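(* Let $H(x,y)=A(x)+B(x)y^{2m}$ be as in the context, let $s\in\mathbb N$ with $s\geq 1$, and let $f_0,f_1,\ldots,f_{n-1}$ be analytic functions on $(x_\ell,x_r)$. Consider the Abelian integrals $$I_i(h)=\int_{\gamma_h}f_i(x)\,y^{2s-1}\,dx,\qquad i=0,1,\ldots,n-1,$$ where, for each $h\in(0,h_0)$, $\gamma_h$ is the oval surrounding the origin inside the level curve $\{A(x)+B(x)y^{2m}=h\}$. Let $\sigma$ be the involution associated to $A$ and define $$\ell_i=\mathscr B_{\sigma}\left(\frac{f_i}{A'B^{\frac{2s-1}{2m}}}\right).$$ Then $(I_0,I_1,\ldots,I_{n-1})$ is an ECT-system on $(0,h_0)$ if $s>m(n-2)$ and $(\ell_0,\ell_1,\ldots,\ell_{n-1})$ is a CT-system on $(0,x_r)$.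
   Context: Setting. $H$ is a real analytic function on an open subset of the plane having a local minimum at the origin, with $H(0,0)=0$, and here $H(x,y)=A(x)+B(x)y^{2m}$ with $m\ge1$ an integer and $A,B$ analytic; $A(0)=0$. A punctured neighbourhood $\mathcal P$ of the origin (the period annulus) is foliated by ovals (closed curves surrounding the origin) $\gamma_h\subset\{H(x,y)=h\}$, parameterized by the energy levels $h\in(0,h_0)$ for some $h_0\in(0,+\infty]$. The projection of $\mathcal P$ on the $x$-axis is denoted $(x_\ell,x_r)$. In this situation $B(x)>0$ on $(x_\ell,x_r)$, $A$ has a local minimum at $x=0$, and $xA'(x)>0$ for all $x\in(x_\ell,x_r)\setminus\{0\}$. Involution. A map $\sigma$ is an involution if $\sigma\circ\sigma=Id$ and $\sigma\neq Id$. The involution associated to $A$ is the analytic involution $\sigma$ of $(x_\ell,x_r)$ with $A(x)=A(\sigma(x))$ for all $x\in(x_\ell,x_r)$; it fixes $0$. Balance. For a function $\kappa$, $\mathscr B_\sigma(\kappa)(x)=\kappa(x)-\kappa(\sigma(x))$. Chebyshev systems. Let $f_0,\ldots,f_{n-1}$ be analytic functions on an open interval $L$. $(f_0,\ldots,f_{n-1})$ is a T-system on $L$ if any nontrivial linear combination $\alpha_0f_0+\cdots+\alpha_{n-1}f_{n-1}$ has at most $n-1$ isolated zeros on $L$. It is a CT-system on $L$ if $(f_0,\ldots,f_{k-1})$ is a T-system on $L$ for all $k=1,\ldots,n$. It is an ECT-system on $L$ if, for all $k=1,\ldots,n$, any nontrivial linear combination $\alpha_0f_0+\cdots+\alpha_{k-1}f_{k-1}$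 has at most $k-1$ isolated zeros on $L$ counted with multiplicities. As usual, in T-, CT- and ECT-systems a linear combination with coefficients not all zero is understood not to vanish identically, so that: CT-system on $L$ is equivalent to $\det(f_j(x_i))_{0\le i,j\le k-1}\neq0$ for all $k=1,\ldots,n$ and all pairwise distinct $x_0,\ldots,x_{k-1}\in L$; and ECT-system on $L$ is equivalent to the Wronskian $\det(f_j^{(i)}(x))_{0\le i,j\le k-1}\neq 0$ for all $k=1,\ldots,n$ and all $x\in L$. *)

theory Defs
  imports "HOL-Complex_Analysis.Complex_Analysis"
begin

definition real_analytic_on :: "(real \<Rightarrow> real) \<Rightarrow> real set \<Rightarrow> bool"  (infix \<open>real'_analytic'_on\<close> 50)
  where "f real_analytic_on S \<longleftrightarrow> (\<forall>x\<in>S. \<exists>F. (\<lambda>t. f (x + t)) has_fps_expansion F)"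


subsection \<open>Chebyshev systems\<close>

definition lin_comb :: "nat \<Rightarrow> (nat \<Rightarrow> real) \<Rightarrow> (nat \<Rightarrow> real \<Rightarrow> real) \<Rightarrow> real \<Rightarrow> real"
  where "lin_comb n \<alpha> f = (\<lambda>x. \<Sum>j<n. \<alpha> j * f j x)"

definition isolated_zeros :: "(real \<Rightarrow> real) \<Rightarrow> real set \<Rightarrow> real set"
  where "isolated_zeros g L = {x. x isolated_in {z \<in> L. g z = 0}}"

text \<open>The order of vanishing; only meaningful where \<open>g\<close> is analytic and does not vanish
  identically near \<open>x\<close>.\<close>

definition zero_mult :: "(real \<Rightarrow> real) \<Rightarrow> real \<Rightarrow> nat"
  where "zero_mult g x = (LEAST k. (deriv ^^ k) g x \<noteq> 0)"

text \<open>In both kinds of systems below, a combination with coefficients not all zero is required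
  not to vanish identically on \<open>L\<close>; without this clause linearly dependent families would not be
  excluded, since the zero function has no isolated zeros. ``At most \<open>n - 1\<close>'' is written
  ``\<open>< n\<close>'' to avoid truncated subtraction.\<close>

definition T_system :: "nat \<Rightarrow> (nat \<Rightarrow> real \<Rightarrow> real) \<Rightarrow> real set \<Rightarrow> bool"
  where "T_system n f L \<longleftrightarrow>
    (\<forall>j<n. f j real_analytic_on L) \<and>
    (\<forall>\<alpha>. (\<exists>j<n. \<alpha> j \<noteq> 0) \<longrightarrow>
      (\<exists>x\<in>L. lin_comb n \<alpha> f x \<noteq> 0) \<and>
      finite (isolated_zeros (lin_comb n \<alpha> f) L) \<and>
      card (isolated_zeros (lin_comb n \<alpha> f) L) < n)"

definition CT_system :: "nat \<Rightarrow> (nat \<Rightarrow> real \<Rightarrow> real) \<Rightarrow> real set \<Rightarrow> bool"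
  where "CT_system n f L \<longleftrightarrow> (\<forall>k\<in>{1..n}. T_system k f L)"

definition ECT_system :: "nat \<Rightarrow> (nat \<Rightarrow> real \<Rightarrow> real) \<Rightarrow> real set \<Rightarrow> bool"
  where "ECT_system n f L \<longleftrightarrow>
    (\<forall>j<n. f j real_analytic_on L) \<and>
    (\<forall>k\<in>{1..n}. \<forall>\<alpha>. (\<exists>j<k. \<alpha> j \<noteq> 0) \<longrightarrow>
      (\<exists>x\<in>L. lin_comb k \<alpha> f x \<noteq> 0) \<and>
      finite (isolated_zeros (lin_comb k \<alpha> f) L) \<and>
      (\<Sum>x\<in>isolated_zeros (lin_comb k \<alpha> f) L. zero_mult (lin_comb k \<alpha> f) x) < k)"


subsection \<open>Involution and balance\<close>

definition associated_involution ::
    "(real \<Rightarrow> real) \<Rightarrow> real set \<Rightarrow> (real \<Rightarrow> real) \<Rightarrow> bool"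
  where "associated_involution A J \<sigma> \<longleftrightarrow>
    \<sigma> \<in> J \<rightarrow> J \<and> \<sigma> real_analytic_on J \<and>
    (\<forall>x\<in>J. \<sigma> (\<sigma> x) = x) \<and> (\<exists>x\<in>J. \<sigma> x \<noteq> x) \<and>
    (\<forall>x\<in>J. A x = A (\<sigma> x))"

definition balance :: "(real \<Rightarrow> real) \<Rightarrow> (real \<Rightarrow> real) \<Rightarrow> real \<Rightarrow> real"
  where "balance \<sigma> \<kappa> = (\<lambda>x. \<kappa> x - \<kappa> (\<sigma> x))"


subsection \<open>Period annulus and Abelian integrals\<close>

text \<open>The plane is identified with \<^typ>\<open>complex\<close>, with coordinates \<open>x = Re z\<close>, \<open>y = Im z\<close>.\<close>

definition hamiltonian ::
    "(real \<Rightarrow> real) \<Rightarrow> (real \<Rightarrow> real) \<Rightarrow> nat \<Rightarrow> complex \<Rightarrow> real"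
  where "hamiltonian A B m z = A (Re z) + B (Re z) * Im z ^ (2 * m)"

text \<open>A piecewise \<open>C\<^sup>1\<close> parametrization of a Jordan curve surrounding the origin.\<close>

definition oval :: "(real \<Rightarrow> complex) \<Rightarrow> bool"
  where "oval c \<longleftrightarrow>
    valid_path c \<and> simple_path c \<and> pathfinish c = pathstart c \<and> 0 \<in> inside (path_image c)"

text \<open>The line integral of \<open>g(x, y) dx\<close> along a path.\<close>

definition line_integral_dx :: "(real \<Rightarrow> real \<Rightarrow> real) \<Rightarrow> (real \<Rightarrow> complex) \<Rightarrow> real"
  where "line_integral_dx g c =
    integral {0..1} (\<lambda>t. g (Re (c t)) (Im (c t)) *
      vector_derivative (\<lambda>u. Re (c u)) (at t within {0..1}))"

definition abelian_integral ::
    "(real \<Rightarrow> real) \<Rightarrow> nat \<Rightarrow> (real \<Rightarrow> real \<Rightarrow> complex) \<Rightarrow> real \<Rightarrow> real"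
  where "abelian_integral f s \<gamma> h = line_integral_dx (\<lambda>x y. f x * y ^ (2 * s - 1)) (\<gamma> h)"

text \<open>The punctured neighbourhood of the origin swept out by the ovals \<open>\<gamma> h\<close>, \<open>0 < h < h0\<close>.
  The ovals are disjoint because they lie on different levels of the Hamiltonian.\<close>

definition annulus :: "(real \<Rightarrow> real \<Rightarrow> complex) \<Rightarrow> ereal \<Rightarrow> complex set"
  where "annulus \<gamma> h0 = (\<Union>h\<in>einterval 0 h0. path_image (\<gamma> h))"

text \<open>The Hamiltonian is considered on the strip over the projection \<open>(xl, xr)\<close> of the annulus,
  the bounds being possibly infinite. The last condition says that the ovals are oriented
  consistently, all clockwise or all counterclockwise; the choice only affects the common sign
  of the integrals.\<close>

locale period_annulus =
  fixes A B :: "real \<Rightarrow> real" and m :: nat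
    and \<gamma> :: "real \<Rightarrow> real \<Rightarrow> complex" and xl xr h0 :: ereal
  assumes m_pos: "1 \<le> m"
    and A_analytic: "A real_analytic_on einterval xl xr"
    and B_analytic: "B real_analytic_on einterval xl xr"
    and A_0: "A 0 = 0"
    and local_min: "\<forall>\<^sub>F z in nhds 0. hamiltonian A B m 0 \<le> hamiltonian A B m z"
    and h0_pos: "0 < h0"
    and ovals: "\<And>h. h \<in> einterval 0 h0 \<Longrightarrow> oval (\<gamma> h)"
    and levels: "\<And>h z. h \<in> einterval 0 h0 \<Longrightarrow> z \<in> path_image (\<gamma> h) \<Longrightarrow> hamiltonian A B m z = h"
    and neighbourhood: "0 \<notin> annulus \<gamma> h0" "open (insert 0 (annulus \<gamma> h0))"
    and projection: "Re ` annulus \<gamma> h0 = einterval xl xr"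
    and B_pos: "\<And>x. x \<in> einterval xl xr \<Longrightarrow> 0 < B x"
    and A_deriv_pos: "\<And>x. x \<in> einterval xl xr - {0} \<Longrightarrow> 0 < x * deriv A x"
    and orientation: "\<And>h h'. h \<in> einterval 0 h0 \<Longrightarrow> h' \<in> einterval 0 h0 \<Longrightarrow>
      winding_number (\<gamma> h) 0 = winding_number (\<gamma> h') 0"

end

theory Submission
  imports Defs
begin

text \<open>
  Put \<open>p = (2s - 1) / (2m)\<close>. The oval at level \<open>h\<close> consists of two graphs
  \<open>y = \<plusminus> ((h - A x) / B x) powr (1 / (2m))\<close>, so an Abelian integral is, up to sign, twice an
  integral over the interval between the two points of the oval on the \<open>x\<close>-axis. Folding the left half
  of that interval onto the right half by \<open>\<sigma>\<close> turns it into a constant multiple of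
  \<open>J\<^sub>p(h) = \<integral> \<ell>(x) A'(x) (h - A(x)) powr p dx\<close>, taken from \<open>0\<close> to the positive solution of
  \<open>A(x) = h\<close>. In the energy variable \<open>A(x)\<close> this is a Riemann--Liouville integral of order
  \<open>p + 1\<close> of the density \<open>\<ell>\<close>. The constant is, up to sign, twice the winding number of the ovals, hence the same
  for all \<open>h\<close>.

  The heart of the matter is a variation diminishing property: if \<open>\<ell>\<close> has at most \<open>N\<close> zeros,
  \<open>p > 0\<close> and \<open>p > N - 1\<close>, then \<open>J\<^sub>p\<close> has at most \<open>N\<close> zeros counted with multiplicity
  (\<open>J_zero_count\<close>, \<open>J_zeros_le_density_zeros\<close>). For a sign change of the density at energy \<open>c\<close>,
  \<open>(h - c) J\<^sub>p'(h) - p J\<^sub>p(h)\<close> is again an integral of the same kind: the exponent is \<open>p - 1\<close> and the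
  density carries the additional factor \<open>p (A - c)\<close>, which removes the sign change
  (\<open>J_weighted_derivative\<close>). On the other hand this expression is, up to a nonvanishing factor,
  the derivative of \<open>J\<^sub>p(h) / \<bar>h - c\<bar> powr p\<close>. Rolle's theorem on either side of \<open>c\<close>, helped on the
  left by \<open>J\<^sub>p(0) = 0\<close>, shows that it has at most one zero fewer than \<open>J\<^sub>p\<close>
  (\<open>zeros_le_Suc_zeros_of_R\<close>). An induction on the number of sign changes therefore reduces everything
  to densities with at most one sign change. With none, \<open>J\<^sub>p\<close> has no zero. With one,
  \<open>J\<^sub>p(h) / (h - c) powr p\<close> is strictly monotone on \<open>h > c\<close> while \<open>J\<^sub>p\<close> does not vanish on
  \<open>h \<le> c\<close>. Treating this case directly keeps every exponent positive, so that no singular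
  integral occurs. A combination of
  the first \<open>k \<le> n\<close> functions \<open>\<ell>\<^sub>i\<close> has at most \<open>k - 1\<close> zeros, and \<open>s > m (n - 2)\<close> says that \<open>p > n - 2\<close>,
  which is what the induction needs.

  Analyticity of \<open>J\<^sub>p\<close> (\<open>J_analytic\<close>) is proved by extending it holomorphically near each energy; the
  upper limit is moved away by a substitution that scales a short interval next to it to
  the unit interval.
\<close>

section \<open>Real analytic functions of one variable\<close>

text \<open>
  The coefficients of the real power series at \<open>x\<close>, read as complex numbers, have the same radius of
  convergence.
\<close>

lemma real_analytic_extends_holomorphically:
  assumes "f real_analytic_on S" "x \<in> S"
  obtains F r where "r > 0" "F holomorphic_on ball (complex_of_real x) r"
    "\<And>t. \<bar>t - x\<bar> < r \<Longrightarrow> F (of_real t) = of_real (f t)"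
proof -
  from assms obtain G where G: "(\<lambda>t. f (x + t)) has_fps_expansion G"
    unfolding real_analytic_on_def by blast
  define Gc where "Gc = Abs_fps (\<lambda>n. complex_of_real (fps_nth G n))"
  have "conv_radius (\<lambda>n. norm (fps_nth Gc n)) = conv_radius (\<lambda>n. norm (fps_nth G n))"
    by (simp add: Gc_def)
  then have radius: "fps_conv_radius Gc = fps_conv_radius G"
    unfolding fps_conv_radius_def conv_radius_norm .
  from G obtain e where e: "e > 0" "\<And>t. \<bar>t\<bar> < e \<Longrightarrow> eval_fps G t = f (x + t)"
    unfolding has_fps_expansion_def eventually_nhds_metric by (auto simp: dist_real_def)
  from G have "fps_conv_radius G > 0" by (simp add: has_fps_expansion_def)
  then obtain d where d: "0 < ereal d" "ereal d < fps_conv_radius G"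
    using ereal_dense2 by blast
  define r where "r = min d e"
  have "r > 0" using d e by (auto simp: r_def)
  moreover have "(\<lambda>z. eval_fps Gc (z - of_real x)) holomorphic_on ball (of_real x) r"
  proof (rule holomorphic_on_compose_gen[where g = "eval_fps Gc" and f = "\<lambda>z. z - of_real x",
        unfolded comp_def])
    show "eval_fps Gc holomorphic_on eball 0 (fps_conv_radius Gc)"
      by (intro holomorphic_intros) auto
    show "(\<lambda>z. z - complex_of_real x) ` ball (complex_of_real x) r \<subseteq> eball 0 (fps_conv_radius Gc)"
    proof clarsimp
      fix z assume "dist (complex_of_real x) z < r"
      then have "ereal (cmod (z - of_real x)) < ereal d"
        by (simp add: r_def dist_norm norm_minus_commute)
      also have "\<dots> < fps_conv_radius Gc" using d radius by simp
      finally show "ereal (cmod (z - of_real x)) < fps_conv_radius Gc" .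
    qed
  qed (intro holomorphic_intros)
  moreover have "eval_fps Gc (of_real t - of_real x) = of_real (f t)" if t: "\<bar>t - x\<bar> < r" for t
  proof -
    have "ereal (norm (t - x)) < ereal d" using t by (simp add: r_def)
    also have "\<dots> < fps_conv_radius G" using d by simp
    finally have "summable (\<lambda>n. fps_nth G n * (t - x) ^ n)"
      by (rule summable_fps)
    then have "eval_fps Gc (of_real (t - x)) = of_real (eval_fps G (t - x))"
      unfolding eval_fps_def Gc_def
      by (subst suminf_of_real) simp_all
    also have "eval_fps G (t - x) = f t" using e(2)[of "t - x"] t by (simp add: r_def)
    finally show ?thesis by simp
  qed
  ultimately show ?thesis by (rule that)
qed

text \<open>
  The real parts of the Taylor coefficients of the extension serve as coefficients. An integral inherits
  holomorphy in a complex parameter from its integrand, so this criterion gives the analyticity of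
  \<open>J\<close> below.
\<close>

lemma real_analytic_if_extends_holomorphically:
  assumes "r > 0" "F holomorphic_on ball (complex_of_real x) r"
    and real: "\<And>t. \<bar>t - x\<bar> < r \<Longrightarrow> F (of_real t) = of_real (f t)"
  shows "\<exists>G. (\<lambda>t. f (x + t)) has_fps_expansion G"
proof -
  define F0 where "F0 = (\<lambda>z. F (of_real x + z))"
  have hol: "F0 holomorphic_on ball 0 r"
    unfolding F0_def
    by (rule holomorphic_on_compose_gen[where g = F and f = "\<lambda>z. of_real x + z", unfolded comp_def,
          OF _ assms(2)]) (auto intro!: holomorphic_intros simp: dist_norm)
  have exp: "F0 has_fps_expansion fps_expansion F0 0"
    by (rule has_fps_expansion_fps_expansion[OF _ _ hol]) (use assms in auto)
  have "(\<lambda>n. Re (fps_nth (fps_expansion F0 0) n) * t ^ n) sums f (x + t)" if "\<bar>t\<bar> < r" for t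
  proof -
    have "(\<lambda>n. fps_nth (fps_expansion F0 0) n * of_real t ^ n) sums F0 (of_real t)"
      by (rule has_fps_expansion_imp_sums_complex[OF exp, of "ereal r"]) (use hol that in auto)
    then have "(\<lambda>n. Re (fps_nth (fps_expansion F0 0) n * of_real t ^ n)) sums Re (F0 (of_real t))"
      by (rule sums_Re)
    moreover have "F0 (of_real t) = of_real (f (x + t))"
      using real[of "x + t"] that by (simp add: F0_def)
    moreover have "Re (c * of_real t ^ n) = Re c * t ^ n" for c n
      by (simp flip: of_real_power)
    ultimately show ?thesis by simp
  qed
  then have "\<forall>\<^sub>F t in nhds 0. (\<lambda>n. fps_nth (Abs_fps (\<lambda>n. Re (fps_nth (fps_expansion F0 0) n))) n * t ^ n) sums f (x + t)"
    unfolding eventually_nhds_metric using assms(1) by (auto simp: dist_real_def)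
  then show ?thesis by (intro exI has_fps_expansionI)
qed

lemma real_analytic_on_mono: "f real_analytic_on S \<Longrightarrow> T \<subseteq> S \<Longrightarrow> f real_analytic_on T"
  unfolding real_analytic_on_def by blast

lemma real_analytic_on_const: "(\<lambda>_. c) real_analytic_on S"
  unfolding real_analytic_on_def using has_fps_expansion_const by blast

lemma real_analytic_on_mult:
  "f real_analytic_on S \<Longrightarrow> g real_analytic_on S \<Longrightarrow> (\<lambda>x. f x * g x) real_analytic_on S"
  unfolding real_analytic_on_def using has_fps_expansion_mult by blast

lemma real_analytic_on_diff:
  "f real_analytic_on S \<Longrightarrow> g real_analytic_on S \<Longrightarrow> (\<lambda>x. f x - g x) real_analytic_on S"
  unfolding real_analytic_on_def using has_fps_expansion_diff by blast

lemma real_analytic_on_lin_comb: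
  assumes "\<And>j. j < k \<Longrightarrow> f j real_analytic_on S"
  shows "lin_comb k \<alpha> f real_analytic_on S"
  unfolding real_analytic_on_def
proof
  fix x assume "x \<in> S"
  then have "\<forall>j. \<exists>F. j < k \<longrightarrow> (\<lambda>t. f j (x + t)) has_fps_expansion F"
    using assms unfolding real_analytic_on_def by blast
  then obtain F where "\<And>j. j < k \<Longrightarrow> (\<lambda>t. f j (x + t)) has_fps_expansion F j"
    by metis
  then have "(\<lambda>t. lin_comb k \<alpha> f (x + t)) has_fps_expansion (\<Sum>j<k. fps_const (\<alpha> j) * F j)"
    unfolding lin_comb_def by (intro fps_expansion_intros) auto
  then show "\<exists>F. (\<lambda>t. lin_comb k \<alpha> f (x + t)) has_fps_expansion F" by blast
qed

lemma real_analytic_on_cong: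
  assumes "f real_analytic_on S" "open S" "\<And>x. x \<in> S \<Longrightarrow> f x = g x"
  shows "g real_analytic_on S"
  unfolding real_analytic_on_def
proof
  fix x assume x: "x \<in> S"
  then obtain F where F: "(\<lambda>t. f (x + t)) has_fps_expansion F"
    using assms unfolding real_analytic_on_def by blast
  obtain e where "e > 0" "ball x e \<subseteq> S" using assms(2) x open_contains_ball by blast
  then have "\<forall>\<^sub>F t in nhds 0. f (x + t) = g (x + t)"
    unfolding eventually_nhds_metric using assms(3) by (auto simp: dist_real_def subset_iff)
  then have "(\<lambda>t. g (x + t)) has_fps_expansion F"
    using F has_fps_expansion_cong[OF _ refl, of "\<lambda>t. f (x + t)" "\<lambda>t. g (x + t)" F] by simp
  then show "\<exists>F. (\<lambda>t. g (x + t)) has_fps_expansion F" by blast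
qed

lemma real_analytic_on_imp_DERIV:
  assumes "f real_analytic_on S" "x \<in> S"
  shows "(f has_real_derivative deriv f x) (at x)"
proof -
  from assms obtain F where F: "(\<lambda>t. f (x + t)) has_fps_expansion F"
    unfolding real_analytic_on_def by blast
  have "((\<lambda>t. f (x + t)) has_real_derivative eval_fps (fps_deriv F) 0) (at 0)"
  proof (rule DERIV_cong_ev[THEN iffD1, OF refl _ refl])
    show "\<forall>\<^sub>F t in nhds 0. eval_fps F t = f (x + t)" using F by (simp add: has_fps_expansion_def)
    show "(eval_fps F has_real_derivative eval_fps (fps_deriv F) 0) (at 0)"
      using F by (intro has_field_derivative_eval_fps) (auto simp: has_fps_expansion_def zero_ereal_def)
  qed
  then have "(f has_real_derivative eval_fps (fps_deriv F) 0) (at x)"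
    using DERIV_shift[of f _ 0 x] by (simp add: add.commute)
  then show ?thesis using DERIV_imp_deriv by fastforce
qed

lemma real_analytic_on_imp_continuous_on: "f real_analytic_on S \<Longrightarrow> continuous_on S f"
  by (meson DERIV_isCont continuous_at_imp_continuous_on real_analytic_on_imp_DERIV)

lemma real_analytic_on_deriv:
  assumes "f real_analytic_on S"
  shows "deriv f real_analytic_on S"
  unfolding real_analytic_on_def
proof
  fix x assume "x \<in> S"
  then obtain F where F: "(\<lambda>t. f (x + t)) has_fps_expansion F"
    using assms unfolding real_analytic_on_def by blast
  have "((\<lambda>t. f (x + t)) has_real_derivative D) (at t) \<longleftrightarrow> (f has_real_derivative D) (at (x + t))" for D t
    using DERIV_shift[of f D t x] by (simp add: add.commute)
  then have "deriv (\<lambda>t. f (x + t)) = (\<lambda>t. deriv f (x + t))"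
    by (intro ext) (simp only: deriv_def)
  then show "\<exists>F. (\<lambda>t. deriv f (x + t)) has_fps_expansion F"
    using has_fps_expansion_deriv[OF F] by auto
qed

lemma real_analytic_on_higher_deriv:
  "f real_analytic_on S \<Longrightarrow> (deriv ^^ k) f real_analytic_on S"
  by (induction k) (auto intro: real_analytic_on_deriv)

text \<open>zeros\<close>

text \<open>
  Applied to a holomorphic extension, the complex identity theorem leaves only these two possibilities.
\<close>

lemma real_analytic_zero_cases:
  assumes "f real_analytic_on S" "x \<in> S"
  shows "(\<forall>\<^sub>F t in at x. f t \<noteq> 0) \<or> (\<forall>\<^sub>F t in nhds x. f t = 0)"
proof -
  obtain F r where F: "r > 0" "F holomorphic_on ball (complex_of_real x) r"
    "\<And>t. \<bar>t - x\<bar> < r \<Longrightarrow> F (of_real t) = of_real (f t)"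
    using real_analytic_extends_holomorphically[OF assms] by metis
  consider (zero) "\<forall>w\<in>ball (complex_of_real x) r. F w = 0" | (nz) w where "w \<in> ball (complex_of_real x) r" "F w \<noteq> 0"
    by blast
  then show ?thesis
  proof cases
    case zero
    have "f t = 0" if "\<bar>t - x\<bar> < r" for t
    proof -
      have "complex_of_real t \<in> ball (of_real x) r"
        using that by (simp add: dist_real_def abs_minus_commute)
      then have "F (of_real t) = 0" using zero by blast
      then show ?thesis using F(3)[OF that] by simp
    qed
    then have "\<forall>\<^sub>F t in nhds x. f t = 0"
      unfolding eventually_nhds_metric using F(1) by (auto simp: dist_real_def)
    then show ?thesis ..
  next
    case nz
    have "\<forall>\<^sub>F z in at (of_real x). F z \<noteq> 0 \<and> z \<in> ball (complex_of_real x) r"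
      by (rule non_zero_neighbour_alt[OF F(2) open_ball connected_ball _ nz]) (use F(1) in simp)
    then obtain s where s: "s > 0" "\<And>z. z \<noteq> of_real x \<Longrightarrow> dist z (of_real x) < s \<Longrightarrow> F z \<noteq> 0"
      unfolding eventually_at by blast
    have "\<forall>\<^sub>F t in at x. f t \<noteq> 0"
      unfolding eventually_at
    proof (intro exI[of _ "min r s"] conjI ballI impI)
      fix t :: real assume "t \<noteq> x \<and> dist t x < min r s"
      moreover then have "complex_of_real t \<noteq> of_real x" "dist (complex_of_real t) (of_real x) < s"
        by (auto simp: dist_of_real)
      ultimately show "f t \<noteq> 0" using F(3)[of t] s(2)[of t] by (auto simp: dist_real_def)
    qed (use F s in auto)
    then show ?thesis ..
  qed
qed

text \<open>
  The points near which \<open>f\<close> vanishes identically and the points that have a zero-free punctured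
  neighbourhood are two disjoint open sets covering the connected set \<open>X\<close>, and \<open>y\<close> is in the second.
  It follows that the isolated zeros counted in a T-system are all the zeros.
\<close>

lemma real_analytic_zeros_isolated:
  assumes f: "f real_analytic_on X" and X: "open X" "connected X"
    and nz: "y \<in> X" "f y \<noteq> 0"
  shows "isolated_zeros f X = {x \<in> X. f x = 0}"
proof -
  define U where "U = {x \<in> X. \<forall>\<^sub>F t in nhds x. f t = 0}"
  define V where "V = {x \<in> X. \<forall>\<^sub>F t in at x. f t \<noteq> 0}"
  have UV: "U \<union> V = X"
    using real_analytic_zero_cases[OF f] unfolding U_def V_def by blast
  have disj: "U \<inter> V = {}"
  proof -
    have False if "\<forall>\<^sub>F t in nhds x. f t = 0" "\<forall>\<^sub>F t in at x. f t \<noteq> 0" for x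
    proof -
      from that(1) have "\<forall>\<^sub>F t in at x. f t = 0" by (simp add: eventually_nhds_conv_at)
      with that(2) have "\<forall>\<^sub>F t in at x. False" by eventually_elim simp
      then show False by (simp add: trivial_limit_at)
    qed
    then show ?thesis unfolding U_def V_def by blast
  qed
  have "open U"
    unfolding open_subopen[of U]
  proof
    fix x assume "x \<in> U"
    then obtain T where "open T" "x \<in> T" "\<forall>t\<in>T. f t = 0" "x \<in> X"
      unfolding U_def eventually_nhds by blast
    then show "\<exists>T. open T \<and> x \<in> T \<and> T \<subseteq> U"
      by (intro exI[of _ "T \<inter> X"]) (use X in \<open>auto simp: U_def eventually_nhds\<close>)
  qed
  moreover have "open V"
    unfolding open_subopen[of V]
  proof
    fix x assume "x \<in> V"
    then obtain T where T: "open T" "x \<in> T" "\<forall>t\<in>T. t \<noteq> x \<longrightarrow> f t \<noteq> 0" "x \<in> X"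
      unfolding V_def eventually_at_topological by blast
    have "\<forall>\<^sub>F t in at z. f t \<noteq> 0" if "z \<in> T" "z \<noteq> x" for z
      unfolding eventually_at_topological
      by (rule exI[of _ "T - {x}"]) (use T that in auto)
    then show "\<exists>T. open T \<and> x \<in> T \<and> T \<subseteq> V"
      using T \<open>x \<in> V\<close> X by (intro exI[of _ "T \<inter> X"]) (auto simp: V_def)
  qed
  moreover have "y \<in> V" using UV nz unfolding U_def by (auto dest: eventually_nhds_x_imp_x)
  ultimately have "U = {}"
    using X(2) UV disj nz unfolding connected_def by fast
  then have iso: "\<forall>\<^sub>F t in at u. f t \<noteq> 0" if "u \<in> X" for u
    using UV that unfolding V_def by blast
  have "u isolated_in {z \<in> X. f z = 0}" if u: "u \<in> X" "f u = 0" for u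
  proof -
    obtain T where "open T" "u \<in> T" "\<forall>t\<in>T. t \<noteq> u \<longrightarrow> f t \<noteq> 0"
      using iso[OF u(1)] unfolding eventually_at_topological by blast
    then show ?thesis unfolding isolated_in_def using u by (auto intro!: exI[of _ T])
  qed
  then show ?thesis unfolding isolated_zeros_def by (auto simp: isolated_in_def)
qed

section \<open>Multiplicities and a weighted Rolle theorem\<close>

text \<open>
  The bookkeeping of Rolle's theorem with multiplicities. At each point of \<open>T\<close> at most one unit of
  \<open>\<mu>\<close> is lost in passing to \<open>\<nu>\<close>, and the gap to its left neighbour in \<open>insert a T\<close> contains a point
  of \<open>Z\<close> that pays for it. The induction adds the points of \<open>T\<close> in increasing order.
\<close>

lemma interlacing_count:
  fixes T Z :: "real set" and \<mu> \<nu> :: "real \<Rightarrow> nat"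
  assumes "finite T" and Z: "finite Z" "\<And>w. w \<in> Z \<Longrightarrow> 1 \<le> \<nu> w" "\<And>w. w \<notin> Z \<Longrightarrow> \<nu> w = 0"
    and "\<And>z. z \<in> T \<Longrightarrow> a < z"
    and "\<And>x y. x \<in> insert a T \<Longrightarrow> y \<in> T \<Longrightarrow> x < y \<Longrightarrow> \<exists>w\<in>Z. x < w \<and> w < y"
    and "\<And>z. z \<in> T \<Longrightarrow> \<mu> z \<le> Suc (\<nu> z)"
  shows "sum \<mu> T \<le> sum \<nu> {w \<in> Z. a < w \<and> (\<exists>z\<in>T. w \<le> z)}"
  using assms(1,5-)
proof (induction T rule: finite_linorder_max_induct)
  case empty
  then show ?case by simp
next
  case (insert b T)
  define x where "x = Max (insert a T)"
  have x: "x \<in> insert a T" "\<And>y. y \<in> insert a T \<Longrightarrow> y \<le> x"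
    using insert.hyps(1) Max_in[of "insert a T"] Max_ge[of "insert a T"]
    unfolding x_def by (simp_all del: Max_insert)
  have "x < b" using x(1) insert.hyps insert.prems(1) by auto
  then obtain w where w: "w \<in> Z" "x < w" "w < b" using insert.prems(2)[of x b] x(1) by auto
  let ?W = "{w \<in> Z. a < w \<and> (\<exists>z\<in>T. w \<le> z)}"
  let ?V = "{w \<in> Z. a < w \<and> (\<exists>z\<in>insert b T. w \<le> z)}"
  have "sum \<mu> T \<le> sum \<nu> ?W"
    by (rule insert.IH) (use insert.prems in auto)
  moreover have "\<mu> b \<le> \<nu> w + sum \<nu> (Z \<inter> {b})"
  proof -
    have "sum \<nu> (Z \<inter> {b}) = \<nu> b" using Z(3) by (cases "b \<in> Z") auto
    then show ?thesis using insert.prems(3)[of b] Z(2)[OF w(1)] by simp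
  qed
  moreover have "sum \<nu> ?W + (\<nu> w + sum \<nu> (Z \<inter> {b})) \<le> sum \<nu> ?V"
  proof -
    have notin: "w \<notin> ?W" using x(2) w by force
    have below: "v \<le> x" if "v \<in> ?W" for v using that x(2) by force
    have "sum \<nu> ?W + (\<nu> w + sum \<nu> (Z \<inter> {b})) = sum \<nu> (insert w ?W) + sum \<nu> (Z \<inter> {b})"
      using notin Z(1) by simp
    also have "\<dots> = sum \<nu> (insert w ?W \<union> (Z \<inter> {b}))"
      by (rule sum.union_disjoint[symmetric]) (use Z(1) w below \<open>x < b\<close> in fastforce)+
    also have "\<dots> \<le> sum \<nu> ?V"
    proof (rule sum_mono2)
      have "a < w" "a < b" using x(2)[of a] w(2,3) by auto
      then show "insert w ?W \<union> (Z \<inter> {b}) \<subseteq> ?V" using w by auto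
    qed (use Z(1) in auto)
    finally show ?thesis .
  qed
  moreover have "sum \<mu> (insert b T) = \<mu> b + sum \<mu> T"
    using insert.hyps by (subst sum.insert) auto
  ultimately show ?case by linarith
qed

lemma deriv_vanishes_below_zero_mult: "j < zero_mult g x \<Longrightarrow> (deriv ^^ j) g x = 0"
  unfolding zero_mult_def using not_less_Least by blast

lemma deriv_zero_mult_neq_0: "(deriv ^^ k) g x \<noteq> 0 \<Longrightarrow> (deriv ^^ zero_mult g x) g x \<noteq> 0"
  unfolding zero_mult_def by (rule LeastI)

lemma zero_mult_eq_0: "g x \<noteq> 0 \<Longrightarrow> zero_mult g x = 0"
  unfolding zero_mult_def by (rule Least_equality) auto

lemma zero_mult_ge_1: "g x = 0 \<Longrightarrow> (deriv ^^ k) g x \<noteq> 0 \<Longrightarrow> 1 \<le> zero_mult g x"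
  using deriv_zero_mult_neq_0[of k g x] by (cases "zero_mult g x") auto

lemma higher_deriv_cong_open:
  assumes "open S" "\<And>x. x \<in> S \<Longrightarrow> f x = g x" "x \<in> S"
  shows "(deriv ^^ k) f x = (deriv ^^ k) g x"
  using assms(3)
proof (induction k arbitrary: x)
  case (Suc k)
  have "\<forall>\<^sub>F y in nhds x. (deriv ^^ k) f y = (deriv ^^ k) g y"
    using Suc assms(1) eventually_nhds by blast
  then show ?case by (simp add: deriv_cong_ev)
qed (use assms in auto)

text \<open>
  On \<open>h > c\<close> the function \<open>R\<close> is \<open>(h - c) powr (p + 1)\<close> times the derivative of
  \<open>u h / (h - c) powr p\<close>, and similarly on \<open>h < c\<close>; written as below, it also makes sense at
  \<open>c\<close> itself. The set \<open>H\<close> stands for an interval that starts at \<open>0\<close>.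
\<close>

locale weighted_rolle =
  fixes H :: "real set" and u R :: "real \<Rightarrow> real" and c p :: real
  assumes H_open: "open H" and H_pos: "\<And>h. h \<in> H \<Longrightarrow> 0 < h"
    and H_down: "\<And>h t. h \<in> H \<Longrightarrow> 0 < t \<Longrightarrow> t \<le> h \<Longrightarrow> t \<in> H"
    and u_analytic: "u real_analytic_on H"
    and u_cont: "continuous_on (insert 0 H) u" and u_0: "u 0 = 0"
    and c: "c \<in> H"
    and R: "\<And>h. h \<in> H \<Longrightarrow> R h = (h - c) * deriv u h - p * u h"
begin

text \<open>
  This formula says at once how orders of vanishing compare: away from \<open>c\<close> the order drops by at most
  one in passing from \<open>u\<close> to \<open>R\<close>, and at \<open>c\<close> it does not drop. It also shows that \<open>u\<close> cannot be flat at
  a point where \<open>R\<close> is not.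
\<close>

lemma R_higher_deriv:
  assumes "z \<in> H"
  shows "(deriv ^^ j) R z = (z - c) * (deriv ^^ Suc j) u z + (real j - p) * (deriv ^^ j) u z"
  using assms
proof (induction j arbitrary: z)
  case (Suc j)
  have der: "((deriv ^^ i) u has_real_derivative (deriv ^^ Suc i) u z) (at z)" for i
    using real_analytic_on_imp_DERIV[OF real_analytic_on_higher_deriv[OF u_analytic] Suc.prems]
    by simp
  have "((\<lambda>z. (z - c) * (deriv ^^ Suc j) u z + (real j - p) * (deriv ^^ j) u z) has_real_derivative
      ((z - c) * (deriv ^^ Suc (Suc j)) u z + (real (Suc j) - p) * (deriv ^^ Suc j) u z)) (at z)"
    by (rule derivative_eq_intros der refl)+ (simp add: algebra_simps)
  then have "((deriv ^^ j) R has_real_derivative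
      ((z - c) * (deriv ^^ Suc (Suc j)) u z + (real (Suc j) - p) * (deriv ^^ Suc j) u z)) (at z)"
    by (rule has_field_derivative_transform_within_open[OF _ H_open Suc.prems])
       (simp only: Suc.IH)
  then show ?case by (simp add: DERIV_imp_deriv)
qed (simp add: R)

lemma zero_of_R_between:
  assumes xy: "x \<in> insert 0 H" "y \<in> H" "x < y" "u x = 0" "u y = 0" and c: "c < x \<or> y < c"
  shows "\<exists>w\<in>H. R w = 0 \<and> x < w \<and> w < y"
proof -
  \<comment> \<open>The sign makes the base of the power positive on the side of \<open>c\<close> that contains \<open>x\<close> and \<open>y\<close>.\<close>
  define s :: real where "s = (if c < x then 1 else -1)"
  have s: "s * (t - c) > 0" if "t \<in> {x..y}" for t using that c by (auto simp: s_def)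
  have s2: "s \<noteq> 0" by (simp add: s_def)
  have "0 \<le> x" using xy(1) H_pos by (auto intro: less_imp_le)
  then have inner: "t \<in> H" if "x < t" "t \<le> y" for t
    using H_down[OF xy(2)] that by simp
  have sub: "{x..y} \<subseteq> insert 0 H"
  proof
    fix t assume "t \<in> {x..y}"
    then show "t \<in> insert 0 H" using inner[of t] xy(1) by (cases "t = x") auto
  qed
  define v where "v = (\<lambda>t. u t * (s * (t - c)) powr (-p))"
  define v' where "v' = (\<lambda>t. deriv u t * (s * (t - c)) powr (-p)
       + u t * (-p * (s * (t - c)) powr (-p - 1) * s))"
  have der: "(v has_real_derivative v' t) (at t)" if "x < t" "t < y" for t
  proof -
    have pos: "s * (t - c) > 0" using s that by auto
    have u': "(u has_real_derivative deriv u t) (at t)"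
      using real_analytic_on_imp_DERIV[OF u_analytic inner[OF that(1) less_imp_le[OF that(2)]]] .
    show ?thesis unfolding v_def v'_def
      by (rule derivative_eq_intros u' refl pos)+ (simp add: algebra_simps)
  qed
  have "\<exists>t. x < t \<and> t < y \<and> DERIV v t :> 0"
  proof (rule Rolle)
    show "x < y" by fact
    show "v x = v y" using xy by (simp add: v_def)
    show "continuous_on {x..y} v" unfolding v_def
      by (intro continuous_intros continuous_on_subset[OF u_cont sub]) (use s in force)
    show "v differentiable (at t)" if "x < t" "t < y" for t
      using der[OF that] real_differentiable_def by blast
  qed
  then obtain t where t: "x < t" "t < y" "DERIV v t :> 0" by blast
  with der DERIV_unique have "v' t = 0" by blast
  have pos: "s * (t - c) > 0" using s t by auto
  have "v' t = (s * (t - c)) powr (-p - 1) * s * R t"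
  proof -
    define P Q where "P = (s * (t - c)) powr (-p)" and "Q = (s * (t - c)) powr (-p - 1)"
    have PQ: "P = Q * (s * (t - c))"
      using powr_add[of "s * (t - c)" "-p - 1" 1] pos by (simp add: P_def Q_def)
    have "v' t = deriv u t * P + u t * (-p * Q * s)" by (simp add: v'_def P_def Q_def)
    also have "\<dots> = Q * s * R t"
      unfolding PQ R[OF inner[OF t(1) less_imp_le[OF t(2)]]] by (simp add: algebra_simps)
    finally show ?thesis by (simp add: Q_def)
  qed
  with \<open>v' t = 0\<close> pos s2 have "R t = 0" by auto
  then show ?thesis using t inner[of t] by auto
qed

text \<open>
  The zeros of \<open>u\<close> are split at \<open>c\<close>. Below \<open>c\<close> the value \<open>u 0 = 0\<close> provides the additional zero
  that Rolle's theorem starts from, and at \<open>c\<close> no multiplicity is lost, so the only loss is the one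
  unit at the smallest zero above \<open>c\<close>.
\<close>

theorem zeros_le_Suc_zeros_of_R:
  assumes R_fin: "finite {z \<in> H. R z = 0}"
    and R_nonflat: "\<And>z. z \<in> H \<Longrightarrow> \<exists>k. (deriv ^^ k) R z \<noteq> 0"
  shows "finite {z \<in> H. u z = 0}"
    and "(\<Sum>z | z \<in> H \<and> u z = 0. zero_mult u z) \<le> Suc (\<Sum>z | z \<in> H \<and> R z = 0. zero_mult R z)"
    and "\<And>z. z \<in> H \<Longrightarrow> \<exists>k. (deriv ^^ k) u z \<noteq> 0"
proof -
  show nonflat: "\<exists>k. (deriv ^^ k) u z \<noteq> 0" if z: "z \<in> H" for z
  proof (rule ccontr)
    assume "\<not> ?thesis"
    then have *: "\<forall>k. (deriv ^^ k) u z = 0" by blast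
    obtain k where "(deriv ^^ k) R z \<noteq> 0" using R_nonflat z by blast
    then show False
      using R_higher_deriv[OF z, of k] *[rule_format, of k] *[rule_format, of "Suc k"] by simp
  qed
  define Z where "Z = {z \<in> H. R z = 0}"
  define \<nu> where "\<nu> = (\<lambda>z. if z \<in> H then zero_mult R z else 0)"
  have Z: "finite Z" "\<And>w. w \<in> Z \<Longrightarrow> 1 \<le> \<nu> w" "\<And>w. w \<notin> Z \<Longrightarrow> \<nu> w = 0"
  proof -
    show "finite Z" using R_fin by (simp add: Z_def)
    show "1 \<le> \<nu> w" if "w \<in> Z" for w
      using that R_nonflat[of w] zero_mult_ge_1[of R w] by (auto simp: Z_def \<nu>_def)
    show "\<nu> w = 0" if "w \<notin> Z" for w
      using that zero_mult_eq_0[of R w] by (auto simp: Z_def \<nu>_def)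
  qed
  have mult: "zero_mult u z \<le> Suc (\<nu> z)" "z = c \<Longrightarrow> zero_mult u z \<le> \<nu> z" if z: "z \<in> H" for z
  proof -
    obtain k where "(deriv ^^ k) R z \<noteq> 0" using R_nonflat z by blast
    then have nz: "(deriv ^^ zero_mult R z) R z \<noteq> 0" by (rule deriv_zero_mult_neq_0)
    show "zero_mult u z \<le> Suc (\<nu> z)"
    proof (rule ccontr)
      assume "\<not> ?thesis"
      then have "Suc (zero_mult R z) < zero_mult u z" using z by (simp add: \<nu>_def)
      then show False
        using nz R_higher_deriv[OF z, of "zero_mult R z"]
          deriv_vanishes_below_zero_mult[of "Suc (zero_mult R z)" u z]
          deriv_vanishes_below_zero_mult[of "zero_mult R z" u z] by simp
    qed
    show "zero_mult u z \<le> \<nu> z" if "z = c"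
    proof (rule ccontr)
      assume "\<not> ?thesis"
      then have "zero_mult R z < zero_mult u z" using z by (simp add: \<nu>_def)
      then show False
        using nz R_higher_deriv[OF z, of "zero_mult R z"] that
          deriv_vanishes_below_zero_mult[of "zero_mult R z" u z] by simp
    qed
  qed
  have bound: "sum (zero_mult u) T \<le> Suc (sum \<nu> Z)" if T: "finite T" "T \<subseteq> {z \<in> H. u z = 0}" for T
  proof -
    define T1 T2 T3 where "T1 = {z \<in> T. z < c}" and "T2 = {z \<in> T. c < z}" and "T3 = T \<inter> {c}"
    have fin: "finite T1" "finite T2" "finite T3" using T unfolding T1_def T2_def T3_def by auto
    have Teq: "T = T1 \<union> T2 \<union> T3" unfolding T1_def T2_def T3_def by auto
    have split: "sum (zero_mult u) T = sum (zero_mult u) T1 + sum (zero_mult u) T2 + sum (zero_mult u) T3"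
      unfolding Teq using fin by (subst sum.union_disjoint; auto simp: T1_def T2_def T3_def)+
    have s1: "sum (zero_mult u) T1 \<le> sum \<nu> {w \<in> Z. w < c}"
    proof -
      have "sum (zero_mult u) T1 \<le> sum \<nu> {w \<in> Z. 0 < w \<and> (\<exists>z\<in>T1. w \<le> z)}"
      proof (rule interlacing_count[OF fin(1) Z])
        fix x y assume "x \<in> insert 0 T1" "y \<in> T1" "x < y"
        then show "\<exists>w\<in>Z. x < w \<and> w < y"
          using zero_of_R_between[of x y] T u_0 unfolding T1_def Z_def by auto
      qed (use T mult H_pos in \<open>auto simp: T1_def\<close>)
      also have "\<dots> \<le> sum \<nu> {w \<in> Z. w < c}"
        by (rule sum_mono2) (use Z(1) in \<open>auto simp: T1_def\<close>)
      finally show ?thesis .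
    qed
    have s2: "sum (zero_mult u) T2 \<le> Suc (sum \<nu> {w \<in> Z. c < w})"
    proof (cases "T2 = {}")
      case False
      define a where "a = Min T2"
      have a: "a \<in> T2" "\<And>z. z \<in> T2 \<Longrightarrow> a \<le> z" using fin False by (auto simp: a_def)
      have "sum (zero_mult u) (T2 - {a}) \<le> sum \<nu> {w \<in> Z. a < w \<and> (\<exists>z\<in>T2 - {a}. w \<le> z)}"
      proof (rule interlacing_count[OF _ Z])
        fix x y assume "x \<in> insert a (T2 - {a})" "y \<in> T2 - {a}" "x < y"
        then show "\<exists>w\<in>Z. x < w \<and> w < y"
          using zero_of_R_between[of x y] T a unfolding T2_def Z_def by auto
      qed (use T mult fin a in \<open>auto simp: T2_def le_less\<close>)
      moreover have "zero_mult u a \<le> Suc (\<nu> a)" using mult a T by (auto simp: T2_def)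
      moreover have "\<nu> a + sum \<nu> {w \<in> Z. a < w \<and> (\<exists>z\<in>T2 - {a}. w \<le> z)} \<le> sum \<nu> {w \<in> Z. c < w}"
      proof (cases "a \<in> Z")
        case True
        have "\<nu> a + sum \<nu> {w \<in> Z. a < w \<and> (\<exists>z\<in>T2 - {a}. w \<le> z)}
            = sum \<nu> (insert a {w \<in> Z. a < w \<and> (\<exists>z\<in>T2 - {a}. w \<le> z)})"
          using Z(1) by simp
        also have "\<dots> \<le> sum \<nu> {w \<in> Z. c < w}"
          by (rule sum_mono2) (use Z(1) a True in \<open>auto simp: T2_def\<close>)
        finally show ?thesis .
      next
        case False
        have "sum \<nu> {w \<in> Z. a < w \<and> (\<exists>z\<in>T2 - {a}. w \<le> z)} \<le> sum \<nu> {w \<in> Z. c < w}"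
          by (rule sum_mono2) (use Z(1) a in \<open>auto simp: T2_def\<close>)
        then show ?thesis using Z(3)[OF False] by simp
      qed
      moreover have "sum (zero_mult u) T2 = zero_mult u a + sum (zero_mult u) (T2 - {a})"
        using fin a by (simp add: sum.remove)
      ultimately show ?thesis by linarith
    qed simp
    have s3: "sum (zero_mult u) T3 \<le> sum \<nu> (Z \<inter> {c})"
    proof -
      have "sum \<nu> (Z \<inter> {c}) = \<nu> c" using Z(3) by (cases "c \<in> Z") auto
      moreover have "sum (zero_mult u) T3 \<le> zero_mult u c" by (cases "c \<in> T") (auto simp: T3_def)
      ultimately show ?thesis using mult(2)[OF c] by simp
    qed
    have "sum \<nu> {w \<in> Z. w < c} + sum \<nu> {w \<in> Z. c < w} + sum \<nu> (Z \<inter> {c})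
        = sum \<nu> ({w \<in> Z. w < c} \<union> {w \<in> Z. c < w} \<union> (Z \<inter> {c}))"
      using Z(1) by (subst sum.union_disjoint; auto)+
    also have "{w \<in> Z. w < c} \<union> {w \<in> Z. c < w} \<union> (Z \<inter> {c}) = Z" by auto
    finally show ?thesis using split s1 s2 s3 by linarith
  qed
  show fin: "finite {z \<in> H. u z = 0}"
  proof (rule finite_if_finite_subsets_card_bdd[THEN conjunct1])
    fix T assume T: "T \<subseteq> {z \<in> H. u z = 0}" "finite T"
    have "card T = (\<Sum>z\<in>T. 1)" by simp
    also have "\<dots> \<le> sum (zero_mult u) T"
    proof (rule sum_mono)
      fix z assume "z \<in> T"
      with T have "z \<in> H" "u z = 0" by auto
      with nonflat[of z] show "1 \<le> zero_mult u z" using zero_mult_ge_1 by blast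
    qed
    also have "\<dots> \<le> Suc (sum \<nu> Z)" using bound T by blast
    finally show "card T \<le> Suc (sum \<nu> Z)" .
  qed
  have "sum \<nu> Z = sum (zero_mult R) Z" by (rule sum.cong) (auto simp: Z_def \<nu>_def)
  then show "(\<Sum>z | z \<in> H \<and> u z = 0. zero_mult u z) \<le> Suc (\<Sum>z | z \<in> H \<and> R z = 0. zero_mult R z)"
    using bound[OF fin] by (simp add: Z_def)
qed

end

section \<open>Sign changes\<close>

lemma constant_sign_if_no_zero:
  fixes g :: "real \<Rightarrow> real"
  assumes "connected X" "continuous_on X g" "\<And>x. x \<in> X \<Longrightarrow> g x \<noteq> 0"
  obtains \<epsilon> :: real where "\<epsilon> \<in> {1, -1}" "\<And>x. x \<in> X \<Longrightarrow> 0 < \<epsilon> * g x"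
proof -
  have conn: "connected (g ` X)" using assms by (intro connected_continuous_image)
  have False if "x \<in> X" "y \<in> X" "g x < 0" "g y > 0" for x y
    using connectedD_interval[OF conn, of "g x" "g y" 0] assms(3) that by fastforce
  then have "(\<forall>x\<in>X. g x > 0) \<or> (\<forall>x\<in>X. g x < 0)"
    using assms(3) by (meson linorder_neqE)
  then show ?thesis using that[of 1] that[of "-1"] by auto
qed

text \<open>
  Only the zeros at which \<open>g\<close> changes sign enter \<open>S\<close>. The induction removes the largest zero \<open>c\<close>: it has
  to be added to \<open>S\<close> exactly if the sign of \<open>g\<close> above \<open>c\<close> differs from the sign that the part below
  \<open>c\<close> prescribes.
\<close>

lemma sign_changes:
  fixes g :: "real \<Rightarrow> real"
  assumes "connected X" "continuous_on X g" "finite {x \<in> X. g x = 0}"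
  obtains \<epsilon> :: real and S where "\<epsilon> \<in> {1, -1}" "S \<subseteq> {x \<in> X. g x = 0}"
    "\<And>x. x \<in> X \<Longrightarrow> 0 \<le> \<epsilon> * g x * (\<Prod>s\<in>S. x - s)"
proof -
  have "\<exists>\<epsilon> S. \<epsilon> \<in> {1, -1} \<and> S \<subseteq> {x \<in> X. g x = 0} \<and> (\<forall>x\<in>X. 0 \<le> \<epsilon> * g x * (\<Prod>s\<in>S. x - s))"
    using assms
  proof (induction "card {x \<in> X. g x = 0}" arbitrary: X)
    case 0
    then have "\<And>x. x \<in> X \<Longrightarrow> g x \<noteq> 0" by auto
    then obtain \<epsilon> where "\<epsilon> \<in> {1, -1}" "\<And>x. x \<in> X \<Longrightarrow> 0 < \<epsilon> * g x"
      using constant_sign_if_no_zero[of X g] 0 by metis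
    then show ?case by (intro exI[of _ \<epsilon>] exI[of _ "{}"]) (auto simp: less_imp_le)
  next
    case (Suc n)
    define Z where "Z = {x \<in> X. g x = 0}"
    define c where "c = Max Z"
    have "Z \<noteq> {}" using Suc.hyps(2) unfolding Z_def by force
    have fin: "finite Z" using Suc.prems unfolding Z_def by simp
    have c: "c \<in> X" "g c = 0" "\<And>z. z \<in> Z \<Longrightarrow> z \<le> c"
      using Max_in[OF fin \<open>Z \<noteq> {}\<close>] Max_ge[OF fin] unfolding c_def Z_def by auto
    define L U where "L = X \<inter> {..<c}" and "U = X \<inter> {c<..}"
    have conn: "connected L" "connected U"
      using Suc.prems(1) unfolding L_def U_def by (auto simp: is_interval_connected_1[symmetric] intro!: is_interval_Int)
    have cont: "continuous_on L g" "continuous_on U g"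
      using Suc.prems(2) unfolding L_def U_def by (auto intro: continuous_on_subset)
    have ZL: "{x \<in> L. g x = 0} = Z - {c}" using c unfolding L_def Z_def by force
    have card: "n = card (Z - {c})"
      using Suc.hyps(2) c fin unfolding Z_def by (subst card_Diff_singleton) auto
    have "\<exists>\<epsilon> S. \<epsilon> \<in> {1, -1} \<and> S \<subseteq> {x \<in> L. g x = 0}
        \<and> (\<forall>x\<in>L. 0 \<le> \<epsilon> * g x * (\<Prod>s\<in>S. x - s))"
      by (rule Suc.hyps(1)) (use card conn cont fin in \<open>simp_all only: ZL finite_Diff\<close>)
    then obtain \<epsilon> S where \<epsilon>: "\<epsilon> \<in> {1, -1}" and S: "S \<subseteq> Z - {c}"
      and sgn: "\<And>x. x \<in> L \<Longrightarrow> 0 \<le> \<epsilon> * g x * (\<Prod>s\<in>S. x - s)"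
      unfolding ZL by blast
    have "g x \<noteq> 0" if "x \<in> U" for x using that c unfolding U_def Z_def by force
    then obtain \<delta> where \<delta>: "\<delta> \<in> {1, -1}" "\<And>x. x \<in> U \<Longrightarrow> 0 < \<delta> * g x"
      using constant_sign_if_no_zero[of U g] conn cont by metis
    have finS: "finite S" "c \<notin> S" using S fin by (auto intro: finite_subset)
    have prod_pos: "0 < (\<Prod>s\<in>S. x - s)" if "x \<in> U" for x
      by (rule prod_pos) (use that S c in \<open>force simp: U_def\<close>)
    have cases: "y \<in> L \<or> y = c \<or> y \<in> U" if "y \<in> X" for y using that unfolding L_def U_def by force
    show ?case
    proof (cases "\<delta> = \<epsilon>")
      case True
      have "0 \<le> \<epsilon> * g x * (\<Prod>s\<in>S. x - s)" if "x \<in> X" for x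
        using cases[OF that] sgn[of x] \<delta>(2)[of x] prod_pos[of x] c(2) True by auto
      then show ?thesis using \<epsilon> S unfolding Z_def by blast
    next
      case False
      then have \<delta>\<epsilon>: "\<delta> = - \<epsilon>" using \<delta> \<epsilon> by auto
      have "0 \<le> \<delta> * g x * (\<Prod>s\<in>insert c S. x - s)" if "x \<in> X" for x
      proof -
        have eq: "\<delta> * g x * (\<Prod>s\<in>insert c S. x - s) = (\<delta> * g x * (\<Prod>s\<in>S. x - s)) * (x - c)"
          using finS by (simp add: algebra_simps)
        show ?thesis using cases[OF that]
        proof (elim disjE)
          assume "x \<in> L"
          then have "\<delta> * g x * (\<Prod>s\<in>S. x - s) \<le> 0" "x - c \<le> 0"
            using sgn[of x] \<delta>\<epsilon> by (auto simp: L_def)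
          then show ?thesis unfolding eq by (rule mult_nonpos_nonpos)
        next
          assume "x \<in> U"
          then have "0 \<le> \<delta> * g x * (\<Prod>s\<in>S. x - s)" "0 \<le> x - c"
            using \<delta>(2)[of x] prod_pos[of x] by (auto simp: U_def)
          then show ?thesis unfolding eq by (rule mult_nonneg_nonneg)
        qed (use c in simp)
      qed
      moreover have "insert c S \<subseteq> {x \<in> X. g x = 0}" using S c unfolding Z_def by auto
      ultimately show ?thesis using \<delta>(1) by blast
    qed
  qed
  then show ?thesis using that by blast
qed

section \<open>Fractional integrals with respect to an energy function\<close>

text \<open>
  For \<open>p > 1\<close> the truncated power is differentiable also at its corner. This lets one
  differentiate \<open>J\<close> below over a fixed domain of integration.
\<close>

lemma truncated_power_deriv:
  fixes a h p :: real
  assumes "1 < p"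
  shows "((\<lambda>h. max 0 (h - a) powr p) has_real_derivative p * max 0 (h - a) powr (p - 1)) (at h)"
proof -
  consider "h < a" | "h = a" | "a < h" by linarith
  then show ?thesis
  proof cases
    case 1
    have "((\<lambda>h. 0) has_real_derivative p * max 0 (h - a) powr (p - 1)) (at h)"
      using 1 by simp
    then show ?thesis
      by (rule has_field_derivative_transform_within_open[of _ _ _ "{..<a}"]) (use 1 in auto)
  next
    case 3
    have "((\<lambda>h. (h - a) powr p) has_real_derivative p * max 0 (h - a) powr (p - 1)) (at h)"
      using 3 by (auto intro!: derivative_eq_intros)
    then show ?thesis
      by (rule has_field_derivative_transform_within_open[of _ _ _ "{a<..}"]) (use 3 in auto)
  next
    case 2
    have "((\<lambda>y. (max 0 (y - a) powr p - max 0 (a - a) powr p) / (y - a)) \<longlongrightarrow> 0) (at a)"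
    proof (rule Lim_null_comparison)
      have "norm ((max 0 (y - a) powr p - max 0 (a - a) powr p) / (y - a)) \<le> \<bar>y - a\<bar> powr (p - 1)" for y
      proof (cases "a < y")
        case True
        then show ?thesis using powr_diff[of "y - a" p 1] by simp
      qed auto
      then show "\<forall>\<^sub>F y in at a. norm ((max 0 (y - a) powr p - max 0 (a - a) powr p) / (y - a)) \<le> \<bar>y - a\<bar> powr (p - 1)"
        by simp
      have "((\<lambda>y. \<bar>y - a\<bar> powr (p - 1)) \<longlongrightarrow> \<bar>a - a\<bar> powr (p - 1)) (at a)"
        by (intro tendsto_intros tendsto_powr') (use assms in auto)
      then show "((\<lambda>y. \<bar>y - a\<bar> powr (p - 1)) \<longlongrightarrow> 0) (at a)" by simp
    qed
    then show ?thesis using 2 by (simp add: has_field_derivative_iff)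
  qed
qed

lemma integral_pos_if_continuous:
  fixes f :: "real \<Rightarrow> real"
  assumes "continuous_on {a..b} f" "a < b" "\<And>x. x \<in> {a..b} \<Longrightarrow> 0 \<le> f x" "x \<in> {a..b}" "0 < f x"
  shows "0 < integral {a..b} f"
proof -
  have "integral {a..b} f \<noteq> 0"
    using integral_eq_0_iff[OF assms(1-3)] assms(4,5) by force
  moreover have "0 \<le> integral {a..b} f"
    by (rule integral_nonneg[OF integrable_continuous_interval[OF assms(1)] assms(3)])
  ultimately show ?thesis by simp
qed

text \<open>
  One monotone branch of the potential \<open>A\<close>. The set \<open>X\<close> stands for an interval with left end \<open>0\<close>; stating
  this by closure properties avoids a case distinction on whether the right end is finite.
\<close>

locale energy_branch =
  fixes X :: "real set" and A :: "real \<Rightarrow> real"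
  assumes X_open: "open X" and X_pos: "\<And>x. x \<in> X \<Longrightarrow> 0 < x"
    and X_down: "\<And>x t. x \<in> X \<Longrightarrow> 0 < t \<Longrightarrow> t \<le> x \<Longrightarrow> t \<in> X"
    and A_analytic: "A real_analytic_on X" and A_cont: "continuous_on (insert 0 X) A"
    and A_0: "A 0 = 0" and A'_pos: "\<And>x. x \<in> X \<Longrightarrow> 0 < deriv A x"
begin

definition "H = A ` X"
definition "\<xi> = the_inv_into (insert 0 X) A"
definition "J p g h = integral {0..\<xi> h} (\<lambda>x. g x * (h - A x) powr p)" for p :: real and g :: "real \<Rightarrow> real"

lemma Icc_subset: "y \<in> X \<Longrightarrow> 0 \<le> x \<Longrightarrow> {x..y} \<subseteq> insert 0 X"
  using X_down by (auto simp: le_less)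

lemma connected_X: "connected X"
  unfolding is_interval_connected_1[symmetric] is_interval_1
  using X_pos X_down by (meson less_le_trans)

lemma A_less: "A x < A y" if xy: "x \<in> insert 0 X" "y \<in> X" "x < y"
proof -
  have "0 \<le> x" using xy X_pos by (auto intro: less_imp_le)
  show ?thesis
  proof (rule DERIV_pos_imp_increasing_open[OF xy(3)])
    fix t assume t: "x < t" "t < y"
    then have "t \<in> X" using X_down[OF xy(2)] \<open>0 \<le> x\<close> by auto
    then show "\<exists>D. DERIV A t :> D \<and> 0 < D"
      using real_analytic_on_imp_DERIV[OF A_analytic] A'_pos by blast
  qed (rule continuous_on_subset[OF A_cont Icc_subset[OF xy(2) \<open>0 \<le> x\<close>]])
qed

lemma A_less_iff: "A x < A y \<longleftrightarrow> x < y" if "x \<in> insert 0 X" "y \<in> insert 0 X"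
proof -
  have "A x < A y" if "x \<in> insert 0 X" "y \<in> insert 0 X" "x < y" for x y
    using A_less[of x y] that X_pos by force
  with that show ?thesis by (metis less_asym linorder_neqE)
qed

lemma A_le_iff: "A x \<le> A y \<longleftrightarrow> x \<le> y" if "x \<in> insert 0 X" "y \<in> insert 0 X"
  using A_less_iff[of y x] that by (auto simp: not_less[symmetric])

lemma inj_A: "inj_on A (insert 0 X)"
  using A_le_iff by (intro inj_onI) (metis order_antisym order_refl)

lemma \<xi>_A: "x \<in> insert 0 X \<Longrightarrow> \<xi> (A x) = x"
  unfolding \<xi>_def by (rule the_inv_into_f_f[OF inj_A])

lemma \<xi>_in_X: "h \<in> H \<Longrightarrow> \<xi> h \<in> X" and A_\<xi>: "h \<in> H \<Longrightarrow> A (\<xi> h) = h"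
  using \<xi>_A unfolding H_def by auto

lemma \<xi>_0: "\<xi> 0 = 0" and \<xi>_in: "h \<in> insert 0 H \<Longrightarrow> \<xi> h \<in> insert 0 X"
  and A_\<xi>_0: "h \<in> insert 0 H \<Longrightarrow> A (\<xi> h) = h"
  using \<xi>_A[of 0] A_0 \<xi>_in_X A_\<xi> by auto

lemma \<xi>_less_iff: "\<xi> h < \<xi> k \<longleftrightarrow> h < k" if "h \<in> insert 0 H" "k \<in> insert 0 H"
  using A_less_iff[OF \<xi>_in \<xi>_in, OF that] A_\<xi>_0 that by simp

lemma \<xi>_le_iff: "\<xi> h \<le> \<xi> k \<longleftrightarrow> h \<le> k" if "h \<in> insert 0 H" "k \<in> insert 0 H"
  using A_le_iff[OF \<xi>_in \<xi>_in, OF that] A_\<xi>_0 that by simp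

lemma \<xi>_nonneg: "h \<in> insert 0 H \<Longrightarrow> 0 \<le> \<xi> h"
  using \<xi>_in X_pos by (force intro: less_imp_le)

lemma A_in_H: "x \<in> X \<Longrightarrow> A x \<in> H"
  by (simp add: H_def)

lemma H_pos: "h \<in> H \<Longrightarrow> 0 < h"
  using A_less[of 0] A_0 X_pos unfolding H_def by auto

lemma H_down:
  assumes "h \<in> H" "0 < t" "t \<le> h"
  shows "t \<in> H"
proof -
  obtain y where y: "y \<in> X" "h = A y" using assms unfolding H_def by auto
  have "\<exists>x\<ge>0. x \<le> y \<and> A x = t"
    by (rule IVT') (use assms y A_0 X_pos in \<open>auto intro: less_imp_le continuous_on_subset[OF A_cont Icc_subset]\<close>)
  then obtain x where x: "0 \<le> x" "x \<le> y" "A x = t" by blast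
  with assms(2) A_0 have "x \<noteq> 0" by auto
  with x y have "x \<in> X" using X_down by auto
  then show ?thesis using x unfolding H_def by auto
qed

lemma exists_larger: "h \<in> insert 0 H \<Longrightarrow> X \<noteq> {} \<Longrightarrow> \<exists>y\<in>X. h < A y"
proof (cases "h = 0")
  case False
  assume "h \<in> insert 0 H"
  with False obtain x where x: "x \<in> X" "h = A x" unfolding H_def by auto
  obtain e where "e > 0" "ball x e \<subseteq> X" using X_open x open_contains_ball by blast
  then have "x + e/2 \<in> X" by (auto simp: subset_iff dist_real_def)
  then show ?thesis using A_less[of x "x + e/2"] x \<open>e > 0\<close> by auto
qed (use A_less[of 0] A_0 X_pos in auto)

lemma H_open: "open H"
  unfolding open_subopen[of H]
proof
  fix h assume h: "h \<in> H"
  then obtain y where y: "y \<in> X" "h < A y" using exists_larger unfolding H_def by blast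
  show "\<exists>T. open T \<and> h \<in> T \<and> T \<subseteq> H"
    by (rule exI[of _ "{0<..<A y}"]) (use y h H_pos H_down[OF A_in_H[OF y(1)]] in auto)
qed

text \<open>
  The kernel \<open>(h - A x) powr p\<close> continued by \<open>0\<close> beyond the point where \<open>A\<close> reaches the energy \<open>h\<close>.
\<close>

definition kernel :: "real \<Rightarrow> real \<Rightarrow> real \<Rightarrow> real"
  where "kernel p h x = max 0 (h - A x) powr p"

lemma kernel_cont:
  assumes "0 < p" "continuous_on (insert 0 X) g"
  shows "continuous_on (U \<times> insert 0 X) (\<lambda>(h, x). g x * kernel p h x)"
  unfolding kernel_def case_prod_beta
  by (intro continuous_intros continuous_on_powr' continuous_on_compose2[OF A_cont]
        continuous_on_compose2[OF assms(2)]) (use assms in auto)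

lemma kernel_cont1:
  assumes "0 < p" "continuous_on (insert 0 X) g"
  shows "continuous_on (insert 0 X) (\<lambda>x. g x * kernel p h x)"
  unfolding kernel_def 
  by (intro continuous_intros continuous_on_powr' A_cont assms(2)) (use assms in auto)

lemma kernel_integrable:
  assumes "0 < p" "continuous_on (insert 0 X) g" "y \<in> X" "0 \<le> x"
  shows "(\<lambda>x. g x * kernel p h x) integrable_on {x..y}"
  by (rule integrable_continuous_interval, rule continuous_on_subset[OF kernel_cont1[OF assms(1,2)]
        Icc_subset[OF assms(3,4)]])

text \<open>
  With the truncated kernel the upper limit no longer depends on \<open>h\<close>, so that theorems on
  parameter integrals over a fixed interval apply to \<open>J\<close>.
\<close>

lemma J_truncated:
  assumes p: "0 < p" and g: "continuous_on (insert 0 X) g" and y: "y \<in> X" "h \<le> A y" and h: "h \<in> insert 0 H"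
  shows "J p g h = integral {0..y} (\<lambda>x. g x * kernel p h x)"
proof -
  have \<xi>: "\<xi> h \<in> insert 0 X" "A (\<xi> h) = h" "0 \<le> \<xi> h" using \<xi>_in A_\<xi>_0 \<xi>_nonneg h by auto
  then have "\<xi> h \<le> y" using A_le_iff[of "\<xi> h" y] y by auto
  have "integral {0..y} (\<lambda>x. g x * kernel p h x)
      = integral {0..\<xi> h} (\<lambda>x. g x * kernel p h x) + integral {\<xi> h..y} (\<lambda>x. g x * kernel p h x)"
    by (rule Henstock_Kurzweil_Integration.integral_combine[symmetric])
       (use \<xi> \<open>\<xi> h \<le> y\<close> kernel_integrable[OF p g y(1)] in auto)
  also have "integral {0..\<xi> h} (\<lambda>x. g x * kernel p h x) = J p g h"
    unfolding J_def
  proof (rule integral_cong)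
    fix x assume x: "x \<in> {0..\<xi> h}"
    then have "x \<in> {0..y}" using \<open>\<xi> h \<le> y\<close> by simp
    then have "x \<in> insert 0 X" using Icc_subset[OF y(1), of 0] by blast
    then have "A x \<le> h" using A_le_iff[of x "\<xi> h"] \<xi> x by auto
    then show "g x * kernel p h x = g x * (h - A x) powr p" by (simp add: kernel_def max_def)
  qed
  also have "integral {\<xi> h..y} (\<lambda>x. g x * kernel p h x) = integral {\<xi> h..y} (\<lambda>x. 0)"
  proof (rule integral_cong)
    fix x assume x: "x \<in> {\<xi> h..y}"
    then have "x \<in> insert 0 X" using Icc_subset[OF y(1), of "\<xi> h"] \<xi> by blast
    then have "h \<le> A x" using A_le_iff[of "\<xi> h" x] \<xi> x by auto
    then show "g x * kernel p h x = 0" by (simp add: kernel_def max_def)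
  qed
  finally show ?thesis by simp
qed

lemma J_0: "J p g 0 = 0"
  by (simp add: J_def \<xi>_0)

lemma J_cont:
  assumes p: "0 < p" and g: "continuous_on (insert 0 X) g"
  shows "continuous_on (insert 0 H) (J p g)"
proof (cases "X = {}")
  case False
  show ?thesis
    unfolding continuous_on_eq_continuous_within
  proof
    fix h assume h: "h \<in> insert 0 H"
    then obtain y where y: "y \<in> X" "h < A y" using exists_larger False by blast
    have "continuous_on UNIV (\<lambda>h. integral (cbox 0 y) (\<lambda>x. g x * kernel p h x))"
      by (rule integral_continuous_on_param, rule continuous_on_subset[OF kernel_cont[OF p g]])
         (use Icc_subset[OF y(1)] in auto)
    then have "continuous (at h within insert 0 H) (\<lambda>h. integral (cbox 0 y) (\<lambda>x. g x * kernel p h x))"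
      by (simp add: continuous_on_eq_continuous_at continuous_at_imp_continuous_at_within)
    then show "continuous (at h within insert 0 H) (J p g)"
      by (rule continuous_transform_within[of _ _ _ "A y - h"])
         (use y h J_truncated[OF p g y(1)] in \<open>auto simp: dist_real_def\<close>)
  qed
next
  case True
  then have "H = {}" unfolding H_def by simp
  then show ?thesis by simp
qed

lemma J_deriv:
  assumes p: "1 < p" and g: "continuous_on (insert 0 X) g" and h: "h \<in> H"
  shows "(J p g has_real_derivative p * J (p - 1) g h) (at h)"
proof -
  obtain y where y: "y \<in> X" "h < A y" using exists_larger h unfolding H_def by blast
  have h0: "0 < h" using H_pos h by blast
  define U where "U = {0<..<A y}"
  have UH: "U \<subseteq> H" unfolding U_def using H_down[OF A_in_H[OF y(1)]] by auto
  have "((\<lambda>h. integral (cbox 0 y) (\<lambda>x. g x * kernel p h x)) has_real_derivative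
     integral (cbox 0 y) (\<lambda>x. p * (g x * kernel (p - 1) h x))) (at h within U)"
  proof (rule leibniz_rule_field_derivative)
    fix h x :: real assume "h \<in> U" "x \<in> cbox 0 y"
    have "((\<lambda>h. g x * kernel p h x) has_real_derivative p * (g x * kernel (p - 1) h x)) (at h)"
      unfolding kernel_def by (rule derivative_eq_intros truncated_power_deriv p refl)+ simp
    then show "((\<lambda>h. g x * kernel p h x) has_real_derivative p * (g x * kernel (p - 1) h x)) (at h within U)"
      by (rule has_field_derivative_at_within)
  next
    have "continuous_on (U \<times> cbox 0 y) (\<lambda>(h, x). g x * kernel (p - 1) h x)"
      by (rule continuous_on_subset[OF kernel_cont[OF _ g]]) (use p Icc_subset[OF y(1)] in auto)
    then show "continuous_on (U \<times> cbox 0 y) (\<lambda>(h, x). p * (g x * kernel (p - 1) h x))"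
      unfolding case_prod_beta by (rule continuous_on_mult_left)
    show "(\<lambda>x. g x * kernel p h x) integrable_on cbox 0 y" for h
      using kernel_integrable[OF _ g y(1), of p 0] p by simp
    show "h \<in> U" using h0 y by (simp add: U_def)
    show "convex U" by (simp add: U_def)
  qed
  also have "integral (cbox 0 y) (\<lambda>x. p * (g x * kernel (p - 1) h x)) = p * J (p - 1) g h"
    using J_truncated[OF _ g y(1), of "p - 1" h] y h p by simp
  finally have "((\<lambda>h. integral (cbox 0 y) (\<lambda>x. g x * kernel p h x)) has_real_derivative p * J (p - 1) g h) (at h)"
    using at_within_open[of h U] h0 y by (simp add: U_def)
  then show ?thesis
    by (rule has_field_derivative_transform_within_open[of _ _ _ U])
       (use h0 y UH J_truncated[OF _ g y(1), of p] p in \<open>auto simp: U_def\<close>)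
qed

text \<open>
  By \<open>J_deriv\<close> the left-hand side is \<open>(h - c) J' - p J\<close>. The identity is
  \<open>(h - c) - (h - A x) = A x - c\<close> under the integral sign.
\<close>

lemma J_weighted_derivative:
  assumes p: "1 < p" and g: "continuous_on (insert 0 X) g" and h: "h \<in> H"
  shows "(h - c) * (p * J (p - 1) g h) - p * J p g h = J (p - 1) (\<lambda>x. p * (A x - c) * g x) h"
proof -
  have y: "\<xi> h \<in> X" "h \<le> A (\<xi> h)" using \<xi>_in_X A_\<xi> h by auto
  have g': "continuous_on (insert 0 X) (\<lambda>x. p * (A x - c) * g x)"
    by (intro continuous_intros g A_cont)
  have int: "(\<lambda>x. g x * kernel q h x) integrable_on {0..\<xi> h}" if "0 < q" for q
    using kernel_integrable[OF that g y(1)] by simp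
  have J: "J p g h = integral {0..\<xi> h} (\<lambda>x. g x * kernel p h x)"
    "J (p - 1) g h = integral {0..\<xi> h} (\<lambda>x. g x * kernel (p - 1) h x)"
    "J (p - 1) (\<lambda>x. p * (A x - c) * g x) h = integral {0..\<xi> h} (\<lambda>x. p * (A x - c) * g x * kernel (p - 1) h x)"
    using J_truncated[OF _ g y] J_truncated[OF _ g' y] p h by auto
  have "(h - c) * (p * J (p - 1) g h) - p * J p g h
      = integral {0..\<xi> h} (\<lambda>x. (h - c) * p * (g x * kernel (p - 1) h x) - p * (g x * kernel p h x))"
    unfolding J using integrable_on_mult_right[OF int] int p
    by (subst Henstock_Kurzweil_Integration.integral_diff) auto
  also have "\<dots> = J (p - 1) (\<lambda>x. p * (A x - c) * g x) h"
    unfolding J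
  proof (rule integral_cong)
    fix x assume x: "x \<in> {0..\<xi> h}"
    then have "x \<in> insert 0 X" using Icc_subset[OF y(1), of 0] by blast
    then have "A x \<le> h" using A_le_iff[of x "\<xi> h"] y A_\<xi>[OF h] x by auto
    then have k: "kernel p h x = kernel (p - 1) h x * (h - A x)"
      using powr_add[of "h - A x" "p - 1" 1] by (simp add: kernel_def max_def)
    show "(h - c) * p * (g x * kernel (p - 1) h x) - p * (g x * kernel p h x)
        = p * (A x - c) * g x * kernel (p - 1) h x" unfolding k by (simp add: algebra_simps)
  qed
  finally show ?thesis .
qed

text \<open>
  The sign of the density is required only on the open range of integration; it carries over to the
  end points by continuity, and strictness comes from the finiteness of the set of zeros.
\<close>

lemma J_pos:
  assumes p: "0 < p" and g: "continuous_on (insert 0 X) g" and fin: "finite {x \<in> X. g x = 0}" and h: "h \<in> H"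
    and sgn: "\<And>x. x \<in> X \<Longrightarrow> x < \<xi> h \<Longrightarrow> 0 \<le> \<epsilon> * g x" and \<epsilon>: "\<epsilon> \<in> {1, -1 :: real}"
  shows "0 < \<epsilon> * J p g h"
proof -
  have y: "\<xi> h \<in> X" "h \<le> A (\<xi> h)" using \<xi>_in_X A_\<xi> h by auto
  let ?f = "\<lambda>x. \<epsilon> * (g x * kernel p h x)"
  have cont: "continuous_on {0..\<xi> h} ?f"
    by (intro continuous_intros continuous_on_subset[OF kernel_cont1[OF p g] Icc_subset[OF y(1)]]) auto
  have inX: "x \<in> X" if "0 < x" "x \<le> \<xi> h" for x using X_down[OF y(1)] that by auto
  have nonneg0: "0 \<le> ?f x" if "x \<in> {0<..<\<xi> h}" for x
    using sgn[OF inX, of x] that by (simp add: kernel_def flip: mult.assoc)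
  have nonneg: "0 \<le> ?f x" if "x \<in> {0..\<xi> h}" for x
  proof (rule continuous_ge_on_closure[where S = "{0<..<\<xi> h}" and f = ?f and a = 0 and x = x])
    show "continuous_on (closure {0<..<\<xi> h}) ?f" using cont X_pos[OF y(1)] by simp
  qed (use that nonneg0 X_pos[OF y(1)] in auto)
  have "infinite ({0<..<\<xi> h} - {x \<in> X. g x = 0})"
    using fin X_pos[OF y(1)] by (simp add: infinite_Ioo Diff_infinite_finite)
  then have "{0<..<\<xi> h} - {x \<in> X. g x = 0} \<noteq> {}" by (rule infinite_imp_nonempty)
  then obtain x where x: "x \<in> {0<..<\<xi> h}" "g x \<noteq> 0" using inX by fastforce
  have "A x < h" using A_less[of x "\<xi> h"] y inX[of x] x A_\<xi>[OF h] by auto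
  then have "?f x \<noteq> 0" using x \<epsilon> by (auto simp: kernel_def)
  moreover have "0 \<le> ?f x" using nonneg[of x] x by simp
  ultimately have "0 < ?f x" by linarith
  then have "0 < integral {0..\<xi> h} ?f"
    using integral_pos_if_continuous[OF cont X_pos[OF y(1)] nonneg, of x] x by auto
  also have "integral {0..\<xi> h} ?f = \<epsilon> * J p g h"
    using J_truncated[OF p g y] h by simp
  finally show ?thesis .
qed

end

section \<open>Analyticity of the fractional integrals\<close>

text \<open>
  A holomorphic function that is real on a real interval has real derivatives there.
\<close>

lemma real_derivative_of_holomorphic_extension:
  assumes F: "F holomorphic_on S" "open S" "complex_of_real x \<in> S"
    and T: "open T" "x \<in> T" and ext: "\<And>t. t \<in> T \<Longrightarrow> F (of_real t) = complex_of_real (f t)"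
  shows "(f has_real_derivative Re (deriv F (of_real x))) (at x)"
    and "deriv F (of_real x) = of_real (Re (deriv F (of_real x)))"
proof -
  have "(F has_field_derivative deriv F (of_real x)) (at (of_real x))"
    by (rule holomorphic_derivI[OF F])
  moreover have "(complex_of_real has_vector_derivative of_real 1) (at x)"
    by (rule bounded_linear.has_vector_derivative[OF bounded_linear_of_real has_vector_derivative_id])
  ultimately have "((F \<circ> complex_of_real) has_vector_derivative of_real 1 * deriv F (of_real x)) (at x)"
    by (intro field_vector_diff_chain_at)
  then have "((F \<circ> complex_of_real) has_vector_derivative deriv F (of_real x)) (at x)"
    by simp
  then have "((\<lambda>t. complex_of_real (f t)) has_vector_derivative deriv F (of_real x)) (at x)"
    by (rule has_vector_derivative_transform_within_open[OF _ T]) (use ext in auto)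
  note der = bounded_linear.has_vector_derivative[OF bounded_linear_Re this]
    bounded_linear.has_vector_derivative[OF bounded_linear_Im this]
  show "(f has_real_derivative Re (deriv F (of_real x))) (at x)"
    using der(1) by (simp add: has_real_derivative_iff_has_vector_derivative)
  have "((\<lambda>t. 0 :: real) has_vector_derivative Im (deriv F (of_real x))) (at x)"
    using der(2) by simp
  moreover have "((\<lambda>t. 0 :: real) has_vector_derivative 0) (at x)" by simp
  ultimately have "Im (deriv F (of_real x)) = 0" by (rule vector_derivative_unique_at)
  then show "deriv F (of_real x) = of_real (Re (deriv F (of_real x)))"
    by (intro complex_eqI) simp_all
qed

context energy_branch
begin

text \<open>
  The complex inverse function theorem applied to a holomorphic extension of \<open>A\<close> extends \<open>\<xi>\<close>. The
  function \<open>L\<close> extends the density of \<open>J\<close> with respect to the energy \<open>a = A x\<close>.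
\<close>

lemma holomorphic_inverse_branch:
  assumes h1: "h1 \<in> H" and g: "g real_analytic_on X"
  obtains \<rho> L \<xi>' where "0 < \<rho>" "L holomorphic_on ball (complex_of_real h1) \<rho>"
    "\<And>a. \<bar>a - h1\<bar> < \<rho> \<Longrightarrow> a \<in> H"
    "\<And>a. \<bar>a - h1\<bar> < \<rho> \<Longrightarrow> (\<xi> has_real_derivative \<xi>' a) (at a)"
    "\<And>a. \<bar>a - h1\<bar> < \<rho> \<Longrightarrow> L (of_real a) = of_real (\<xi>' a * g (\<xi> a))"
proof -
  define x1 where "x1 = \<xi> h1"
  have x1: "x1 \<in> X" "A x1 = h1" using \<xi>_in_X[OF h1] A_\<xi>[OF h1] by (simp_all add: x1_def)
  obtain Ac r1 where Ac: "r1 > 0" "Ac holomorphic_on ball (complex_of_real x1) r1"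
    "\<And>t. \<bar>t - x1\<bar> < r1 \<Longrightarrow> Ac (of_real t) = of_real (A t)"
    by (rule real_analytic_extends_holomorphically[OF A_analytic x1(1)]) (rule that)
  obtain Gc r2 where Gc: "r2 > 0" "Gc holomorphic_on ball (complex_of_real x1) r2"
    "\<And>t. \<bar>t - x1\<bar> < r2 \<Longrightarrow> Gc (of_real t) = of_real (g t)"
    by (rule real_analytic_extends_holomorphically[OF g x1(1)]) (rule that)
  define r where "r = min r1 r2"
  have r: "0 < r" "Ac holomorphic_on ball (complex_of_real x1) r"
    "Gc holomorphic_on ball (complex_of_real x1) r"
    using Ac(1) Gc(1) holomorphic_on_subset[OF Ac(2) subset_ball, of r]
      holomorphic_on_subset[OF Gc(2) subset_ball, of r] by (simp_all add: r_def)
  have "(A has_real_derivative Re (deriv Ac (of_real x1))) (at x1)"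
    by (rule real_derivative_of_holomorphic_extension(1)[OF r(2), of _ "ball x1 r"])
       (use r Ac(3) in \<open>auto simp: dist_real_def r_def\<close>)
  then have "deriv A x1 = Re (deriv Ac (of_real x1))" by (rule DERIV_imp_deriv)
  with A'_pos[OF x1(1)] have "deriv Ac (of_real x1) \<noteq> 0" by auto
  then obtain d where d: "d > 0" "ball (complex_of_real x1) d \<subseteq> ball (complex_of_real x1) r"
    "open (Ac ` ball (complex_of_real x1) d)" "inj_on Ac (ball (complex_of_real x1) d)"
    using has_complex_derivative_locally_invertible[OF r(2) _ open_ball, of "complex_of_real x1"] r(1)
    by (metis centre_in_ball)
  have "d \<le> r"
  proof -
    have "dist x1 t < r" if "dist x1 t < d" for t
    proof -
      have "complex_of_real t \<in> ball (of_real x1) d" using that by (simp add: dist_of_real)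
      then have "complex_of_real t \<in> ball (of_real x1) r" using d(2) by blast
      then show ?thesis by (simp add: dist_of_real)
    qed
    then have "ball x1 d \<subseteq> ball x1 r" by auto
    then show ?thesis using d(1) by (simp add: ball_subset_ball_iff)
  qed
  obtain \<xi>c where \<xi>c: "\<xi>c holomorphic_on (Ac ` ball (complex_of_real x1) d)"
    "\<And>z. z \<in> ball (complex_of_real x1) d \<Longrightarrow> deriv Ac z * deriv \<xi>c (Ac z) = 1"
    "\<And>z. z \<in> ball (complex_of_real x1) d \<Longrightarrow> \<xi>c (Ac z) = z"
    by (rule holomorphic_has_inverse[OF holomorphic_on_subset[OF r(2) d(2)] open_ball d(4)])
       (rule that)
  have "Ac (of_real x1) = of_real h1" using Ac(1) Ac(3)[of x1] x1 by simp
  then have "complex_of_real h1 \<in> Ac ` ball (complex_of_real x1) d"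
    using imageI[of "complex_of_real x1" "ball (complex_of_real x1) d" Ac] d(1) by simp
  then obtain \<rho>0 where \<rho>0: "\<rho>0 > 0" "ball (complex_of_real h1) \<rho>0 \<subseteq> Ac ` ball (complex_of_real x1) d"
    using d(3) open_contains_ball by blast
  obtain e0 where "e0 > 0" "ball x1 e0 \<subseteq> X" using X_open x1(1) open_contains_ball by blast
  \<comment> \<open>Monotonicity confines \<open>\<xi>\<close> to within \<open>d\<close> of \<open>x1\<close>, where the complex inverse agrees with it.\<close>
  define e where "e = min e0 d / 2"
  have e: "0 < e" "e < d" "x1 - e \<in> X" "x1 + e \<in> X"
  proof -
    show "0 < e" "e < d" using \<open>e0 > 0\<close> d(1) by (auto simp: e_def)
    have "x1 - e \<in> ball x1 e0" "x1 + e \<in> ball x1 e0"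
      using \<open>e0 > 0\<close> d(1) by (auto simp: e_def dist_real_def)
    then show "x1 - e \<in> X" "x1 + e \<in> X" using \<open>ball x1 e0 \<subseteq> X\<close> by auto
  qed
  have less: "A (x1 - e) < h1" "h1 < A (x1 + e)"
    using A_less[of "x1 - e" x1] A_less[of x1 "x1 + e"] e x1 by auto
  define \<rho> where "\<rho> = min \<rho>0 (min (h1 - A (x1 - e)) (A (x1 + e) - h1))"
  have \<rho>: "0 < \<rho>" using \<rho>0 less by (simp add: \<rho>_def)
  have ball: "ball (complex_of_real h1) \<rho> \<subseteq> Ac ` ball (complex_of_real x1) d"
    using \<rho>0(2) subset_ball[of \<rho> \<rho>0 "complex_of_real h1"] by (simp add: \<rho>_def)
  have aH: "a \<in> H" and close: "\<bar>\<xi> a - x1\<bar> < d" if "\<bar>a - h1\<bar> < \<rho>" for a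
  proof -
    have a: "A (x1 - e) < a" "a < A (x1 + e)" using that by (auto simp: \<rho>_def)
    have "0 < A (x1 - e)" using H_pos A_in_H e by blast
    with a show "a \<in> H" using H_down[OF A_in_H[OF e(4)], of a] by simp
    then have "x1 - e < \<xi> a" "\<xi> a < x1 + e"
      using \<xi>_less_iff[of "A (x1 - e)" a] \<xi>_less_iff[of a "A (x1 + e)"] A_in_H e \<xi>_A a by auto
    then show "\<bar>\<xi> a - x1\<bar> < d" using e by linarith
  qed
  have ext: "\<xi>c (of_real a) = of_real (\<xi> a)" if "\<bar>a - h1\<bar> < \<rho>" for a
  proof -
    have "Ac (of_real (\<xi> a)) = of_real a"
      using Ac(3)[of "\<xi> a"] close[OF that] A_\<xi>[OF aH[OF that]] \<open>d \<le> r\<close> by (simp add: r_def)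
    then show ?thesis
      using \<xi>c(3)[of "of_real (\<xi> a)"] close[OF that] by (simp add: dist_real_def abs_minus_commute)
  qed
  have hol: "\<xi>c holomorphic_on ball (complex_of_real h1) \<rho>"
    by (rule holomorphic_on_subset[OF \<xi>c(1) ball])
  define \<xi>' where "\<xi>' = (\<lambda>a. Re (deriv \<xi>c (complex_of_real a)))"
  have der: "(\<xi> has_real_derivative \<xi>' a) (at a)" "deriv \<xi>c (of_real a) = of_real (\<xi>' a)"
    if "\<bar>a - h1\<bar> < \<rho>" for a
  proof -
    have a: "complex_of_real a \<in> ball (complex_of_real h1) \<rho>" "a \<in> ball h1 \<rho>"
      using that by (simp_all add: dist_real_def abs_minus_commute)
    have ext': "\<xi>c (of_real t) = complex_of_real (\<xi> t)" if "t \<in> ball h1 \<rho>" for t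
      using ext that by (simp add: dist_real_def abs_minus_commute)
    show "(\<xi> has_real_derivative \<xi>' a) (at a)" "deriv \<xi>c (of_real a) = of_real (\<xi>' a)"
      unfolding \<xi>'_def
      by (rule real_derivative_of_holomorphic_extension[OF hol open_ball a(1) open_ball a(2)],
          erule ext')+
  qed
  have maps: "\<xi>c ` ball (complex_of_real h1) \<rho> \<subseteq> ball (complex_of_real x1) r"
  proof
    fix w assume "w \<in> \<xi>c ` ball (complex_of_real h1) \<rho>"
    then obtain z where z: "z \<in> ball (complex_of_real x1) d" "w = \<xi>c (Ac z)" using ball by blast
    then show "w \<in> ball (complex_of_real x1) r" using \<xi>c(3)[OF z(1)] d(2) by auto
  qed
  show ?thesis
  proof (rule that[of \<rho> "\<lambda>z. deriv \<xi>c z * Gc (\<xi>c z)" \<xi>'])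
    show "(\<lambda>z. deriv \<xi>c z * Gc (\<xi>c z)) holomorphic_on ball (complex_of_real h1) \<rho>"
      by (intro holomorphic_intros holomorphic_deriv hol open_ball
          holomorphic_on_compose_gen[OF hol r(3) maps, unfolded comp_def])
    show "deriv \<xi>c (of_real a) * Gc (\<xi>c (of_real a)) = of_real (\<xi>' a * g (\<xi> a))" if "\<bar>a - h1\<bar> < \<rho>" for a
      using der(2)[OF that] ext[OF that] Gc(3)[of "\<xi> a"] close[OF that] \<open>d \<le> r\<close> by (simp add: r_def)
    show "0 < \<rho>" by (rule \<rho>)
    show "a \<in> H" if "\<bar>a - h1\<bar> < \<rho>" for a by (rule aH[OF that])
    show "(\<xi> has_real_derivative \<xi>' a) (at a)" if "\<bar>a - h1\<bar> < \<rho>" for a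
      by (rule der(1)[OF that])
  qed
qed

text \<open>
  The part of \<open>J\<close> over an interval on which \<open>h - A x\<close> stays away from \<open>0\<close>.
\<close>

lemma J_far_part_holomorphic:
  assumes p: "0 < p" and x0: "x0 \<in> X" and g: "continuous_on (insert 0 X) g"
  shows "(\<lambda>z. integral {0..x0} (\<lambda>x. of_real (g x) * (z - of_real (A x)) powr of_real p))
    holomorphic_on {z. A x0 < Re z}"
proof -
  let ?U = "{z. A x0 < Re z}"
  have contA: "continuous_on {0..x0} A" and contg: "continuous_on {0..x0} g"
    using continuous_on_subset[OF A_cont Icc_subset[OF x0]] continuous_on_subset[OF g Icc_subset[OF x0]]
    by simp_all
  have le: "A x \<le> A x0" if "x \<in> {0..x0}" for x
  proof -
    have "x \<in> insert 0 X" using Icc_subset[OF x0, of 0] that by blast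
    then show ?thesis using A_le_iff[of x x0] x0 that by auto
  qed
  have nn: "z - of_real (A x) \<notin> \<real>\<^sub>\<le>\<^sub>0" if "z \<in> ?U" "x \<in> {0..x0}" for z x
    using le[OF that(2)] that(1) by (auto simp: complex_nonpos_Reals_iff)
  have cont: "continuous_on (?U \<times> cbox 0 x0) (\<lambda>w. of_real (g (snd w)) * (fst w - of_real (A (snd w))) powr of_real q)" for q
  proof -
    have snd: "continuous_on (?U \<times> cbox 0 x0) snd" "snd ` (?U \<times> cbox 0 x0) \<subseteq> {0..x0}"
      by (auto intro: continuous_intros)
    have cA: "continuous_on (?U \<times> cbox 0 x0) (\<lambda>w. fst w - complex_of_real (A (snd w)))"
      by (intro continuous_on_diff continuous_on_of_real continuous_on_compose2[OF contA snd]
          continuous_on_fst continuous_on_id)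
    have "continuous_on (?U \<times> cbox 0 x0) (\<lambda>w. (fst w - of_real (A (snd w))) powr of_real q)"
    proof (rule continuous_on_powr_complex[OF _ _ cA continuous_on_const])
      have pos: "0 < Re (fst w - of_real (A (snd w)))" if "w \<in> ?U \<times> cbox 0 x0" for w
        using le[of "snd w"] that by auto
      then show "?U \<times> cbox 0 x0 \<subseteq> {w. 0 \<le> Re (fst w - of_real (A (snd w))) \<or>
          Im (fst w - of_real (A (snd w))) \<noteq> 0}" by force
      show "0 < Re (of_real q)" if "w \<in> ?U \<times> cbox 0 x0" "fst w - of_real (A (snd w)) = 0" for w
        using pos[OF that(1)] that(2) by simp
    qed
    then show ?thesis
      by (intro continuous_on_mult continuous_on_of_real continuous_on_compose2[OF contg snd])
  qed
  have "(\<lambda>z. integral (cbox 0 x0) (\<lambda>x. of_real (g x) * (z - of_real (A x)) powr of_real p)) holomorphic_on ?U"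
  proof (rule leibniz_rule_holomorphic)
    fix z x assume zx: "z \<in> ?U" "x \<in> cbox 0 x0"
    show "((\<lambda>z. of_real (g x) * (z - of_real (A x)) powr of_real p) has_field_derivative
        of_real p * (of_real (g x) * (z - of_real (A x)) powr of_real (p - 1))) (at z within ?U)"
      by (rule has_field_derivative_at_within)
         (rule derivative_eq_intros refl | use nn[OF zx(1), of x] zx in simp)+
  next
    fix z assume "z \<in> ?U"
    then show "(\<lambda>x. of_real (g x) * (z - of_real (A x)) powr of_real p) integrable_on cbox 0 x0"
      by (intro integrable_continuous)
         (rule continuous_on_compose2[OF cont, of _ "\<lambda>x. (z, x)", unfolded fst_conv snd_conv];
          auto intro!: continuous_intros)
  next
    show "continuous_on (?U \<times> cbox 0 x0) (\<lambda>(z, x). of_real p * (of_real (g x) * (z - of_real (A x)) powr of_real (p - 1)))"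
      unfolding case_prod_beta by (rule continuous_on_mult_left[OF cont])
    show "convex ?U" by (simp add: convex_halfspace_Re_gt)
  qed
  then show ?thesis by simp
qed

text \<open>
  The part of \<open>J\<close> next to the end point, after the energies between \<open>b\<close> and \<open>z\<close> have been scaled to the
  unit interval. The kernel has become independent of \<open>z\<close>, so that only \<open>L\<close> has to be differentiated.
\<close>

lemma near_part_holomorphic:
  assumes p: "0 < p" and L: "L holomorphic_on ball c \<rho>" and b: "b \<in> ball c \<rho>"
  shows "(\<lambda>z. integral {0..1} (\<lambda>u. L (b + (z - b) * of_real u) * of_real ((1 - u) powr p)))
    holomorphic_on ball c \<rho>"
proof -
  have maps: "b + (z - b) * of_real u \<in> ball c \<rho>" if "z \<in> ball c \<rho>" "u \<in> {0..1}" for z :: complex and u :: real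
  proof -
    have "(1 - u) *\<^sub>R b + u *\<^sub>R z \<in> ball c \<rho>"
      using convexD_alt[OF convex_ball, of b c \<rho> z u] b that by simp
    then show ?thesis by (simp add: scaleR_conv_of_real algebra_simps)
  qed
  have L': "deriv L holomorphic_on ball c \<rho>" by (rule holomorphic_deriv[OF L open_ball])
  have contp: "continuous_on {0..1} (\<lambda>u::real. (1 - u) powr p)"
    by (intro continuous_on_powr' continuous_intros) (use p in auto)
  have cont: "continuous_on (ball c \<rho> \<times> cbox 0 1)
      (\<lambda>w. F (b + (fst w - b) * of_real (snd w)) * of_real ((1 - snd w) powr p))"
    if "F holomorphic_on ball c \<rho>" for F :: "complex \<Rightarrow> complex"
  proof -
    have snd: "continuous_on (ball c \<rho> \<times> cbox 0 1) snd"
      "snd ` (ball c \<rho> \<times> cbox (0::real) 1) \<subseteq> {0..1}"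
      by (auto intro: continuous_intros)
    have "continuous_on (ball c \<rho> \<times> cbox 0 1) (\<lambda>w. b + (fst w - b) * of_real (snd w))"
      by (intro continuous_intros)
    moreover have "(\<lambda>w. b + (fst w - b) * of_real (snd w)) ` (ball c \<rho> \<times> cbox 0 1) \<subseteq> ball c \<rho>"
      using maps by fastforce
    ultimately have "continuous_on (ball c \<rho> \<times> cbox 0 1) (\<lambda>w. F (b + (fst w - b) * of_real (snd w)))"
      by (rule continuous_on_compose2[OF holomorphic_on_imp_continuous_on[OF that]])
    then show ?thesis
      by (intro continuous_on_mult continuous_on_of_real continuous_on_compose2[OF contp snd])
  qed
  have "(\<lambda>z. integral (cbox 0 1) (\<lambda>u. L (b + (z - b) * of_real u) * of_real ((1 - u) powr p)))
    holomorphic_on ball c \<rho>"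
  proof (rule leibniz_rule_holomorphic)
    fix z and u :: real assume zu: "z \<in> ball c \<rho>" "u \<in> cbox 0 1"
    have "(L has_field_derivative deriv L (b + (z - b) * of_real u)) (at (b + (z - b) * of_real u))"
      by (rule holomorphic_derivI[OF L open_ball]) (use maps zu in auto)
    then have "((\<lambda>z. L (b + (z - b) * of_real u) * of_real ((1 - u) powr p)) has_field_derivative
        deriv L (b + (z - b) * of_real u) * of_real u * of_real ((1 - u) powr p)) (at z)"
      by (auto intro!: derivative_eq_intros DERIV_chain2[of L])
    then show "((\<lambda>z. L (b + (z - b) * of_real u) * of_real ((1 - u) powr p)) has_field_derivative
        deriv L (b + (z - b) * of_real u) * of_real ((1 - u) powr p) * of_real u) (at z within ball c \<rho>)"
      by (rule has_field_derivative_at_within[OF DERIV_cong]) (simp add: mult_ac)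
  next
    fix z assume "z \<in> ball c \<rho>"
    then show "(\<lambda>u. L (b + (z - b) * of_real u) * of_real ((1 - u) powr p)) integrable_on cbox 0 1"
      by (intro integrable_continuous)
         (rule continuous_on_compose2[OF cont[OF L], of _ "\<lambda>x. (z, x)", unfolded fst_conv snd_conv];
          auto intro!: continuous_intros)
  next
    show "continuous_on (ball c \<rho> \<times> cbox 0 1) (\<lambda>(z, u). deriv L (b + (z - b) * of_real u) * of_real ((1 - u) powr p) * of_real u)"
      unfolding case_prod_beta
      by (rule continuous_on_mult[OF cont[OF L']]) (intro continuous_intros)
  qed (rule convex_ball)
  then show ?thesis by simp
qed

text \<open>
  Around \<open>h1\<close> the integral is split at an energy \<open>b\<close> slightly below \<open>h1\<close>, and each of the two parts
  extends holomorphically.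
\<close>

theorem J_analytic:
  assumes p: "0 < p" and g: "continuous_on (insert 0 X) g" "g real_analytic_on X"
  shows "J p g real_analytic_on H"
  unfolding real_analytic_on_def
proof
  fix h1 assume h1: "h1 \<in> H"
  obtain \<rho> L \<xi>' where \<rho>: "0 < \<rho>" and L: "L holomorphic_on ball (complex_of_real h1) \<rho>"
    and aH: "\<And>a. \<bar>a - h1\<bar> < \<rho> \<Longrightarrow> a \<in> H"
    and \<xi>': "\<And>a. \<bar>a - h1\<bar> < \<rho> \<Longrightarrow> (\<xi> has_real_derivative \<xi>' a) (at a)"
    and Lr: "\<And>a. \<bar>a - h1\<bar> < \<rho> \<Longrightarrow> L (of_real a) = of_real (\<xi>' a * g (\<xi> a))"
    by (rule holomorphic_inverse_branch[OF h1 g(2)]) (rule that)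
  define b where "b = h1 - \<rho> / 2"
  define x0 where "x0 = \<xi> b"
  have bH: "b \<in> H" using aH[of b] \<rho> by (simp add: b_def)
  have x0: "x0 \<in> X" "A x0 = b" using \<xi>_in_X[OF bH] A_\<xi>[OF bH] by (auto simp: x0_def)
  let ?B = "ball (complex_of_real h1) (\<rho> / 2)"
  define G1 where "G1 = (\<lambda>z::complex. integral {0..x0} (\<lambda>x. of_real (g x) * (z - of_real (A x)) powr of_real p))"
  define G2 where "G2 = (\<lambda>z::complex. (z - of_real b) powr of_real (p + 1) *
      integral {0..1} (\<lambda>u. L (of_real b + (z - of_real b) * of_real u) * of_real ((1 - u) powr p)))"
  have Re: "b < Re z" if "z \<in> ?B" for z
    using that abs_Re_le_cmod[of "z - of_real h1"] by (auto simp: b_def dist_norm norm_minus_commute)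
  have "G1 holomorphic_on ?B"
    unfolding G1_def
    by (rule holomorphic_on_subset[OF J_far_part_holomorphic[OF p x0(1) g(1)]]) (use Re x0 in auto)
  moreover have "G2 holomorphic_on ?B"
  proof -
    have "(\<lambda>z. integral {0..1} (\<lambda>u. L (of_real b + (z - of_real b) * of_real u) * of_real ((1 - u) powr p)))
        holomorphic_on ball (complex_of_real h1) \<rho>"
      by (rule near_part_holomorphic[OF p L]) (use \<rho> in \<open>auto simp: b_def dist_norm\<close>)
    then have "(\<lambda>z. integral {0..1} (\<lambda>u. L (of_real b + (z - of_real b) * of_real u) * of_real ((1 - u) powr p)))
        holomorphic_on ?B"
      by (rule holomorphic_on_subset) (use \<rho> in auto)
    then show ?thesis
      unfolding G2_def
    proof (intro holomorphic_intros)
      show "z - of_real b \<notin> \<real>\<^sub>\<le>\<^sub>0" if "z \<in> ?B" for z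
        using Re[OF that] by (simp add: complex_nonpos_Reals_iff)
    qed
  qed
  ultimately have hol: "(\<lambda>z. G1 z + G2 z) holomorphic_on ?B" by (intro holomorphic_intros)
  have real: "G1 (of_real h) + G2 (of_real h) = of_real (J p g h)" if h: "\<bar>h - h1\<bar> < \<rho> / 2" for h
  proof -
    have hH: "h \<in> H" and bh: "b < h" using aH[of h] h \<rho> by (auto simp: b_def abs_if split: if_splits)
    have y: "\<xi> h \<in> X" "A (\<xi> h) = h" using \<xi>_in_X[OF hH] A_\<xi>[OF hH] by auto
    have "x0 \<le> \<xi> h" unfolding x0_def using \<xi>_le_iff[of b h] bH hH bh by simp
    have x0p: "0 \<le> x0" using X_pos[OF x0(1)] by simp
    let ?f = "\<lambda>x. g x * kernel p h x"
    have "J p g h = integral {0..\<xi> h} ?f"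
      by (rule J_truncated[OF p g(1) y(1)]) (use y hH in auto)
    also have "\<dots> = integral {0..x0} ?f + integral {x0..\<xi> h} ?f"
      by (rule Henstock_Kurzweil_Integration.integral_combine[symmetric, OF x0p \<open>x0 \<le> \<xi> h\<close>])
         (rule kernel_integrable[OF p g(1) y(1) order_refl])
    finally have "J p g h = integral {0..x0} ?f + integral {x0..\<xi> h} ?f" .
    moreover have "G1 (of_real h) = of_real (integral {0..x0} ?f)"
    proof -
      have "G1 (of_real h) = integral {0..x0} (\<lambda>x. of_real (?f x))"
        unfolding G1_def
      proof (rule integral_cong)
        fix x assume x: "x \<in> {0..x0}"
        then have "x \<in> insert 0 X" using Icc_subset[OF x0(1), of 0] by blast
        then have "A x \<le> b" using A_le_iff[of x x0] x0 x by auto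
        with bh have "0 \<le> h - A x" by simp
        then show "of_real (g x) * (of_real h - of_real (A x)) powr of_real p = complex_of_real (?f x)"
          using powr_of_real[of "h - A x" p] by (simp add: kernel_def max_def)
      qed
      then show ?thesis
        using has_integral_of_real[OF integrable_integral[OF kernel_integrable[OF p g(1) x0(1), of 0 h]]]
        by (auto simp: integral_unique)
    qed
    moreover have "G2 (of_real h) = of_real (integral {x0..\<xi> h} ?f)"
    proof -
      \<comment> \<open>The substitution that maps the unit interval to the energies from \<open>b\<close> to \<open>h\<close>.\<close>
      define \<phi> where "\<phi> = (\<lambda>u. \<xi> (b + (h - b) * u))"
      have rng: "b \<le> b + (h - b) * u" "b + (h - b) * u \<le> h" "\<bar>b + (h - b) * u - h1\<bar> < \<rho>" if "u \<in> {0..1}" for u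
      proof -
        have "0 \<le> (h - b) * u" "(h - b) * u \<le> h - b" using that bh by (auto intro: mult_left_le)
        moreover have "b = h1 - \<rho> / 2" by (rule b_def)
        moreover have "h - h1 < \<rho> / 2" using h by linarith
        ultimately show "b \<le> b + (h - b) * u" "b + (h - b) * u \<le> h" "\<bar>b + (h - b) * u - h1\<bar> < \<rho>"
          using \<rho> unfolding abs_less_iff by linarith+
      qed
      have "((\<lambda>u. (\<xi>' (b + (h - b) * u) * (h - b)) *\<^sub>R ?f (\<phi> u)) has_integral
          integral {\<phi> 0..\<phi> 1} ?f) {0..1}"
      proof (rule has_integral_substitution)
        show "continuous_on {x0..\<xi> h} ?f"
          by (rule continuous_on_subset[OF kernel_cont1[OF p g(1)] Icc_subset[OF y(1) x0p]])
        show "\<phi> ` {0..1} \<subseteq> {x0..\<xi> h}"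
          using \<xi>_le_iff[OF insertI2 insertI2, OF bH aH[OF rng(3)]] \<xi>_le_iff[OF insertI2 insertI2, OF aH[OF rng(3)] hH]
            rng(1,2) by (auto simp: \<phi>_def x0_def)
        show "\<phi> 0 \<le> \<phi> 1" using \<open>x0 \<le> \<xi> h\<close> by (simp add: \<phi>_def x0_def)
        fix u :: real assume "u \<in> {0..1}"
        from \<xi>'[OF rng(3)[OF this]]
        show "(\<phi> has_real_derivative \<xi>' (b + (h - b) * u) * (h - b)) (at u within {0..1})"
          unfolding \<phi>_def
          by (rule has_field_derivative_at_within[OF DERIV_chain2[of \<xi>]]) (auto intro!: derivative_eq_intros)
      qed simp
      then have "((\<lambda>u. \<xi>' (b + (h - b) * u) * (h - b) * ?f (\<phi> u)) has_integral integral {x0..\<xi> h} ?f) {0..1}"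
        by (simp add: \<phi>_def x0_def)
      then have int: "((\<lambda>u. complex_of_real (\<xi>' (b + (h - b) * u) * (h - b) * ?f (\<phi> u))) has_integral
          of_real (integral {x0..\<xi> h} ?f)) {0..1}"
        by (rule has_integral_of_real)
      have pt: "complex_of_real (\<xi>' (b + (h - b) * u) * (h - b) * ?f (\<phi> u)) =
          of_real ((h - b) powr (p + 1)) * (L (of_real b + (of_real h - of_real b) * of_real u) * of_real ((1 - u) powr p))"
        if u: "u \<in> {0..1}" for u
      proof -
        have "A (\<phi> u) = b + (h - b) * u" unfolding \<phi>_def by (rule A_\<xi>[OF aH[OF rng(3)[OF u]]])
        then have "A (\<phi> u) \<le> h" "h - A (\<phi> u) = (h - b) * (1 - u)"
          using rng(2)[OF u] by (simp_all add: algebra_simps)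
        then have "kernel p h (\<phi> u) = ((h - b) * (1 - u)) powr p"
          by (simp add: kernel_def max_def)
        also have "\<dots> = (h - b) powr p * (1 - u) powr p"
          using bh u by (simp add: powr_mult)
        finally have k: "kernel p h (\<phi> u) = (h - b) powr p * (1 - u) powr p" .
        have pw: "(h - b) powr (p + 1) = (h - b) powr p * (h - b)"
          using bh by (simp add: powr_add)
        have "L (of_real b + (of_real h - of_real b) * of_real u) = of_real (\<xi>' (b + (h - b) * u) * g (\<phi> u))"
          using Lr[OF rng(3)[OF u]] by (simp add: \<phi>_def)
        then show ?thesis unfolding k pw by simp
      qed
      have "((\<lambda>u. of_real ((h - b) powr (p + 1)) * (L (of_real b + (of_real h - of_real b) * of_real u) * of_real ((1 - u) powr p)))
          has_integral of_real (integral {x0..\<xi> h} ?f)) {0..1}"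
        by (rule has_integral_eq[OF pt int])
      then have "of_real (integral {x0..\<xi> h} ?f) = of_real ((h - b) powr (p + 1)) *
          integral {0..1} (\<lambda>u. L (of_real b + (of_real h - of_real b) * of_real u) * of_real ((1 - u) powr p))"
        by (subst integral_unique[symmetric], assumption) (rule integral_mult_right)
      then show ?thesis using powr_of_real[of "h - b" "p + 1"] bh by (simp add: G2_def)
    qed
    ultimately show ?thesis by simp
  qed
  show "\<exists>F. (\<lambda>t. J p g (h1 + t)) has_fps_expansion F"
    by (rule real_analytic_if_extends_holomorphically[OF _ hol real]) (use \<rho> in auto)
qed

end

section \<open>Zeros of the fractional integrals\<close>

context energy_branch
begin

lemma J_pos_neq_0:
  assumes "0 < p" "continuous_on (insert 0 X) g" "finite {x \<in> X. g x = 0}" "h \<in> H" "\<epsilon> \<in> {1, -1 :: real}"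
    "\<And>x. x \<in> X \<Longrightarrow> x < \<xi> h \<Longrightarrow> 0 \<le> \<epsilon> * g x"
  shows "J p g h \<noteq> 0"
  using J_pos[OF assms(1-4) assms(6) assms(5)] by auto

lemma normalized_kernel_deriv:
  assumes "A x < h" "c < h"
  shows "((\<lambda>h. ((h - A x) / (h - c)) powr p) has_real_derivative
    p * ((h - A x) / (h - c)) powr (p - 1) * ((A x - c) / (h - c) ^ 2)) (at h)"
proof -
  have q: "((\<lambda>h. (h - A x) / (h - c)) has_real_derivative (A x - c) / (h - c) ^ 2) (at h)"
    by (rule derivative_eq_intros refl | use assms in \<open>simp add: power2_eq_square\<close>)+
  have "0 < (h - A x) / (h - c)" using assms by simp
  from DERIV_chain2[OF has_real_derivative_powr[OF this] q] show ?thesis by (simp add: mult_ac)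
qed

text \<open>
  Dividing \<open>J\<close> by \<open>(h - c) powr p\<close> replaces the kernel by a power of \<open>(h - A x) / (h - c)\<close>, which
  decreases in \<open>h\<close> where \<open>A x < c\<close> and increases where \<open>A x > c\<close>. The two ranges are kept apart because
  on the first one the integrand is smooth in \<open>h\<close>, whereas on the second one only monotonicity is used.
\<close>

lemma J_normalized_split:
  assumes p: "0 < p" and g: "continuous_on (insert 0 X) g" and c: "c \<in> H" "c < h" and y: "y \<in> X" "h \<le> A y"
  shows "J p g h * (h - c) powr (-p) = integral {0..\<xi> c} (\<lambda>x. g x * ((h - A x) / (h - c)) powr p)
    + integral {\<xi> c..y} (\<lambda>x. g x * kernel p h x) * (h - c) powr (-p)"
proof -
  have h: "h \<in> H" using c H_pos[OF c(1)] H_down[OF A_in_H[OF y(1)]] y(2) by simp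
  have \<xi>c: "\<xi> c \<in> X" "A (\<xi> c) = c" "0 \<le> \<xi> c" using \<xi>_in_X A_\<xi> \<xi>_nonneg c by auto
  have "\<xi> c \<le> y" using A_le_iff[of "\<xi> c" y] \<xi>c y c by auto
  have "J p g h = integral {0..y} (\<lambda>x. g x * kernel p h x)"
    by (rule J_truncated[OF p g y]) (use h in simp)
  also have "\<dots> = integral {0..\<xi> c} (\<lambda>x. g x * kernel p h x) + integral {\<xi> c..y} (\<lambda>x. g x * kernel p h x)"
    by (rule Henstock_Kurzweil_Integration.integral_combine[symmetric, OF \<xi>c(3) \<open>\<xi> c \<le> y\<close>])
       (rule kernel_integrable[OF p g y(1) order_refl])
  also have "integral {0..\<xi> c} (\<lambda>x. g x * kernel p h x)
      = integral {0..\<xi> c} (\<lambda>x. (h - c) powr p * (g x * ((h - A x) / (h - c)) powr p))"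
  proof (rule integral_cong)
    fix x assume x: "x \<in> {0..\<xi> c}"
    then have "x \<in> insert 0 X" using Icc_subset[OF \<xi>c(1), of 0] by blast
    then have "A x \<le> c" using A_le_iff[of x "\<xi> c"] \<xi>c x by auto
    then have "A x \<le> h" using c by simp
    then have "kernel p h x = (h - c) powr p * ((h - A x) / (h - c)) powr p"
      using c by (simp add: kernel_def max_def flip: powr_mult)
    then show "g x * kernel p h x = (h - c) powr p * (g x * ((h - A x) / (h - c)) powr p)" by simp
  qed
  also have "\<dots> = (h - c) powr p * integral {0..\<xi> c} (\<lambda>x. g x * ((h - A x) / (h - c)) powr p)"
    by (rule integral_mult_right)
  finally have "J p g h = (h - c) powr p * integral {0..\<xi> c} (\<lambda>x. g x * ((h - A x) / (h - c)) powr p)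
      + integral {\<xi> c..y} (\<lambda>x. g x * kernel p h x)" .
  moreover have "(h - c) powr p * (h - c) powr (-p) = 1"
    using c by (simp add: powr_minus)
  moreover have "(P * a + b) * Q = a + b * Q" if "P * Q = 1" for P Q a b :: real
    using that by (metis distrib_right mult.assoc mult.commute mult.right_neutral)
  ultimately show ?thesis by simp
qed

text \<open>
  If the density changes sign only at energy \<open>c\<close>, both parts of \<open>J_normalized_split\<close> move in the same
  direction. The part below \<open>c\<close> has a strictly positive derivative, computed under the integral sign; the
  part above \<open>c\<close> is monotone and differentiable, being the difference of differentiable functions,
  so its derivative is nonnegative. For exponents \<open>p \<le> 1\<close> this spares the singular integral that
  differentiating the second part would give.
\<close>

lemma J_normalized_deriv_pos:
  assumes p: "0 < p" and g: "continuous_on (insert 0 X) g" "g real_analytic_on X"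
    and fin: "finite {x \<in> X. g x = 0}" and c: "c \<in> H" and h: "h \<in> H" "c < h"
    and \<epsilon>: "\<epsilon> \<in> {1, -1 :: real}" and sgn: "\<And>x. x \<in> X \<Longrightarrow> 0 \<le> \<epsilon> * g x * (A x - c)"
  shows "\<exists>D. ((\<lambda>h. \<epsilon> * (J p g h * (h - c) powr (-p))) has_real_derivative D) (at h) \<and> 0 < D"
proof -
  obtain y where y: "y \<in> X" "h < A y" using exists_larger h unfolding H_def by blast
  have \<xi>c: "\<xi> c \<in> X" "A (\<xi> c) = c" "0 < \<xi> c" using \<xi>_in_X A_\<xi> X_pos c by auto
  have "\<xi> c \<le> y" using A_le_iff[of "\<xi> c" y] \<xi>c y h by auto
  have left: "x \<in> insert 0 X" "A x \<le> c" if "x \<in> {0..\<xi> c}" for x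
  proof -
    show *: "x \<in> insert 0 X" using Icc_subset[OF \<xi>c(1), of 0] that by blast
    show "A x \<le> c" using A_le_iff[of x "\<xi> c"] \<xi>c that * by auto
  qed
  have right: "x \<in> X" "c \<le> A x" if "x \<in> {\<xi> c..y}" for x
  proof -
    show *: "x \<in> X" using X_down[OF y(1), of x] \<xi>c(3) that by auto
    show "c \<le> A x" using A_le_iff[of "\<xi> c" x] \<xi>c that * by auto
  qed
  define U1 where "U1 = (\<lambda>h. \<epsilon> * integral {0..\<xi> c} (\<lambda>x. g x * ((h - A x) / (h - c)) powr p))"
  define U2 where "U2 = (\<lambda>h. \<epsilon> * (integral {\<xi> c..y} (\<lambda>x. g x * kernel p h x) * (h - c) powr (-p)))"
  define I where "I = {c<..<A y}"
  have I: "open I" "h \<in> I" "convex I" using h y by (auto simp: I_def)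
  have IH: "I \<subseteq> H" using H_down[OF A_in_H[OF y(1)]] H_pos[OF c] by (auto simp: I_def)
  have contA: "continuous_on {0..\<xi> c} A" and contg: "continuous_on {0..\<xi> c} g"
    using continuous_on_subset[OF A_cont Icc_subset[OF \<xi>c(1)]] continuous_on_subset[OF g(1) Icc_subset[OF \<xi>c(1)]]
    by simp_all
  have nz: "h - A x > 0" "h - c > 0" if "h \<in> I" "x \<in> {0..\<xi> c}" for h x
    using left(2)[OF that(2)] that(1) by (auto simp: I_def)
  have cont1: "continuous_on {0..\<xi> c} (\<lambda>x. g x * ((h - A x) / (h - c)) powr q)" if "h \<in> I" for h q
    by (intro continuous_intros contA contg) (use nz that in \<open>fastforce simp: I_def\<close>)+
  define D1 where "D1 = integral {0..\<xi> c} (\<lambda>x. g x * (p * ((h - A x) / (h - c)) powr (p - 1) * ((A x - c) / (h - c) ^ 2)))"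
  have "((\<lambda>h. integral (cbox 0 (\<xi> c)) (\<lambda>x. g x * ((h - A x) / (h - c)) powr p)) has_real_derivative
      integral (cbox 0 (\<xi> c)) (\<lambda>x. g x * (p * ((h - A x) / (h - c)) powr (p - 1) * ((A x - c) / (h - c) ^ 2)))) (at h within I)"
  proof (rule leibniz_rule_field_derivative[OF _ _ _ I(2,3)])
    fix h x assume "h \<in> I" "x \<in> cbox 0 (\<xi> c)"
    then have "((\<lambda>h. ((h - A x) / (h - c)) powr p) has_real_derivative
        p * ((h - A x) / (h - c)) powr (p - 1) * ((A x - c) / (h - c) ^ 2)) (at h)"
      by (intro normalized_kernel_deriv) (use nz[of h x] in auto)
    from DERIV_cmult[OF this, of "g x"]
    show "((\<lambda>h. g x * ((h - A x) / (h - c)) powr p) has_real_derivative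
        g x * (p * ((h - A x) / (h - c)) powr (p - 1) * ((A x - c) / (h - c) ^ 2))) (at h within I)"
      by (rule has_field_derivative_at_within)
  next
    show "(\<lambda>x. g x * ((h - A x) / (h - c)) powr p) integrable_on cbox 0 (\<xi> c)" if "h \<in> I" for h
      using integrable_continuous_interval[OF cont1[OF that]] by simp
    have snd: "continuous_on (I \<times> cbox 0 (\<xi> c)) snd" "snd ` (I \<times> cbox 0 (\<xi> c)) \<subseteq> {0..\<xi> c}"
      by (auto intro: continuous_intros)
    have fst: "continuous_on (I \<times> cbox 0 (\<xi> c)) fst" by (intro continuous_intros)
    show "continuous_on (I \<times> cbox 0 (\<xi> c)) (\<lambda>(h, x). g x * (p * ((h - A x) / (h - c)) powr (p - 1) * ((A x - c) / (h - c) ^ 2)))"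
      unfolding case_prod_beta
      by (intro continuous_intros continuous_on_compose2[OF contA snd] continuous_on_compose2[OF contg snd] fst)
         (use nz in fastforce)+
  qed
  then have "((\<lambda>h. integral {0..\<xi> c} (\<lambda>x. g x * ((h - A x) / (h - c)) powr p)) has_real_derivative D1) (at h)"
    unfolding D1_def by (simp only: at_within_open[OF I(2,1)] cbox_interval)
  then have dU1: "(U1 has_real_derivative \<epsilon> * D1) (at h)"
    unfolding U1_def by (rule DERIV_cmult)
  have D1_pos: "0 < \<epsilon> * D1"
  proof -
    let ?f = "\<lambda>x. \<epsilon> * (g x * (p * ((h - A x) / (h - c)) powr (p - 1) * ((A x - c) / (h - c) ^ 2)))"
    have f: "?f x = (\<epsilon> * g x * (A x - c)) * (p * ((h - A x) / (h - c)) powr (p - 1) / (h - c) ^ 2)" for x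
      by simp
    have weight: "0 < p * ((h - A x) / (h - c)) powr (p - 1) / (h - c) ^ 2" if "x \<in> {0..\<xi> c}" for x
      using nz[OF I(2) that] p by simp
    have cont: "continuous_on {0..\<xi> c} ?f"
      by (intro continuous_intros contA contg) (use nz[OF I(2)] in fastforce)+
    have nonneg0: "0 \<le> ?f x" if "x \<in> {0<..<\<xi> c}" for x
    proof -
      have x: "x \<in> X" using X_down[OF \<xi>c(1)] that by auto
      show ?thesis unfolding f
        by (rule mult_nonneg_nonneg[OF sgn[OF x] less_imp_le[OF weight]]) (use that in auto)
    qed
    have nonneg: "0 \<le> ?f x" if "x \<in> {0..\<xi> c}" for x
    proof (rule continuous_ge_on_closure[where S = "{0<..<\<xi> c}" and f = ?f and a = 0 and x = x])
      show "continuous_on (closure {0<..<\<xi> c}) ?f" using cont \<xi>c(3) by simp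
    qed (use that nonneg0 \<xi>c(3) in auto)
    have "infinite ({0<..<\<xi> c} - {x \<in> X. g x = 0})"
      using fin \<xi>c(3) by (simp add: infinite_Ioo Diff_infinite_finite)
    then have "{0<..<\<xi> c} - {x \<in> X. g x = 0} \<noteq> {}" by (rule infinite_imp_nonempty)
    then obtain x where x: "x \<in> {0<..<\<xi> c}" "g x \<noteq> 0" using X_down[OF \<xi>c(1)] by fastforce
    have xX: "x \<in> X" using X_down[OF \<xi>c(1)] x by auto
    have "A x < c" using A_less[of x "\<xi> c"] \<xi>c x xX by auto
    then have "?f x \<noteq> 0" using x \<epsilon> weight[of x] unfolding f by auto
    moreover have "0 \<le> ?f x" using nonneg[of x] x by simp
    ultimately have "0 < ?f x" by linarith
    then have "0 < integral {0..\<xi> c} ?f"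
      using integral_pos_if_continuous[OF cont \<xi>c(3) nonneg, of x] x by auto
    then show ?thesis unfolding D1_def by simp
  qed
  have int2: "(\<lambda>x. g x * kernel p h x) integrable_on {\<xi> c..y}" for h
    by (rule kernel_integrable[OF p g(1) y(1)]) (use \<xi>c in simp)
  have mono: "mono_on I U2"
  proof (rule mono_onI)
    fix h k assume hk: "h \<in> I" "k \<in> I" "h \<le> k"
    then have hc: "0 < h - c" "0 < k - c" by (auto simp: I_def)
    have U2_eq: "U2 h = integral {\<xi> c..y} (\<lambda>x. \<epsilon> * (g x * kernel p h x) * (h - c) powr (-p))" for h
      unfolding U2_def by (subst integral_mult_left, subst integral_mult_right) simp
    show "U2 h \<le> U2 k"
      unfolding U2_eq
    proof (rule integral_le)
      fix x assume x: "x \<in> {\<xi> c..y}"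
      have eg: "0 \<le> \<epsilon> * g x \<or> A x = c" using sgn[OF right(1)[OF x]] right(2)[OF x]
        by (auto simp: zero_le_mult_iff)
      have k: "kernel p h x * (h - c) powr (-p) = (max 0 (h - A x) / (h - c)) powr p" if "0 < h - c" for h
        using that by (simp add: kernel_def powr_divide powr_minus divide_simps)
      have "max 0 (h - A x) / (h - c) \<le> max 0 (k - A x) / (k - c)"
      proof (cases "A x \<le> h")
        case True
        have "(h - A x) * (k - c) \<le> (k - A x) * (h - c)"
        proof -
          have "0 \<le> (k - h) * (A x - c)" using hk right(2)[OF x] by simp
          then show ?thesis by (simp add: algebra_simps)
        qed
        then show ?thesis using hc True hk by (simp add: max_def divide_simps mult.commute)
      next
        case False
        then show ?thesis using hc by simp
      qed
      then have le: "kernel p h x * (h - c) powr (-p) \<le> kernel p k x * (k - c) powr (-p)"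
        unfolding k[OF hc(1)] k[OF hc(2)] using p hc by (intro powr_mono2) auto
      show "\<epsilon> * (g x * kernel p h x) * (h - c) powr (-p) \<le> \<epsilon> * (g x * kernel p k x) * (k - c) powr (-p)"
      proof (cases "A x = c")
        case True
        have "kernel p h x * (h - c) powr (-p) = 1" if "0 < h - c" for h
          unfolding k[OF that] using that True by simp
        from this[OF hc(1)] this[OF hc(2)] show ?thesis by (simp add: mult.assoc)
      next
        case False
        with eg have "0 \<le> \<epsilon> * g x" by simp
        from mult_left_mono[OF le this] show ?thesis by (simp add: mult_ac)
      qed
    qed (intro integrable_on_mult_left integrable_on_mult_right int2)+
  qed
  have analytic: "((\<lambda>h. \<epsilon> * (J p g h * (h - c) powr (-p))) has_real_derivative
      \<epsilon> * (deriv (J p g) h * (h - c) powr (-p) + J p g h * (-p * (h - c) powr (-p - 1)))) (at h)"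
    by (rule derivative_eq_intros real_analytic_on_imp_DERIV[OF J_analytic[OF p g] h(1)] refl
        | use h in \<open>simp add: algebra_simps\<close>)+
  define D where "D = \<epsilon> * (deriv (J p g) h * (h - c) powr (-p) + J p g h * (-p * (h - c) powr (-p - 1)))"
  have "(U2 has_real_derivative D - \<epsilon> * D1) (at h)"
  proof (rule has_field_derivative_transform_within_open[OF DERIV_diff[OF analytic[folded D_def] dU1] I(1,2)])
    fix k assume k: "k \<in> I"
    have "J p g k * (k - c) powr (-p) = integral {0..\<xi> c} (\<lambda>x. g x * ((k - A x) / (k - c)) powr p)
        + integral {\<xi> c..y} (\<lambda>x. g x * kernel p k x) * (k - c) powr (-p)"
      by (rule J_normalized_split[OF p g(1) c _ y(1)]) (use k in \<open>auto simp: I_def\<close>)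
    then show "\<epsilon> * (J p g k * (k - c) powr (-p)) - U1 k = U2 k"
      unfolding U1_def U2_def by (simp add: algebra_simps)
  qed
  then have "0 \<le> D - \<epsilon> * D1"
    by (rule mono_on_imp_deriv_nonneg[OF mono]) (use I in \<open>simp add: interior_open\<close>)
  with D1_pos have "0 < D" by simp
  with analytic show ?thesis unfolding D_def by blast
qed

text \<open>
  Here \<open>C\<close> is the set of energies at which the density \<open>g\<close> changes sign. The last clause, that \<open>J p g\<close> is
  nowhere flat, is carried along because the multiplicities used in Rolle's theorem need it.
\<close>

theorem J_zero_count:
  assumes C: "finite C" "C \<subseteq> H" and p: "0 < p" "real (card C) - 1 < p"
    and g: "continuous_on (insert 0 X) g" "g real_analytic_on X" "finite {x \<in> X. g x = 0}"
    and \<epsilon>: "\<epsilon> \<in> {1, -1 :: real}"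
    and sgn: "\<And>x. x \<in> X \<Longrightarrow> 0 \<le> \<epsilon> * g x * (\<Prod>c\<in>C. A x - c)"
  shows "finite {z \<in> H. J p g z = 0} \<and> (\<Sum>z | z \<in> H \<and> J p g z = 0. zero_mult (J p g) z) \<le> card C
    \<and> (\<forall>z\<in>H. \<exists>k. (deriv ^^ k) (J p g) z \<noteq> 0)"
  using assms
proof (induction "card C" arbitrary: C p g)
  case 0
  then have "C = {}" by simp
  have "J p g z \<noteq> 0" if "z \<in> H" for z
    by (rule J_pos_neq_0[OF _ _ _ that \<open>\<epsilon> \<in> {1, -1}\<close>]) (use 0 \<open>C = {}\<close> in auto)
  then have none: "{z \<in> H. J p g z = 0} = {}" and "\<forall>z\<in>H. (deriv ^^ 0) (J p g) z \<noteq> 0" by auto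
  then have "\<forall>z\<in>H. \<exists>k. (deriv ^^ k) (J p g) z \<noteq> 0" by blast
  then show ?case unfolding none by simp
next
  case (Suc n)
  note C = Suc.prems(1,2) and p = Suc.prems(3,4) and g = Suc.prems(5-7) and \<epsilon> = Suc.prems(8) and sgn = Suc.prems(9)
  from Suc.hyps(2) C(1) obtain c where cC: "c \<in> C" by fastforce
  then have c: "c \<in> H" using C by auto
  define C' where "C' = C - {c}"
  have C': "finite C'" "C' \<subseteq> H" "n = card C'" "C = insert c C'" "c \<notin> C'"
    using C cC Suc.hyps(2) by (auto simp: C'_def card_Diff_singleton)
  have prod: "(\<Prod>d\<in>C. A x - d) = (A x - c) * (\<Prod>d\<in>C'. A x - d)" for x
    unfolding C'(4) using C' by simp
  show ?case
  proof (cases "n = 0")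
    case True
    with C' have C1: "C' = {}" by simp
    have sgn1: "0 \<le> \<epsilon> * g x * (A x - c)" if "x \<in> X" for x
      using sgn[OF that] C1 by (simp add: prod)
    \<comment> \<open>Up to energy \<open>c\<close> the density has constant sign.\<close>
    have low: "J p g z \<noteq> 0" if z: "z \<in> H" "z \<le> c" for z
    proof (rule J_pos_neq_0[OF p(1) g(1,3) z(1)])
      show "- \<epsilon> \<in> {1, -1}" using \<epsilon> by auto
      fix x assume x: "x \<in> X" "x < \<xi> z"
      then have "A x < c" using A_less[of x "\<xi> z"] \<xi>_in_X[OF z(1)] A_\<xi>[OF z(1)] z(2) by auto
      with sgn1[OF x(1)] show "0 \<le> - \<epsilon> * g x" by (auto simp: zero_le_mult_iff mult_le_0_iff)
    qed
    define U where "U = (\<lambda>h. \<epsilon> * (J p g h * (h - c) powr (-p)))"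
    have U': "\<exists>D. (U has_real_derivative D) (at h) \<and> 0 < D" if "h \<in> H" "c < h" for h
      unfolding U_def by (rule J_normalized_deriv_pos[OF p(1) g c that \<epsilon> sgn1])
    have unique: "\<not> (z < w)" if zw: "z \<in> H" "w \<in> H" "J p g z = 0" "J p g w = 0" for z w
    proof
      assume "z < w"
      have "c < z" using low zw by force
      have "U z < U w"
      proof (rule DERIV_pos_imp_increasing[OF \<open>z < w\<close>])
        fix h assume "z \<le> h" "h \<le> w"
        then show "\<exists>D. (U has_real_derivative D) (at h) \<and> 0 < D"
          using U'[of h] H_down[OF zw(2), of h] H_pos[OF c] \<open>c < z\<close> by auto
      qed
      with zw show False by (simp add: U_def)
    qed
    have simple: "deriv (J p g) z \<noteq> 0" if z: "z \<in> H" "J p g z = 0" for z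
    proof
      assume d: "deriv (J p g) z = 0"
      have cz: "c < z" using low z by force
      have "(U has_real_derivative \<epsilon> * (deriv (J p g) z * (z - c) powr (-p)
          + J p g z * (-p * (z - c) powr (-p - 1)))) (at z)"
        unfolding U_def
        by (rule derivative_eq_intros real_analytic_on_imp_DERIV[OF J_analytic[OF p(1) g(1,2)] z(1)] refl
            | use cz in \<open>simp add: algebra_simps\<close>)+
      then have "(U has_real_derivative 0) (at z)" using d z by simp
      with U'[OF z(1) cz] show False using DERIV_unique by fastforce
    qed
    have mult: "zero_mult (J p g) z \<le> 1" if "z \<in> H" "J p g z = 0" for z
      unfolding zero_mult_def by (rule Least_le) (use simple[OF that] in simp)
    have zeros: "{z \<in> H. J p g z = 0} = {} \<or> (\<exists>z. {z \<in> H. J p g z = 0} = {z})"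
    proof (cases "{z \<in> H. J p g z = 0} = {}")
      case False
      then obtain z where z: "z \<in> H" "J p g z = 0" by blast
      have eq: "w = z" if "w \<in> H" "J p g w = 0" for w
        using unique[OF z(1) that(1) z(2) that(2)] unique[OF that(1) z(1) that(2) z(2)] by simp
      have "{z \<in> H. J p g z = 0} = {z}" using z eq by blast
      then show ?thesis by blast
    qed simp
    then have "finite {z \<in> H. J p g z = 0}" by (metis finite.emptyI finite.insertI)
    moreover have "(\<Sum>z | z \<in> H \<and> J p g z = 0. zero_mult (J p g) z) \<le> 1"
      using zeros
    proof (elim disjE exE)
      fix z assume z: "{z \<in> H. J p g z = 0} = {z}"
      then have "z \<in> {z \<in> H. J p g z = 0}" by simp
      then have "zero_mult (J p g) z \<le> 1" using mult by simp
      then show ?thesis unfolding z by simp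
    next
      assume none: "{z \<in> H. J p g z = 0} = {}"
      show ?thesis unfolding none by simp
    qed
    moreover have "\<exists>k. (deriv ^^ k) (J p g) z \<noteq> 0" if "z \<in> H" for z
    proof (cases "J p g z = 0")
      case True
      with simple[OF that] show ?thesis by (intro exI[of _ 1]) simp
    qed (auto intro: exI[of _ 0])
    ultimately show ?thesis using Suc.hyps(2) True by simp
  next
    case False
    have p1: "1 < p" using p(2) Suc.hyps(2) False by linarith
    \<comment> \<open>The additional factor adds at most the zero \<open>\<xi> c\<close> and removes the sign change at \<open>c\<close>.\<close>
    define g' where "g' = (\<lambda>x. p * (A x - c) * g x)"
    have sub: "{x \<in> X. g' x = 0} \<subseteq> {x \<in> X. g x = 0} \<union> {\<xi> c}"
      using p(1) \<xi>_A by (auto simp: g'_def)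
    have IH: "finite {z \<in> H. J (p - 1) g' z = 0} \<and> (\<Sum>z | z \<in> H \<and> J (p - 1) g' z = 0. zero_mult (J (p - 1) g') z) \<le> card C'
        \<and> (\<forall>z\<in>H. \<exists>k. (deriv ^^ k) (J (p - 1) g') z \<noteq> 0)"
    proof (rule Suc.hyps(1)[OF C'(3,1,2)])
      show "0 < p - 1" using p1 by simp
      show "real (card C') - 1 < p - 1" using p(2) Suc.hyps(2) C'(3) by linarith
      show "continuous_on (insert 0 X) g'" unfolding g'_def by (intro continuous_intros A_cont g)
      show "g' real_analytic_on X" unfolding g'_def
        by (intro real_analytic_on_mult real_analytic_on_diff real_analytic_on_const A_analytic g)
      show "finite {x \<in> X. g' x = 0}" by (rule finite_subset[OF sub]) (use g in simp)
      show "\<epsilon> \<in> {1, -1}" by (rule \<epsilon>)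
      fix x assume x: "x \<in> X"
      have "0 \<le> p * (\<epsilon> * g x * (\<Prod>d\<in>C. A x - d))" using p(1) sgn[OF x] by simp
      then show "0 \<le> \<epsilon> * g' x * (\<Prod>d\<in>C'. A x - d)" by (simp add: prod g'_def mult_ac)
    qed
    interpret weighted_rolle H "J p g" "J (p - 1) g'" c p
    proof
      show "J p g real_analytic_on H" by (rule J_analytic[OF p(1) g(1,2)])
      show "continuous_on (insert 0 H) (J p g)" by (rule J_cont[OF p(1) g(1)])
      show "J (p - 1) g' h = (h - c) * deriv (J p g) h - p * J p g h" if "h \<in> H" for h
        using J_weighted_derivative[OF p1 g(1) that, of c] DERIV_imp_deriv[OF J_deriv[OF p1 g(1) that]]
        by (simp add: g'_def)
      show "open H" "c \<in> H" "J p g 0 = 0" by (fact H_open c J_0)+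
      show "0 < h" if "h \<in> H" for h by (rule H_pos[OF that])
      show "t \<in> H" if "h \<in> H" "0 < t" "t \<le> h" for h t by (rule H_down[OF that])
    qed
    have fin: "finite {z \<in> H. J (p - 1) g' z = 0}" and flat: "\<And>z. z \<in> H \<Longrightarrow> \<exists>k. (deriv ^^ k) (J (p - 1) g') z \<noteq> 0"
      using IH by auto
    show ?thesis
      using zeros_le_Suc_zeros_of_R(1)[OF fin flat] zeros_le_Suc_zeros_of_R(3)[OF fin flat]
        le_trans[OF zeros_le_Suc_zeros_of_R(2)[OF fin flat], of "card C"] IH Suc.hyps(2) C'(3) by simp
  qed
qed

end

section \<open>Integration along a closed curve crossing the axis twice\<close>

text \<open>
  The parametrization may start on the axis or off it; in the first case \<open>s = 0\<close>, in the second one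
  the axis is met at two interior times. The conclusion treats both cases uniformly.
\<close>

lemma loop_zero_times:
  fixes c :: "real \<Rightarrow> complex"
  assumes c: "simple_path c" "pathfinish c = pathstart c"
    and e: "e1 \<noteq> e2" "e1 \<in> path_image c" "e2 \<in> path_image c"
    and zeros: "\<And>z. z \<in> path_image c \<Longrightarrow> Im z = 0 \<Longrightarrow> z = e1 \<or> z = e2"
  obtains s t where "0 \<le> s" "s < t" "t < 1" "{c s, c t} = {e1, e2}"
    "\<And>x. 0 < x \<Longrightarrow> x < 1 \<Longrightarrow> x \<noteq> s \<Longrightarrow> x \<noteq> t \<Longrightarrow> Im (c x) \<noteq> 0"
    "s = 0 \<or> Im (c 0) \<noteq> 0"
proof -
  have loop: "c 0 = c 1" using c by (simp add: pathstart_def pathfinish_def)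
  have inj: "x = y \<or> (x = 0 \<and> y = 1) \<or> (x = 1 \<and> y = 0)" if "c x = c y" "x \<in> {0..1}" "y \<in> {0..1}" for x y
    using c that unfolding simple_path_def loop_free_def by blast
  have zeros': "c x = e1 \<or> c x = e2" if "x \<in> {0..1}" "Im (c x) = 0" for x
    using zeros[of "c x"] that by (auto simp: path_image_def)
  have time: "\<exists>t. 0 \<le> t \<and> t < 1 \<and> c t = e" if mem: "e \<in> path_image c" for e
  proof -
    obtain t where t: "t \<in> {0..1}" "c t = e" using mem unfolding path_image_def by blast
    then show ?thesis using loop by (cases "t = 1") (auto intro: exI[of _ 0] exI[of _ t])
  qed
  obtain t1 where t1: "0 \<le> t1" "t1 < 1" "c t1 = e1" using time[OF e(2)] by blast
  obtain t2 where t2: "0 \<le> t2" "t2 < 1" "c t2 = e2" using time[OF e(3)] by blast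
  have "t1 \<noteq> t2" using t1 t2 e(1) by auto
  have no_other: "Im (c x) \<noteq> 0" if "0 < x" "x < 1" "x \<noteq> t1" "x \<noteq> t2" for x
  proof
    assume "Im (c x) = 0"
    then have "c x = c t1 \<or> c x = c t2" using zeros'[of x] that t1 t2 by simp
    then show False using inj[of x t1] inj[of x t2] that t1 t2 by auto
  qed
  have start: "Im (c 0) \<noteq> 0" if "t1 \<noteq> 0" "t2 \<noteq> 0"
  proof
    assume "Im (c 0) = 0"
    then have "c 0 = c t1 \<or> c 0 = c t2" using zeros'[of 0] t1 t2 by simp
    then show False using inj[of 0 t1] inj[of 0 t2] that t1 t2 by auto
  qed
  show ?thesis
  proof (cases "t1 < t2")
    case True
    show ?thesis by (rule that[of t1 t2]) (use True t1 t2 no_other start in auto)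
  next
    case False
    then have "t2 < t1" using \<open>t1 \<noteq> t2\<close> by simp
    then show ?thesis by (intro that[of t2 t1]) (use t1 t2 no_other start in auto)
  qed
qed

text \<open>
  A simple loop that meets the axis only in \<open>e1\<close> and \<open>e2\<close> and visits both half planes consists of one arc in
  each of them, run through in opposite directions. A form with a primitive on each half plane can
  therefore be integrated at once, and the number \<open>\<epsilon>\<close> that records the orientation is the same for all
  forms. Computing the winding number and an Abelian integral with the same \<open>\<epsilon>\<close> links their signs.
\<close>

lemma integral_along_two_arcs:
  fixes c :: "real \<Rightarrow> complex"
  assumes c: "simple_path c" "pathfinish c = pathstart c"
    and e: "e1 \<noteq> e2" "e1 \<in> path_image c" "e2 \<in> path_image c"
    and Im_e: "Im e1 = 0" "Im e2 = 0"
    and zeros: "\<And>z. z \<in> path_image c \<Longrightarrow> Im z = 0 \<Longrightarrow> z = e1 \<or> z = e2"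
    and both: "\<exists>z\<in>path_image c. 0 < Im z" "\<exists>z\<in>path_image c. Im z < 0"
  obtains \<epsilon> :: real where "\<epsilon> \<in> {1, -1}"
    "\<And>(P_up :: complex \<Rightarrow> complex) P_lo q S.
       continuous_on (path_image c \<inter> {z. 0 \<le> Im z}) P_up \<Longrightarrow>
       continuous_on (path_image c \<inter> {z. Im z \<le> 0}) P_lo \<Longrightarrow> finite S \<Longrightarrow>
       (\<And>t. t \<in> {0<..<1} - S \<Longrightarrow> 0 < Im (c t) \<Longrightarrow> ((\<lambda>t. P_up (c t)) has_vector_derivative q t) (at t)) \<Longrightarrow>
       (\<And>t. t \<in> {0<..<1} - S \<Longrightarrow> Im (c t) < 0 \<Longrightarrow> ((\<lambda>t. P_lo (c t)) has_vector_derivative q t) (at t)) \<Longrightarrow>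
       (q has_integral of_real \<epsilon> * ((P_up e2 - P_up e1) - (P_lo e2 - P_lo e1))) {0..1}"
proof -
  obtain s t where st: "0 \<le> s" "s < t" "t < 1" and cst: "{c s, c t} = {e1, e2}"
    and nz: "\<And>x. 0 < x \<Longrightarrow> x < 1 \<Longrightarrow> x \<noteq> s \<Longrightarrow> x \<noteq> t \<Longrightarrow> Im (c x) \<noteq> 0"
    and s0: "s = 0 \<or> Im (c 0) \<noteq> 0"
    using loop_zero_times[OF c e zeros] by blast
  have loop: "c 0 = c 1" using c by (simp add: pathstart_def pathfinish_def)
  have cont: "continuous_on {0..1} c" using c by (simp add: simple_path_def path_def)
  then have contIm: "continuous_on {0..1} (\<lambda>x. Im (c x))" by (intro continuous_intros)
  have sign: "\<exists>\<delta>. \<delta> \<in> {1, -1 :: real} \<and> (\<forall>x\<in>I. 0 < \<delta> * Im (c x))"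
    if "I \<subseteq> {0..1}" "connected I" "\<And>x. x \<in> I \<Longrightarrow> Im (c x) \<noteq> 0" for I
    using constant_sign_if_no_zero[OF that(2) continuous_on_subset[OF contIm that(1)] that(3)] by metis
  obtain \<delta> where \<delta>: "\<delta> \<in> {1, -1 :: real}" "\<And>x. s < x \<Longrightarrow> x < t \<Longrightarrow> 0 < \<delta> * Im (c x)"
    using sign[of "{s<..<t}"] st nz by force
  \<comment> \<open>The rest of the loop is one arc: its two pieces meet at the start of the loop unless \<open>s = 0\<close>.\<close>
  have "\<exists>\<delta>'. \<delta>' \<in> {1, -1 :: real} \<and> (\<forall>x. 0 < x \<and> x < s \<or> t < x \<and> x < 1 \<longrightarrow> 0 < \<delta>' * Im (c x))"
  proof (cases "s = 0")
    case True
    obtain \<delta>' where "\<delta>' \<in> {1, -1 :: real}" "\<forall>x\<in>{t<..<1}. 0 < \<delta>' * Im (c x)"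
      using sign[of "{t<..<1}"] st nz by force
    then show ?thesis using True by (intro exI[of _ \<delta>']) auto
  next
    case False
    then have c0: "Im (c 0) \<noteq> 0" using s0 by simp
    have "\<exists>\<delta>. \<delta> \<in> {1, -1 :: real} \<and> (\<forall>x\<in>{0..<s}. 0 < \<delta> * Im (c x))"
    proof (rule sign)
      show "Im (c x) \<noteq> 0" if "x \<in> {0..<s}" for x
        using nz[of x] that st c0 by (cases "x = 0") auto
    qed (use st in auto)
    then obtain \<delta>1 where \<delta>1: "\<delta>1 \<in> {1, -1 :: real}" "\<forall>x\<in>{0..<s}. 0 < \<delta>1 * Im (c x)"
      by blast
    have "\<exists>\<delta>. \<delta> \<in> {1, -1 :: real} \<and> (\<forall>x\<in>{t<..1}. 0 < \<delta> * Im (c x))"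
    proof (rule sign)
      show "Im (c x) \<noteq> 0" if "x \<in> {t<..1}" for x
        using nz[of x] that st c0 loop by (cases "x = 1") auto
    qed (use st in auto)
    then obtain \<delta>2 where \<delta>2: "\<delta>2 \<in> {1, -1 :: real}" "\<forall>x\<in>{t<..1}. 0 < \<delta>2 * Im (c x)"
      by blast
    have "0 < \<delta>1 * Im (c 0)" using \<delta>1(2) False st by auto
    moreover have "0 < \<delta>2 * Im (c 0)" unfolding loop using \<delta>2(2) st by auto
    ultimately have "\<delta>1 = \<delta>2" using \<delta>1(1) \<delta>2(1) by auto
    then show ?thesis using \<delta>1 \<delta>2 by (intro exI[of _ \<delta>1]) auto
  qed
  then obtain \<delta>' where \<delta>': "\<delta>' \<in> {1, -1 :: real}"
    "\<And>x. 0 < x \<Longrightarrow> x < s \<Longrightarrow> 0 < \<delta>' * Im (c x)" "\<And>x. t < x \<Longrightarrow> x < 1 \<Longrightarrow> 0 < \<delta>' * Im (c x)"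
    by blast
  have "\<delta>' \<noteq> \<delta>"
  proof
    assume eq: "\<delta>' = \<delta>"
    have nonneg: "0 \<le> \<delta> * Im (c x)" if "x \<in> {0..1}" for x
    proof -
      have gen: "0 \<le> \<delta> * Im (c x)" if x: "x \<in> {0<..<1}" for x
      proof (cases "x = s \<or> x = t")
        case True
        then have "c x = e1 \<or> c x = e2" using cst by auto
        then show ?thesis using Im_e by auto
      next
        case False
        then consider "x < s" | "s < x" "x < t" | "t < x" by linarith
        then have "0 < \<delta> * Im (c x)" using \<delta> \<delta>' eq x by cases auto
        then show ?thesis by simp
      qed
      show ?thesis
        by (rule continuous_ge_on_closure[where S = "{0<..<1}" and f = "\<lambda>x. \<delta> * Im (c x)" and a = 0 and x = x])
           (use that gen in \<open>auto intro!: continuous_intros contIm\<close>)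
    qed
    with both \<delta>(1) show False by (fastforce simp: path_image_def)
  qed
  then have \<delta>\<delta>: "\<delta>' = - \<delta>" using \<delta>(1) \<delta>'(1) by auto
  define \<epsilon> :: real where "\<epsilon> = (if c t = e2 then \<delta> else - \<delta>)"
  show ?thesis
  proof (rule that[of \<epsilon>])
    show "\<epsilon> \<in> {1, -1}" using \<delta>(1) by (auto simp: \<epsilon>_def)
    fix P_up P_lo :: "complex \<Rightarrow> complex" and q S
    assume cont_up: "continuous_on (path_image c \<inter> {z. 0 \<le> Im z}) P_up"
      and cont_lo: "continuous_on (path_image c \<inter> {z. Im z \<le> 0}) P_lo" and S: "finite S"
      and der_up: "\<And>t. t \<in> {0<..<1} - S \<Longrightarrow> 0 < Im (c t) \<Longrightarrow> ((\<lambda>t. P_up (c t)) has_vector_derivative q t) (at t)"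
      and der_lo: "\<And>t. t \<in> {0<..<1} - S \<Longrightarrow> Im (c t) < 0 \<Longrightarrow> ((\<lambda>t. P_lo (c t)) has_vector_derivative q t) (at t)"
    define P where "P = (\<lambda>d::real. if d = 1 then P_up else P_lo)"
    have segment: "(q has_integral (P d (c b) - P d (c a))) {a..b}"
      if ab: "0 \<le> a" "a \<le> b" "b \<le> 1" and d: "d \<in> {1, -1}" and pos: "\<And>x. a < x \<Longrightarrow> x < b \<Longrightarrow> 0 < d * Im (c x)"
      for a b d
    proof (cases "a = b")
      case True
      then show ?thesis by (simp add: has_integral_refl)
    next
      case False
      have sub: "{a..b} \<subseteq> {0..1}" using ab by auto
      have nonneg: "0 \<le> d * Im (c x)" if "x \<in> {a..b}" for x
      proof (rule continuous_ge_on_closure[where S = "{a<..<b}" and f = "\<lambda>x. d * Im (c x)" and a = 0 and x = x])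
        show "continuous_on (closure {a<..<b}) (\<lambda>x. d * Im (c x))"
          using False ab continuous_on_subset[OF contIm sub] by (auto intro!: continuous_intros)
        show "x \<in> closure {a<..<b}" using that False ab by simp
        show "0 \<le> d * Im (c y)" if "y \<in> {a<..<b}" for y using pos[of y] that by simp
      qed
      have contP: "continuous_on {a..b} (\<lambda>x. P d (c x))"
      proof (cases "d = 1")
        case True
        show ?thesis
          by (rule continuous_on_compose2[OF _ continuous_on_subset[OF cont sub], of "path_image c \<inter> {z. 0 \<le> Im z}"])
             (use True cont_up sub nonneg in \<open>auto simp: P_def path_image_def\<close>)
      next
        case False
        with d have "d = -1" by auto
        then show ?thesis
          by (intro continuous_on_compose2[OF _ continuous_on_subset[OF cont sub], of "path_image c \<inter> {z. Im z \<le> 0}"])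
             (use cont_lo sub nonneg in \<open>auto simp: P_def path_image_def\<close>)
      qed
      show ?thesis
      proof (rule fundamental_theorem_of_calculus_interior_strong[OF S ab(2) _ contP])
        fix x assume x: "x \<in> {a<..<b} - S"
        then have "0 < d * Im (c x)" "x \<in> {0<..<1} - S" using pos[of x] ab by auto
        then show "((\<lambda>x. P d (c x)) has_vector_derivative q x) (at x)"
          using d der_up[of x] der_lo[of x] by (auto simp: P_def)
      qed
    qed
    have "(q has_integral ((P \<delta>' (c s) - P \<delta>' (c 0)) + (P \<delta> (c t) - P \<delta> (c s)))) {0..t}"
      by (rule has_integral_combine[OF st(1) less_imp_le[OF st(2)] segment segment])
         (use st \<delta> \<delta>' in auto)
    from has_integral_combine[OF _ _ this segment[of t 1 \<delta>']]
    have "(q has_integral ((P \<delta>' (c s) - P \<delta>' (c 0)) + (P \<delta> (c t) - P \<delta> (c s)) + (P \<delta>' (c 1) - P \<delta>' (c t)))) {0..1}"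
      using st \<delta>' by simp
    also have "(P \<delta>' (c s) - P \<delta>' (c 0)) + (P \<delta> (c t) - P \<delta> (c s)) + (P \<delta>' (c 1) - P \<delta>' (c t))
        = of_real \<epsilon> * ((P_up e2 - P_up e1) - (P_lo e2 - P_lo e1))"
    proof -
      have "c t = e2 \<and> c s = e1 \<or> c t = e1 \<and> c s = e2 \<and> c t \<noteq> e2" using cst e(1) by (auto simp: doubleton_eq_iff)
      then show ?thesis using \<delta>(1) loop unfolding \<delta>\<delta> \<epsilon>_def P_def by (auto simp: algebra_simps)
    qed
    finally show "(q has_integral of_real \<epsilon> * ((P_up e2 - P_up e1) - (P_lo e2 - P_lo e1))) {0..1}" .
  qed
qed

text \<open>
  A connected set that avoids \<open>C\<close> lies in a single component of the complement.
\<close>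

lemma connected_avoiding_stays_inside:
  assumes "z \<in> inside C" "connected S" "z \<in> S" "S \<inter> C = {}"
  shows "S \<subseteq> inside C"
proof
  fix w assume "w \<in> S"
  have "S \<subseteq> connected_component_set (- C) z"
    by (rule connected_component_maximal) (use assms in auto)
  then have "w \<in> connected_component_set (- C) z" using \<open>w \<in> S\<close> by blast
  then have "connected_component_set (- C) w = connected_component_set (- C) z"
    by (rule connected_component_eq)
  then show "w \<in> inside C"
    using assms \<open>w \<in> S\<close> unfolding inside_def by auto
qed

text \<open>
  A vertical ray is connected and unbounded, so it cannot stay in a bounded component.
\<close>

lemma vertical_line_meets_curve:
  assumes "z \<in> inside C" "Im z = 0"
  shows "\<exists>y>0. Complex (Re z) y \<in> C" and "\<exists>y<0. Complex (Re z) y \<in> C"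
proof -
  have zC: "z \<notin> C" and bdd: "bounded (connected_component_set (- C) z)"
    using assms(1) by (auto simp: inside_def)
  have ray: "\<exists>y>0. Complex (Re z) (d * y) \<in> C" if d: "\<bar>d\<bar> = 1" for d :: real
  proof (rule ccontr)
    assume no: "\<not> ?thesis"
    let ?S = "(\<lambda>y. Complex (Re z) (d * y)) ` {0..}"
    have "continuous_on {0..} (\<lambda>y. Complex (Re z) (d * y))"
      unfolding Complex_eq by (intro continuous_intros)
    then have conn: "connected ?S"
      by (rule connected_continuous_image) (simp add: is_interval_connected_1[symmetric])
    have z: "z = Complex (Re z) (d * 0)" using assms(2) by (simp add: complex_eq_iff)
    have "Complex (Re z) (d * y) \<notin> C" if "0 \<le> y" for y
      using no zC z that by (cases "y = 0") auto
    then have "?S \<subseteq> - C" by auto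
    moreover have "z \<in> ?S" using z by (intro image_eqI[of _ _ 0]) auto
    ultimately have "?S \<subseteq> connected_component_set (- C) z"
      using conn by (intro connected_component_maximal)
    with bdd have "bounded ?S" by (rule bounded_subset)
    then obtain M where M: "\<And>y. 0 \<le> y \<Longrightarrow> norm (Complex (Re z) (d * y)) \<le> M"
      unfolding bounded_iff by auto
    have "\<bar>M\<bar> + 1 \<le> \<bar>Im (Complex (Re z) (d * (\<bar>M\<bar> + 1)))\<bar>" using d by (simp add: abs_mult)
    also have "\<dots> \<le> norm (Complex (Re z) (d * (\<bar>M\<bar> + 1)))" by (rule abs_Im_le_cmod)
    also have "\<dots> \<le> M" using M[of "\<bar>M\<bar> + 1"] by simp
    finally show False by simp
  qed
  show "\<exists>y>0. Complex (Re z) y \<in> C" using ray[of 1] by simp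
  obtain y where "0 < y" "Complex (Re z) (-1 * y) \<in> C" using ray[of "-1"] by auto
  then show "\<exists>y<0. Complex (Re z) y \<in> C" by (intro exI[of _ "- y"]) simp
qed

section \<open>The ovals of the period annulus\<close>

lemma interval_einterval: "x \<in> einterval a b \<Longrightarrow> y \<in> einterval a b \<Longrightarrow> {x..y} \<subseteq> einterval a b"
  by (auto simp: einterval_iff) (meson ereal_less_eq(3) less_le_trans le_less_trans)+

context period_annulus
begin

abbreviation "base \<equiv> einterval xl xr"

lemma image_in_strip:
  assumes "h \<in> einterval 0 h0" "z \<in> path_image (\<gamma> h)"
  shows "Re z \<in> base" and "A (Re z) + B (Re z) * Im z ^ (2 * m) = h"
proof -
  have "z \<in> annulus \<gamma> h0" using assms unfolding annulus_def by blast
  then show "Re z \<in> base" using projection by blast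
  show "A (Re z) + B (Re z) * Im z ^ (2 * m) = h" using levels[OF assms] by (simp add: hamiltonian_def)
qed

lemma origin_inside: "h \<in> einterval 0 h0 \<Longrightarrow> 0 \<in> inside (path_image (\<gamma> h))"
  using ovals by (simp add: oval_def)

lemma zero_in_base: "0 \<in> base"
proof -
  obtain h where h: "h \<in> einterval 0 h0" using h0_pos einterval_nonempty by blast
  obtain y where "Complex (Re 0) y \<in> path_image (\<gamma> h)"
    using vertical_line_meets_curve(1)[OF origin_inside[OF h]] by auto
  from image_in_strip(1)[OF h this] show ?thesis by simp
qed

lemma A_DERIV: "x \<in> base \<Longrightarrow> (A has_real_derivative deriv A x) (at x)"
  by (rule real_analytic_on_imp_DERIV[OF A_analytic])

lemma A_continuous: "continuous_on base A"
  by (rule real_analytic_on_imp_continuous_on[OF A_analytic])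

lemma A_increasing:
  assumes "0 \<le> x" "x < y" "y \<in> base"
  shows "A x < A y"
proof (rule DERIV_pos_imp_increasing_open[OF assms(2)])
  have sub: "{x..y} \<subseteq> base" using interval_einterval[OF zero_in_base assms(3)] assms by auto
  then show "continuous_on {x..y} A" by (rule continuous_on_subset[OF A_continuous])
  fix t assume "x < t" "t < y"
  then have "t \<in> base" "0 < t" using sub assms by auto
  then show "\<exists>D. (A has_real_derivative D) (at t) \<and> 0 < D"
    using A_DERIV A_deriv_pos[of t] by (auto simp: zero_less_mult_iff)
qed

lemma A_decreasing:
  assumes "x < y" "y \<le> 0" "x \<in> base"
  shows "A y < A x"
proof (rule DERIV_neg_imp_decreasing_open[OF assms(1)])
  have sub: "{x..y} \<subseteq> base" using interval_einterval[OF assms(3) zero_in_base] assms by auto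
  then show "continuous_on {x..y} A" by (rule continuous_on_subset[OF A_continuous])
  fix t assume "x < t" "t < y"
  then have "t \<in> base" "t < 0" using sub assms by auto
  then show "\<exists>D. (A has_real_derivative D) (at t) \<and> D < 0"
    using A_DERIV A_deriv_pos[of t] by (auto simp: zero_less_mult_iff)
qed

lemma A_mono_right: "0 \<le> x \<Longrightarrow> x \<le> y \<Longrightarrow> y \<in> base \<Longrightarrow> A x \<le> A y"
  using A_increasing[of x y] by (cases "x = y") auto

lemma A_mono_left: "x \<le> y \<Longrightarrow> y \<le> 0 \<Longrightarrow> x \<in> base \<Longrightarrow> A y \<le> A x"
  using A_decreasing[of x y] by (cases "x = y") auto

lemma A_below_top:
  assumes "x \<in> base"
  shows "\<exists>h\<in>einterval 0 h0. A x \<le> h"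
proof -
  obtain z where z: "z \<in> annulus \<gamma> h0" "x = Re z" using assms projection by blast
  then obtain h where h: "h \<in> einterval 0 h0" "z \<in> path_image (\<gamma> h)" unfolding annulus_def by blast
  have "0 \<le> B x * Im z ^ (2 * m)" using B_pos[OF assms] by (simp add: power_mult)
  then have "A x \<le> h" using image_in_strip(2)[OF h] z by simp
  then show ?thesis using h by blast
qed

text \<open>
  On the axis between the origin and \<open>x\<close> the Hamiltonian is below \<open>h\<close>, so this segment avoids the oval
  and \<open>x\<close> is inside it.
\<close>

lemma sublevel_meets_oval:
  assumes h: "h \<in> einterval 0 h0" and x: "x \<in> base" "A x < h"
  shows "\<exists>y>0. Complex x y \<in> path_image (\<gamma> h)" "\<exists>y<0. Complex x y \<in> path_image (\<gamma> h)"
proof -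
  let ?C = "path_image (\<gamma> h)"
  have "complex_of_real t \<notin> ?C" if "t \<in> closed_segment 0 x" for t
  proof
    assume mem: "complex_of_real t \<in> ?C"
    have "A t \<le> A x"
      using that A_mono_right[of t x] A_mono_left[of x t] x
      by (auto simp: closed_segment_eq_real_ivl split: if_splits)
    moreover have "A t = h" using image_in_strip(2)[OF h mem] m_pos by (auto simp: power_0_left)
    ultimately show False using x by simp
  qed
  then have "complex_of_real ` closed_segment 0 x \<inter> ?C = {}" by blast
  moreover have "connected (complex_of_real ` closed_segment 0 x)"
    by (intro connected_continuous_image continuous_intros) simp
  moreover have "0 \<in> complex_of_real ` closed_segment 0 x" by (rule image_eqI[of _ _ 0]) auto
  ultimately have "complex_of_real ` closed_segment 0 x \<subseteq> inside ?C"
    using connected_avoiding_stays_inside[OF origin_inside[OF h]] by blast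
  then have "complex_of_real x \<in> inside ?C" by auto
  from vertical_line_meets_curve[OF this]
  show "\<exists>y>0. Complex x y \<in> ?C" "\<exists>y<0. Complex x y \<in> ?C" by auto
qed

text \<open>
  The projection of the oval to the \<open>x\<close>-axis is compact and contains every \<open>x\<close> with \<open>A x < h\<close>. At
  its extreme points \<open>A\<close> cannot be below \<open>h\<close>, since then neighbouring points would belong to
  the projection as well.
\<close>

lemma oval_endpoints:
  assumes h: "h \<in> einterval 0 h0"
  obtains a b where "a < 0" "0 < b" "a \<in> base" "b \<in> base" "A a = h" "A b = h"
    "complex_of_real a \<in> path_image (\<gamma> h)" "complex_of_real b \<in> path_image (\<gamma> h)"
    "\<And>z. z \<in> path_image (\<gamma> h) \<Longrightarrow> a \<le> Re z \<and> Re z \<le> b"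
    "\<And>z. z \<in> path_image (\<gamma> h) \<Longrightarrow> Im z = 0 \<Longrightarrow> z = of_real a \<or> z = of_real b"
proof -
  let ?C = "path_image (\<gamma> h)"
  have hpos: "0 < h" using h by (simp add: einterval_iff)
  have path: "path (\<gamma> h)" using ovals[OF h] by (simp add: oval_def simple_path_imp_path)
  define R where "R = Re ` ?C"
  have R_compact: "compact R"
    unfolding R_def by (intro compact_continuous_image compact_path_image path continuous_intros)
  have sub: "x \<in> R" if "x \<in> base" "A x < h" for x
    using sublevel_meets_oval(1)[OF h that] unfolding R_def by (auto intro!: image_eqI[where x = "Complex x _"])
  have R_le: "x \<in> base" "A x \<le> h" if "x \<in> R" for x
  proof -
    obtain z where z: "z \<in> ?C" "x = Re z" using \<open>x \<in> R\<close> unfolding R_def by blast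
    show "x \<in> base" using image_in_strip(1)[OF h z(1)] z(2) by simp
    then have "0 \<le> B x * Im z ^ (2 * m)" using B_pos[of x] by (simp add: power_mult)
    then show "A x \<le> h" using image_in_strip(2)[OF h z(1)] z(2) by simp
  qed
  have R0: "0 \<in> R" using sub[OF zero_in_base] A_0 hpos by simp
  have neighbours: "\<exists>e>0. \<forall>y. \<bar>y - x\<bar> < e \<longrightarrow> y \<in> R" if x: "x \<in> R" "A x \<noteq> h" for x
  proof -
    have "x \<in> base" "A x < h" using R_le[OF x(1)] x(2) by auto
    have "isCont A x" using continuous_on_eq_continuous_at[OF open_einterval] A_continuous \<open>x \<in> base\<close> by blast
    then have "\<forall>\<^sub>F y in nhds x. A y < h"
      using \<open>A x < h\<close> by (auto simp: continuous_at tendsto_at_iff_tendsto_nhds intro: order_tendstoD)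
    moreover have "\<forall>\<^sub>F y in nhds x. y \<in> base" using \<open>x \<in> base\<close> by (simp add: eventually_nhds_in_open)
    ultimately have "\<forall>\<^sub>F y in nhds x. y \<in> R" by eventually_elim (rule sub)
    then show ?thesis by (auto simp: eventually_nhds_metric dist_real_def)
  qed
  obtain b where b: "b \<in> R" "\<And>x. x \<in> R \<Longrightarrow> x \<le> b" using compact_attains_sup[OF R_compact] R0 by blast
  obtain a where a: "a \<in> R" "\<And>x. x \<in> R \<Longrightarrow> a \<le> x" using compact_attains_inf[OF R_compact] R0 by blast
  have Ab: "A b = h"
  proof (rule ccontr)
    assume "A b \<noteq> h"
    then obtain e where "e > 0" "\<forall>y. \<bar>y - b\<bar> < e \<longrightarrow> y \<in> R" using neighbours b by blast
    then have "b + e / 2 \<in> R" by simp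
    then show False using b(2) \<open>e > 0\<close> by fastforce
  qed
  have Aa: "A a = h"
  proof (rule ccontr)
    assume "A a \<noteq> h"
    then obtain e where "e > 0" "\<forall>y. \<bar>y - a\<bar> < e \<longrightarrow> y \<in> R" using neighbours a by blast
    then have "a - e / 2 \<in> R" by simp
    then show False using a(2) \<open>e > 0\<close> by fastforce
  qed
  have "a \<noteq> 0" "b \<noteq> 0" using Aa Ab A_0 hpos by auto
  then have ab: "a < 0" "0 < b" using a(2)[OF R0] b(2)[OF R0] by auto
  have axis: "complex_of_real x \<in> ?C" if xR: "x \<in> R" "A x = h" for x
  proof -
    obtain z where z: "z \<in> ?C" "x = Re z" using xR unfolding R_def by blast
    have "B x * Im z ^ (2 * m) = 0" using image_in_strip(2)[OF h z(1)] z(2) xR by simp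
    then have "Im z = 0" using B_pos[OF R_le(1)[OF xR(1)]] by simp
    then have "z = of_real x" using z(2) by (simp add: complex_eq_iff)
    then show ?thesis using z(1) by simp
  qed
  show ?thesis
  proof (rule that[of a b])
    show "a < 0" "0 < b" "A a = h" "A b = h" by fact+
    show "a \<in> base" "b \<in> base" using R_le a b by auto
    show "complex_of_real a \<in> ?C" "complex_of_real b \<in> ?C" using axis a b Aa Ab by auto
    show "a \<le> Re z \<and> Re z \<le> b" if "z \<in> ?C" for z using a b that unfolding R_def by auto
    show "z = of_real a \<or> z = of_real b" if z: "z \<in> ?C" "Im z = 0" for z
    proof -
      have zz: "z = of_real (Re z)" using z(2) by (simp add: complex_eq_iff)
      have "Re z \<in> R" using z unfolding R_def by auto
      have Az: "A (Re z) = h" using image_in_strip(2)[OF h z(1)] z(2) m_pos by (auto simp: power_0_left)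
      have "Re z = a \<or> Re z = b"
      proof (cases "0 \<le> Re z")
        case True
        have "\<not> Re z < b" using A_increasing[OF True, of b] R_le b Ab Az by auto
        then show ?thesis using b(2)[OF \<open>Re z \<in> R\<close>] by simp
      next
        case False
        have "\<not> a < Re z" using A_decreasing[of a "Re z"] False R_le a Aa Az by auto
        then show ?thesis using a(2)[OF \<open>Re z \<in> R\<close>] by simp
      qed
      then show ?thesis using zz by auto
    qed
  qed
qed

text \<open>
  The total change of the logarithm along the upper arc from \<open>a\<close> to \<open>b\<close>, followed by the lower arc back
  to \<open>a\<close>. The factors \<open>-\<i>\<close> and \<open>\<i>\<close> turn the closed upper and lower half planes away from
  the cut of the principal logarithm.
\<close>

lemma Ln_at_endpoints:
  assumes "a < 0" "0 < b"
  shows "(Ln (-\<i> * of_real b) - Ln (-\<i> * of_real a)) - (Ln (\<i> * of_real b) - Ln (\<i> * of_real a)) = - (2 * of_real pi * \<i>)"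
proof -
  have half: "exp (\<i> * complex_of_real (pi / 2)) = \<i>"
    by (simp only: cis_conv_exp[symmetric] cis_pi_half)
  have half': "exp (- (\<i> * complex_of_real (pi / 2))) = - \<i>"
    by (simp only: exp_minus half) simp
  have e: "exp (of_real (ln r) + \<i> * of_real (pi / 2)) = \<i> * of_real r"
    "exp (of_real (ln r) + - (\<i> * of_real (pi / 2))) = - \<i> * of_real r" if "0 < r" for r
    unfolding exp_add half half' using that exp_of_real[of "ln r", where 'a = complex] by simp_all
  have Ln: "Ln (\<i> * of_real r) = of_real (ln r) + \<i> * of_real (pi / 2)"
    "Ln (- \<i> * of_real r) = of_real (ln r) + - (\<i> * of_real (pi / 2))" if "0 < r" for r
    by (rule Ln_unique[OF e(1)[OF that]] Ln_unique[OF e(2)[OF that]];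
        use pi_gt_zero in \<open>simp; linarith\<close>)+
  have a: "- \<i> * of_real a = \<i> * of_real (- a)" "\<i> * of_real a = - \<i> * of_real (- a)" by simp_all
  have na: "0 < - a" using assms by simp
  show ?thesis
    unfolding a Ln[OF assms(2)] Ln[OF na] by simp
qed

text \<open>
  On the upper half of the oval the form \<open>f(x) y^(2s-1) dx\<close> is the differential of an antiderivative \<open>\<Phi>\<close>
  evaluated at \<open>x\<close>, and on the lower half of \<open>-\<Phi>\<close> because the exponent is odd. Likewise \<open>dz / z\<close> has the
  primitives \<open>Ln (-\<i> z)\<close> and \<open>Ln (\<i> z)\<close>. So \<open>integral_along_two_arcs\<close> evaluates both integrals.
\<close>

theorem abelian_integral_as_real_integral:
  assumes h: "h \<in> einterval 0 h0" and ab: "a < 0" "0 < b" "a \<in> base" "b \<in> base" "A a = h" "A b = h"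
    and f: "continuous_on base f" and s: "1 \<le> s"
  shows "abelian_integral f s \<gamma> h = - 2 * Re (winding_number (\<gamma> h) 0) *
      integral {a..b} (\<lambda>x. f x * ((h - A x) / B x) powr ((2 * real s - 1) / (2 * real m)))"
    and "winding_number (\<gamma> h) 0 \<in> {1, -1}"
proof -
  let ?C = "path_image (\<gamma> h)"
  define p where "p = (2 * real s - 1) / (2 * real m)"
  have p: "0 < p" using s m_pos by (simp add: p_def)
  have valid: "valid_path (\<gamma> h)" and simple: "simple_path (\<gamma> h)"
    and loop: "pathfinish (\<gamma> h) = pathstart (\<gamma> h)" and inside: "0 \<in> inside ?C"
    using ovals[OF h] by (auto simp: oval_def)
  obtain a' b' where ab': "a' < 0" "0 < b'" "a' \<in> base" "b' \<in> base" "A a' = h" "A b' = h"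
    "complex_of_real a' \<in> ?C" "complex_of_real b' \<in> ?C"
    "\<And>z. z \<in> ?C \<Longrightarrow> a' \<le> Re z \<and> Re z \<le> b'"
    "\<And>z. z \<in> ?C \<Longrightarrow> Im z = 0 \<Longrightarrow> z = of_real a' \<or> z = of_real b'"
    by (rule oval_endpoints[OF h]) (rule that)
  have "a' = a"
    using A_decreasing[of a a'] A_decreasing[of a' a] ab ab'(1-6) by (cases a a' rule: linorder_cases) auto
  have "b' = b"
    using A_increasing[of b b'] A_increasing[of b' b] ab ab'(1-6) by (cases b b' rule: linorder_cases) auto
  note C = ab'(7-)[unfolded \<open>a' = a\<close> \<open>b' = b\<close>]
  have "0 < h" using h by (simp add: einterval_iff)
  then have both: "\<exists>z\<in>?C. 0 < Im z" "\<exists>z\<in>?C. Im z < 0"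
    using sublevel_meets_oval[OF h zero_in_base, unfolded A_0] by (metis complex.sel(2))+
  have zeroC: "0 \<notin> ?C" using inside by (simp add: inside_def)
  obtain \<epsilon> :: real where \<epsilon>: "\<epsilon> \<in> {1, -1}" and arcs:
    "\<And>(P_up :: complex \<Rightarrow> complex) P_lo q S.
       continuous_on (?C \<inter> {z. 0 \<le> Im z}) P_up \<Longrightarrow>
       continuous_on (?C \<inter> {z. Im z \<le> 0}) P_lo \<Longrightarrow> finite S \<Longrightarrow>
       (\<And>t. t \<in> {0<..<1} - S \<Longrightarrow> 0 < Im (\<gamma> h t) \<Longrightarrow> ((\<lambda>t. P_up (\<gamma> h t)) has_vector_derivative q t) (at t)) \<Longrightarrow>
       (\<And>t. t \<in> {0<..<1} - S \<Longrightarrow> Im (\<gamma> h t) < 0 \<Longrightarrow> ((\<lambda>t. P_lo (\<gamma> h t)) has_vector_derivative q t) (at t)) \<Longrightarrow>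
       (q has_integral of_real \<epsilon> * ((P_up (of_real b) - P_up (of_real a)) - (P_lo (of_real b) - P_lo (of_real a)))) {0..1}"
    by (rule integral_along_two_arcs[OF simple loop _ C(1,2) _ _ C(4) both]) (use ab in auto)
  obtain S where S: "finite S" "\<gamma> h C1_differentiable_on ({0..1} - S)"
    using valid by (auto simp: valid_path_def piecewise_C1_differentiable_on_def)
  define c' where "c' = (\<lambda>t. vector_derivative (\<gamma> h) (at t))"
  have c': "(\<gamma> h has_vector_derivative c' t) (at t)" if "t \<in> {0<..<1} - S" for t
    using S(2) that unfolding c'_def C1_differentiable_on_eq
    by (auto simp: vector_derivative_works[symmetric])
  have inC: "\<gamma> h t \<in> ?C" if "t \<in> {0<..<1}" for t using that by (auto simp: path_image_def)
  
  have winding: "winding_number (\<gamma> h) 0 = - of_real \<epsilon>"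
  proof -
    have up: "- \<i> * z \<notin> \<real>\<^sub>\<le>\<^sub>0" if "0 \<le> Im z" "z \<noteq> 0" for z
      using that by (auto simp: complex_nonpos_Reals_iff complex_eq_iff)
    have lo: "\<i> * z \<notin> \<real>\<^sub>\<le>\<^sub>0" if "Im z \<le> 0" "z \<noteq> 0" for z
      using that by (auto simp: complex_nonpos_Reals_iff complex_eq_iff)
    have Ln_der: "((\<lambda>t. Ln (w * \<gamma> h t)) has_vector_derivative 1 / \<gamma> h t * c' t) (at t)"
      if t: "t \<in> {0<..<1} - S" and w: "w * \<gamma> h t \<notin> \<real>\<^sub>\<le>\<^sub>0" "w \<noteq> 0" for t w
    proof -
      have "((\<lambda>z. Ln (w * z)) has_field_derivative 1 / \<gamma> h t) (at (\<gamma> h t))"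
        by (rule derivative_eq_intros refl w(1))+ (use w in \<open>auto simp: divide_simps\<close>)
      from field_vector_diff_chain_at[OF c'[OF t] this] show ?thesis by (simp add: comp_def mult.commute)
    qed
    have "((\<lambda>t. 1 / \<gamma> h t * c' t) has_integral of_real \<epsilon> *
        ((Ln (-\<i> * of_real b) - Ln (-\<i> * of_real a)) - (Ln (\<i> * of_real b) - Ln (\<i> * of_real a)))) {0..1}"
    proof (rule arcs[where P_up = "\<lambda>z. Ln (- \<i> * z)" and P_lo = "\<lambda>z. Ln (\<i> * z)", OF _ _ S(1)])
      show "continuous_on (?C \<inter> {z. 0 \<le> Im z}) (\<lambda>z. Ln (- \<i> * z))"
        by (intro continuous_on_Ln continuous_intros) (use up zeroC in blast)
      show "continuous_on (?C \<inter> {z. Im z \<le> 0}) (\<lambda>z. Ln (\<i> * z))"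
        by (intro continuous_on_Ln continuous_intros) (use lo zeroC in blast)
      show "((\<lambda>t. Ln (- \<i> * \<gamma> h t)) has_vector_derivative 1 / \<gamma> h t * c' t) (at t)"
        if "t \<in> {0<..<1} - S" "0 < Im (\<gamma> h t)" for t
      proof (rule Ln_der[OF that(1)])
        show "- \<i> * \<gamma> h t \<notin> \<real>\<^sub>\<le>\<^sub>0" by (rule up) (use that(2) in auto)
      qed simp
      show "((\<lambda>t. Ln (\<i> * \<gamma> h t)) has_vector_derivative 1 / \<gamma> h t * c' t) (at t)"
        if "t \<in> {0<..<1} - S" "Im (\<gamma> h t) < 0" for t
      proof (rule Ln_der[OF that(1)])
        show "\<i> * \<gamma> h t \<notin> \<real>\<^sub>\<le>\<^sub>0" by (rule lo) (use that(2) in auto)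
      qed simp
    qed
    then have "((\<lambda>t. 1 / \<gamma> h t * c' t) has_integral of_real \<epsilon> * (- (2 * of_real pi * \<i>))) {0..1}"
      unfolding Ln_at_endpoints[OF ab(1,2)] .
    moreover have "((\<lambda>t. 1 / \<gamma> h t * c' t) has_integral 2 * of_real pi * \<i> * winding_number (\<gamma> h) 0) {0..1}"
      using has_contour_integral_winding_number[OF valid zeroC]
      unfolding has_contour_integral c'_def by simp
    ultimately have "2 * of_real pi * \<i> * winding_number (\<gamma> h) 0 = of_real \<epsilon> * (- (2 * of_real pi * \<i>))"
      by (rule has_integral_unique[rotated])
    then have "2 * of_real pi * \<i> * winding_number (\<gamma> h) 0 = 2 * of_real pi * \<i> * (- of_real \<epsilon>)"
      by (simp only: mult.commute[of "complex_of_real \<epsilon>"] mult_minus_left mult_minus_right)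
    moreover have "2 * of_real pi * \<i> \<noteq> 0" by simp
    ultimately show ?thesis by (rule mult_left_cancel[THEN iffD1, rotated])
  qed
  have "\<epsilon> = 1 \<or> \<epsilon> = -1" using \<epsilon> by simp
  then show "winding_number (\<gamma> h) 0 \<in> {1, -1}" unfolding winding by (elim disjE) simp_all
  
  define \<phi> where "\<phi> = (\<lambda>x. f x * ((h - A x) / B x) powr p)"
  define \<Phi> where "\<Phi> = (\<lambda>x. integral {a..x} \<phi>)"
  have sub: "{a..b} \<subseteq> base" by (rule interval_einterval[OF ab(3,4)])
  have A_le: "A x \<le> h" if "x \<in> {a..b}" for x
  proof (cases "0 \<le> x")
    case True
    then show ?thesis using A_mono_right[of x b] ab that by simp
  next
    case False
    then show ?thesis using A_mono_left[of a x] ab that by simp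
  qed
  have B_pos_ab: "0 < B x" if "x \<in> {a..b}" for x
    using B_pos[of x] sub that by blast
  have "continuous_on {a..b} f" "continuous_on {a..b} A" "continuous_on {a..b} B"
    using continuous_on_subset[OF f sub] continuous_on_subset[OF A_continuous sub]
      continuous_on_subset[OF real_analytic_on_imp_continuous_on[OF B_analytic] sub] by auto
  then have cont\<phi>: "continuous_on {a..b} \<phi>"
    unfolding \<phi>_def
  proof (intro continuous_on_mult continuous_on_powr' continuous_on_divide continuous_on_diff continuous_on_const)
    show "\<forall>x\<in>{a..b}. B x \<noteq> 0" using B_pos_ab by (intro ballI) (simp add: less_imp_neq[symmetric])
    show "\<forall>x\<in>{a..b}. 0 \<le> (h - A x) / B x \<and> ((h - A x) / B x = 0 \<longrightarrow> 0 < p)"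
    proof
      fix x assume x: "x \<in> {a..b}"
      then show "0 \<le> (h - A x) / B x \<and> ((h - A x) / B x = 0 \<longrightarrow> 0 < p)"
        using A_le[OF x] B_pos_ab[OF x] p by simp
    qed
  qed
  have \<Phi>_der: "(\<Phi> has_real_derivative \<phi> x) (at x within {a..b})" if "x \<in> {a..b}" for x
    unfolding \<Phi>_def by (rule integral_has_real_derivative[OF cont\<phi> that])
  then have cont\<Phi>: "continuous_on {a..b} \<Phi>" by (rule DERIV_continuous_on)
  \<comment> \<open>The odd power of \<open>y\<close> in terms of the even power that the level equation determines.\<close>
  have y_power: "sgn y * y ^ (2 * s - 1) = (y ^ (2 * m)) powr p" if "y \<noteq> 0" for y :: real
  proof -
    have "sgn y * y ^ (2 * s - 1) = \<bar>y\<bar> ^ (2 * s - 1)"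
    proof -
      have "odd (2 * s - 1)" using s by simp
      then have "sgn y ^ (2 * s - 1) = sgn y" using that by (cases "0 < y") auto
      moreover have "\<bar>y\<bar> ^ (2 * s - 1) = (sgn y * y) ^ (2 * s - 1)" by (simp add: abs_sgn mult.commute)
      ultimately show ?thesis by (simp add: power_mult_distrib)
    qed
    also have "\<dots> = \<bar>y\<bar> powr (2 * real s - 1)"
      using that s by (simp add: powr_realpow[symmetric] of_nat_diff)
    also have "2 * real s - 1 = (2 * real m) * p" using m_pos by (simp add: p_def)
    also have "\<bar>y\<bar> powr ((2 * real m) * p) = (\<bar>y\<bar> powr (2 * real m)) powr p" by (simp add: powr_powr)
    also have "\<bar>y\<bar> powr (2 * real m) = y ^ (2 * m)"
      using that powr_realpow[of "\<bar>y\<bar>" "2 * m"] by (simp add: power_even_abs)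
    finally show ?thesis .
  qed
  define q where "q = (\<lambda>t. complex_of_real (f (Re (\<gamma> h t)) * Im (\<gamma> h t) ^ (2 * s - 1) * Re (c' t)))"
  have der: "((\<lambda>t. complex_of_real (d * \<Phi> (Re (\<gamma> h t)))) has_vector_derivative q t) (at t)"
    if t: "t \<in> {0<..<1} - S" and d: "Im (\<gamma> h t) \<noteq> 0" "d = sgn (Im (\<gamma> h t))" for t d
  proof -
    let ?x = "Re (\<gamma> h t)" and ?y = "Im (\<gamma> h t)"
    have z: "\<gamma> h t \<in> ?C" using inC t by auto
    have eq: "A ?x + B ?x * ?y ^ (2 * m) = h" by (rule image_in_strip(2)[OF h z])
    have xJ: "?x \<in> base" by (rule image_in_strip(1)[OF h z])
    have "0 < ?y ^ (2 * m)" using d(1) by (simp add: power_mult)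
    then have "A ?x < h" using eq B_pos[OF xJ] by (smt (verit) mult_pos_pos)
    then have x: "a < ?x" "?x < b" using C(3)[OF z] ab by (auto simp: le_less)
    have "(\<Phi> has_real_derivative \<phi> ?x) (at ?x)"
      using \<Phi>_der[of ?x] x at_within_interior[of ?x "{a..b}"] by (simp add: interior_atLeastAtMost_real)
    moreover have "((\<lambda>t. Re (\<gamma> h t)) has_vector_derivative Re (c' t)) (at t)"
      by (rule bounded_linear.has_vector_derivative[OF bounded_linear_Re c'[OF t]])
    ultimately have "((\<Phi> \<circ> (\<lambda>t. Re (\<gamma> h t))) has_vector_derivative Re (c' t) * \<phi> ?x) (at t)"
      by (intro field_vector_diff_chain_at)
    then have "((\<lambda>t. d * \<Phi> (Re (\<gamma> h t))) has_vector_derivative d * (Re (c' t) * \<phi> ?x)) (at t)"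
      unfolding comp_def by (rule bounded_linear.has_vector_derivative[OF bounded_linear_mult_right])
    then have vd: "((\<lambda>t. complex_of_real (d * \<Phi> (Re (\<gamma> h t)))) has_vector_derivative of_real (d * (Re (c' t) * \<phi> ?x))) (at t)"
      by (rule bounded_linear.has_vector_derivative[OF bounded_linear_of_real])
    have "(h - A ?x) / B ?x = ?y ^ (2 * m)" using eq B_pos[OF xJ] by (simp add: field_simps)
    then have "d * \<phi> ?x = f ?x * ((d * sgn ?y) * ?y ^ (2 * s - 1))"
      unfolding \<phi>_def using y_power[OF d(1)] by simp
    moreover have "d * sgn ?y = 1" using d by (cases "0 < ?y") auto
    ultimately have "d * \<phi> ?x = f ?x * ?y ^ (2 * s - 1)" by simp
    then have val: "d * (Re (c' t) * \<phi> ?x) = f ?x * ?y ^ (2 * s - 1) * Re (c' t)" by (simp add: mult.left_commute mult.commute)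
    show ?thesis using vd unfolding val q_def .
  qed
  have ReC: "Re ` (?C \<inter> T) \<subseteq> {a..b}" for T using C(3) by auto
  have cont: "continuous_on (?C \<inter> T) (\<lambda>z. complex_of_real (d * \<Phi> (Re z)))" for T d
    by (intro continuous_intros continuous_on_compose2[OF cont\<Phi> _ ReC])
  have "(q has_integral of_real \<epsilon> * ((of_real (1 * \<Phi> (Re (of_real b))) - of_real (1 * \<Phi> (Re (of_real a))))
      - (of_real (- 1 * \<Phi> (Re (of_real b))) - of_real (- 1 * \<Phi> (Re (of_real a)))))) {0..1}"
    by (rule arcs[OF cont cont S(1)]; rule der) auto
  then have "(q has_integral of_real (2 * \<epsilon> * \<Phi> b)) {0..1}"
    by (simp add: \<Phi>_def algebra_simps)
  from has_integral_linear[OF this bounded_linear_Re]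
  have int: "((\<lambda>t. f (Re (\<gamma> h t)) * Im (\<gamma> h t) ^ (2 * s - 1) * Re (c' t)) has_integral 2 * \<epsilon> * \<Phi> b) {0..1}"
    by (simp add: comp_def q_def)
  have "((\<lambda>t. f (Re (\<gamma> h t)) * Im (\<gamma> h t) ^ (2 * s - 1) *
      vector_derivative (\<lambda>u. Re (\<gamma> h u)) (at t within {0..1})) has_integral 2 * \<epsilon> * \<Phi> b) {0..1}"
  proof (rule has_integral_spike_finite[OF _ _ int])
    show "finite (insert 0 (insert 1 S))" using S by simp
    fix t assume "t \<in> {0..1} - insert 0 (insert 1 S)"
    then have t: "t \<in> {0<..<1} - S" by auto
    have "((\<lambda>t. Re (\<gamma> h t)) has_vector_derivative Re (c' t)) (at t)"
      by (rule bounded_linear.has_vector_derivative[OF bounded_linear_Re c'[OF t]])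
    then have "vector_derivative (\<lambda>u. Re (\<gamma> h u)) (at t within {0..1}) = Re (c' t)"
      using t by (simp add: vector_derivative_at at_within_Icc_at)
    then show "f (Re (\<gamma> h t)) * Im (\<gamma> h t) ^ (2 * s - 1) * vector_derivative (\<lambda>u. Re (\<gamma> h u)) (at t within {0..1})
        = f (Re (\<gamma> h t)) * Im (\<gamma> h t) ^ (2 * s - 1) * Re (c' t)" by simp
  qed
  then have "abelian_integral f s \<gamma> h = 2 * \<epsilon> * \<Phi> b"
    unfolding abelian_integral_def line_integral_dx_def by (rule integral_unique)
  then show "abelian_integral f s \<gamma> h = - 2 * Re (winding_number (\<gamma> h) 0) *
      integral {a..b} (\<lambda>x. f x * ((h - A x) / B x) powr ((2 * real s - 1) / (2 * real m)))"
    by (simp add: winding \<Phi>_def \<phi>_def p_def)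
qed

end

section \<open>Folding along the involution\<close>

text \<open>
  The integrand that \<open>\<phi>\<close> contributes on the right half line after the substitution by \<open>\<sigma>\<close> on the left one.
  Unlike the balance of \<open>\<phi> / A'\<close>, it has no singularity at \<open>0\<close>.
\<close>

definition folded :: "(real \<Rightarrow> real) \<Rightarrow> (real \<Rightarrow> real) \<Rightarrow> real \<Rightarrow> real"
  where "folded \<sigma> \<phi> x = \<phi> x - \<phi> (\<sigma> x) * deriv \<sigma> x"

context period_annulus
begin

lemma A_pos: "x \<in> base \<Longrightarrow> x \<noteq> 0 \<Longrightarrow> 0 < A x"
  using A_increasing[of 0 x] A_decreasing[of x 0] A_0 by (cases "0 < x") auto

lemma A_inj_right: "x \<in> base \<Longrightarrow> y \<in> base \<Longrightarrow> 0 \<le> x \<Longrightarrow> 0 \<le> y \<Longrightarrow> A x = A y \<Longrightarrow> x = y"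
  using A_increasing[of x y] A_increasing[of y x] by (cases x y rule: linorder_cases) auto

lemma A_inj_left: "x \<in> base \<Longrightarrow> y \<in> base \<Longrightarrow> x \<le> 0 \<Longrightarrow> y \<le> 0 \<Longrightarrow> A x = A y \<Longrightarrow> x = y"
  using A_decreasing[of x y] A_decreasing[of y x] by (cases x y rule: linorder_cases) auto

lemma right_half: "einterval 0 xr = {x \<in> base. 0 < x}"
proof -
  have "xl < ereal 0" using zero_in_base by (simp only: einterval_iff)
  then have "xl < ereal x" if "0 < x" for x
    using that by (meson less_ereal.simps(1) less_trans)
  then show ?thesis by (auto simp: einterval_iff)
qed

lemma energy_branch_right: "energy_branch (einterval 0 xr) A"
proof
  show "open (einterval 0 xr)" by simp
  show "0 < x" if "x \<in> einterval 0 xr" for x using that by (simp add: right_half)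
  show "t \<in> einterval 0 xr" if "x \<in> einterval 0 xr" "0 < t" "t \<le> x" for x t
    using that interval_einterval[OF zero_in_base, of x] unfolding right_half by auto
  have sub: "insert 0 (einterval 0 xr) \<subseteq> base" using zero_in_base by (auto simp: right_half)
  show "A real_analytic_on einterval 0 xr" by (rule real_analytic_on_mono[OF A_analytic]) (use sub in blast)
  show "continuous_on (insert 0 (einterval 0 xr)) A" by (rule continuous_on_subset[OF A_continuous sub])
  show "A 0 = 0" by (rule A_0)
  show "0 < deriv A x" if "x \<in> einterval 0 xr" for x
    using that A_deriv_pos[of x] unfolding right_half by (auto simp: zero_less_mult_iff)
qed

text \<open>
  This is where the annulus and the top energy \<open>h0\<close> are seen to fit together: an energy \<open>A x\<close> is
  below \<open>h0\<close> because \<open>x\<close> is the projection of a point of some oval, and every \<open>h\<close> below \<open>h0\<close> is attained at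
  the right end point of its oval.
\<close>

lemma energies: "A ` einterval 0 xr = einterval 0 h0"
proof
  show "A ` einterval 0 xr \<subseteq> einterval 0 h0"
  proof
    fix h assume "h \<in> A ` einterval 0 xr"
    then obtain x where x: "x \<in> base" "0 < x" "h = A x" unfolding right_half by auto
    then obtain k where k: "k \<in> einterval 0 h0" "h \<le> k" using A_below_top by blast
    have "0 < h" using A_pos x by auto
    moreover have "ereal h < h0"
      using k by (metis einterval_iff ereal_less_eq(3) le_less_trans)
    ultimately show "h \<in> einterval 0 h0" by (simp add: einterval_iff)
  qed
  show "einterval 0 h0 \<subseteq> A ` einterval 0 xr"
  proof
    fix h assume h: "h \<in> einterval 0 h0"
    obtain a b where "0 < b" "b \<in> base" "A b = h" by (rule oval_endpoints[OF h]) (rule that)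
    then show "h \<in> A ` einterval 0 xr" unfolding right_half by (intro image_eqI[of _ _ b]) auto
  qed
qed

lemma winding_number_constant:
  obtains w :: real where "w \<noteq> 0" "\<And>h. h \<in> einterval 0 h0 \<Longrightarrow> Re (winding_number (\<gamma> h) 0) = w"
proof -
  obtain h1 where h1: "h1 \<in> einterval 0 h0" using h0_pos einterval_nonempty by blast
  obtain a b where ab: "a < 0" "0 < b" "a \<in> base" "b \<in> base" "A a = h1" "A b = h1"
    by (rule oval_endpoints[OF h1]) (rule that)
  have "winding_number (\<gamma> h1) 0 \<in> {1, -1}"
    by (rule abelian_integral_as_real_integral(2)[OF h1 ab continuous_on_const, of 1]) simp
  then have "Re (winding_number (\<gamma> h1) 0) \<noteq> 0" by (elim insertE) simp_all
  then show ?thesis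
  proof (rule that)
    show "Re (winding_number (\<gamma> h) 0) = Re (winding_number (\<gamma> h1) 0)" if "h \<in> einterval 0 h0" for h
      using orientation[OF that h1] by simp
  qed
qed

context
  fixes \<sigma> :: "real \<Rightarrow> real"
  assumes \<sigma>: "associated_involution A base \<sigma>"
begin

lemma \<sigma>_base: "x \<in> base \<Longrightarrow> \<sigma> x \<in> base" and \<sigma>_\<sigma>: "x \<in> base \<Longrightarrow> \<sigma> (\<sigma> x) = x"
  and A_\<sigma>: "x \<in> base \<Longrightarrow> A (\<sigma> x) = A x" and \<sigma>_analytic: "\<sigma> real_analytic_on base"
  using \<sigma> unfolding associated_involution_def Pi_iff by (blast, blast, metis, blast)

lemma \<sigma>_continuous: "continuous_on base \<sigma>"
  by (rule real_analytic_on_imp_continuous_on[OF \<sigma>_analytic])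

lemma \<sigma>_DERIV: "x \<in> base \<Longrightarrow> (\<sigma> has_real_derivative deriv \<sigma> x) (at x)"
  by (rule real_analytic_on_imp_DERIV[OF \<sigma>_analytic])

lemma \<sigma>_0: "\<sigma> 0 = 0"
  using A_pos[OF \<sigma>_base[OF zero_in_base]] A_\<sigma>[OF zero_in_base] A_0 by force

lemma \<sigma>_neq_0: "x \<in> base \<Longrightarrow> x \<noteq> 0 \<Longrightarrow> \<sigma> x \<noteq> 0"
  using \<sigma>_\<sigma>[of x] \<sigma>_0 by metis

text \<open>
  On \<open>x > 0\<close> the continuous function \<open>\<sigma>\<close> has no zero, so it has constant sign. If it were positive,
  injectivity of \<open>A\<close> would force \<open>\<sigma>\<close> to be the identity first on the right and then, as \<open>\<sigma>\<close> is
  an involution, on the left.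
\<close>

lemma \<sigma>_swaps_sides:
  assumes x: "x \<in> base" "0 < x"
  shows "\<sigma> x < 0"
proof (rule ccontr)
  assume "\<not> \<sigma> x < 0"
  then have "0 < \<sigma> x" using \<sigma>_neq_0[OF x(1)] x(2) by force
  interpret energy_branch "einterval 0 xr" A by (rule energy_branch_right)
  have sub: "einterval 0 xr \<subseteq> base" by (auto simp: right_half)
  have conn: "connected (\<sigma> ` einterval 0 xr)"
    by (rule connected_continuous_image[OF continuous_on_subset[OF \<sigma>_continuous sub] connected_X])
  have pos: "0 < \<sigma> y" if y: "y \<in> base" "0 < y" for y
  proof (rule ccontr)
    assume "\<not> 0 < \<sigma> y"
    then have "0 \<in> \<sigma> ` einterval 0 xr"
      using connectedD_interval[OF conn, of "\<sigma> y" "\<sigma> x" 0] x y \<open>0 < \<sigma> x\<close> by (auto simp: right_half)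
    then show False using \<sigma>_neq_0 by (auto simp: right_half)
  qed
  have id_right: "\<sigma> y = y" if y: "y \<in> base" "0 < y" for y
    by (rule A_inj_right[OF \<sigma>_base[OF y(1)] y(1) _ _ A_\<sigma>[OF y(1)]]) (use pos[OF y] y in simp_all)
  have "\<sigma> y = y" if y: "y \<in> base" for y
  proof (cases y "0 :: real" rule: linorder_cases)
    case less
    have "\<not> 0 < \<sigma> y"
    proof
      assume "0 < \<sigma> y"
      then have "\<sigma> (\<sigma> y) = \<sigma> y" by (rule id_right[OF \<sigma>_base[OF y]])
      then show False using \<sigma>_\<sigma>[OF y] less \<open>0 < \<sigma> y\<close> by linarith
    qed
    then show ?thesis
      by (intro A_inj_left[OF \<sigma>_base[OF y] y _ _ A_\<sigma>[OF y]]) (use less in simp_all)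
  next
    case equal
    then show ?thesis using \<sigma>_0 by simp
  next
    case greater
    then show ?thesis by (rule id_right[OF y])
  qed
  then show False using \<sigma> unfolding associated_involution_def by blast
qed

lemma deriv_A_\<sigma>:
  assumes x: "x \<in> base"
  shows "deriv A (\<sigma> x) * deriv \<sigma> x = deriv A x"
proof -
  have "((\<lambda>x. A (\<sigma> x)) has_real_derivative deriv A (\<sigma> x) * deriv \<sigma> x) (at x)"
    by (rule DERIV_chain2[OF A_DERIV[OF \<sigma>_base[OF x]] \<sigma>_DERIV[OF x]])
  then have "(A has_real_derivative deriv A (\<sigma> x) * deriv \<sigma> x) (at x)"
    by (rule has_field_derivative_transform_within_open[OF _ open_einterval x]) (rule A_\<sigma>)
  then show ?thesis by (simp add: DERIV_imp_deriv)
qed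

lemma folded_continuous: "continuous_on base \<phi> \<Longrightarrow> continuous_on base (folded \<sigma> \<phi>)"
  unfolding folded_def[abs_def]
  by (intro continuous_on_diff continuous_on_mult continuous_on_compose2[of base \<phi> base \<sigma>] \<sigma>_continuous
      real_analytic_on_imp_continuous_on[OF real_analytic_on_deriv[OF \<sigma>_analytic]] image_subsetI \<sigma>_base)

text \<open>
  Differentiating \<open>A (\<sigma> x) = A x\<close> gives \<open>deriv \<sigma> x = deriv A x / deriv A (\<sigma> x)\<close>.
\<close>

lemma folded_eq_balance:
  assumes x: "x \<in> einterval 0 xr"
  shows "folded \<sigma> \<phi> x = deriv A x * balance \<sigma> (\<lambda>x. \<phi> x / deriv A x) x"
proof -
  have xb: "x \<in> base" "0 < x" using x by (auto simp: right_half)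
  have "\<sigma> x < 0" by (rule \<sigma>_swaps_sides[OF xb])
  then have "deriv A (\<sigma> x) \<noteq> 0" "deriv A x \<noteq> 0"
    using A_deriv_pos[of x] A_deriv_pos[of "\<sigma> x"] \<sigma>_base[OF xb(1)] xb by auto
  then show ?thesis
    unfolding folded_def balance_def using deriv_A_\<sigma>[OF xb(1)]
    by (simp add: field_simps)
qed

lemma integral_fold:
  assumes ab: "a < 0" "0 < b" "a \<in> base" "b \<in> base" "A a = h" "A b = h"
    and \<phi>: "continuous_on base \<phi>" and p: "0 < p"
  shows "integral {a..b} (\<lambda>x. \<phi> x * (h - A x) powr p) = integral {0..b} (\<lambda>x. folded \<sigma> \<phi> x * (h - A x) powr p)"
proof -
  let ?F = "\<lambda>x. \<phi> x * (h - A x) powr p"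
  have sub: "{a..b} \<subseteq> base" by (rule interval_einterval[OF ab(3,4)])
  have sub0: "{0..b} \<subseteq> base" by (rule interval_einterval[OF zero_in_base ab(4)])
  have A_le: "A x \<le> h" if "x \<in> {a..b}" for x
  proof (cases "0 \<le> x")
    case True
    then show ?thesis using A_mono_right[of x b] ab that by simp
  next
    case False
    then show ?thesis using A_mono_left[of a x] ab that by simp
  qed
  have cont: "continuous_on {a..b} ?F"
    by (intro continuous_intros continuous_on_powr' continuous_on_subset[OF \<phi> sub]
        continuous_on_subset[OF A_continuous sub]) (use A_le p in auto)
  have \<sigma>b: "\<sigma> b = a"
    by (rule A_inj_left[OF \<sigma>_base[OF ab(4)] ab(3)])
       (use ab A_\<sigma>[OF ab(4)] \<sigma>_swaps_sides[OF ab(4,2)] in simp_all)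
  have range: "\<sigma> x \<in> {a..0}" if "x \<in> {0..b}" for x
  proof (cases "x = 0")
    case True
    then show ?thesis using \<sigma>_0 ab by simp
  next
    case False
    have "x \<in> {a..b}" using that ab(1) by simp
    then have x: "x \<in> base" using sub by blast
    have "0 < x" using False that by simp
    note x = x this \<sigma>_swaps_sides[OF x this]
    have "\<not> \<sigma> x < a"
    proof
      assume "\<sigma> x < a"
      then have "A a < A (\<sigma> x)" by (rule A_decreasing) (use ab \<sigma>_base x in auto)
      also have "A (\<sigma> x) \<le> h" using A_\<sigma>[OF x(1)] A_le[OF \<open>x \<in> {a..b}\<close>] by simp
      finally show False using ab by simp
    qed
    with x show ?thesis by simp
  qed
  have "((\<lambda>x. deriv \<sigma> x *\<^sub>R ?F (\<sigma> x)) has_integral (integral {\<sigma> 0..\<sigma> b} ?F - integral {\<sigma> b..\<sigma> 0} ?F)) {0..b}"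
  proof (rule has_integral_substitution_general[of "{}"])
    show "continuous_on {a..0} ?F" by (rule continuous_on_subset[OF cont]) (use ab in auto)
    show "\<sigma> ` {0..b} \<subseteq> {a..0}" using range by blast
    show "continuous_on {0..b} \<sigma>"
      by (rule continuous_on_subset[OF \<sigma>_continuous sub0])
    show "(\<sigma> has_field_derivative deriv \<sigma> x) (at x within {0..b})" if "x \<in> {0..b} - {}" for x
      by (rule has_field_derivative_at_within[OF \<sigma>_DERIV]) (use that sub0 in blast)
  qed (use ab in auto)
  then have left: "((\<lambda>x. deriv \<sigma> x * ?F (\<sigma> x)) has_integral - integral {a..0} ?F) {0..b}"
    using ab by (simp add: \<sigma>_0 \<sigma>b)
  have int: "?F integrable_on {a..b}" by (rule integrable_continuous_interval[OF cont])
  have right: "(?F has_integral integral {0..b} ?F) {0..b}"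
    by (rule integrable_integral, rule integrable_on_subinterval[OF int]) (use ab in auto)
  have "integral {a..b} ?F = integral {a..0} ?F + integral {0..b} ?F"
    by (rule Henstock_Kurzweil_Integration.integral_combine[symmetric]) (use ab int in auto)
  moreover have "((\<lambda>x. ?F x - deriv \<sigma> x * ?F (\<sigma> x)) has_integral integral {0..b} ?F - - integral {a..0} ?F) {0..b}"
    by (rule has_integral_diff[OF right left])
  moreover have "integral {0..b} (\<lambda>x. ?F x - deriv \<sigma> x * ?F (\<sigma> x)) = integral {0..b} (\<lambda>x. folded \<sigma> \<phi> x * (h - A x) powr p)"
  proof (rule integral_cong)
    fix x assume "x \<in> {0..b}"
    then have "A (\<sigma> x) = A x" using A_\<sigma> sub0 by blast
    then show "?F x - deriv \<sigma> x * ?F (\<sigma> x) = folded \<sigma> \<phi> x * (h - A x) powr p"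
      by (simp add: folded_def algebra_simps)
  qed
  ultimately show ?thesis by (simp add: integral_unique)
qed

end

end

section \<open>Fractional integrals of linear combinations, and the main result\<close>

context energy_branch
begin

lemma J_lin_comb:
  assumes p: "0 < p" and g: "\<And>j. j < k \<Longrightarrow> continuous_on (insert 0 X) (g j)" and h: "h \<in> H"
  shows "J p (lin_comb k \<alpha> g) h = lin_comb k \<alpha> (\<lambda>j. J p (g j)) h"
proof -
  have y: "\<xi> h \<in> X" "h \<le> A (\<xi> h)" using \<xi>_in_X[OF h] A_\<xi>[OF h] by auto
  have cont: "continuous_on (insert 0 X) (lin_comb k \<alpha> g)"
    unfolding lin_comb_def by (intro continuous_intros g) auto
  have "J p (lin_comb k \<alpha> g) h = integral {0..\<xi> h} (\<lambda>x. lin_comb k \<alpha> g x * kernel p h x)"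
    by (rule J_truncated[OF p cont y]) (use h in simp)
  also have "\<dots> = integral {0..\<xi> h} (\<lambda>x. \<Sum>j<k. \<alpha> j * (g j x * kernel p h x))"
    by (simp add: lin_comb_def sum_distrib_right mult.assoc)
  also have "\<dots> = (\<Sum>j<k. integral {0..\<xi> h} (\<lambda>x. \<alpha> j * (g j x * kernel p h x)))"
    by (intro integral_sum integrable_on_mult_right kernel_integrable[OF p g y(1)]) auto
  also have "\<dots> = lin_comb k \<alpha> (\<lambda>j. J p (g j)) h"
    unfolding lin_comb_def
  proof (intro sum.cong refl)
    fix j assume "j \<in> {..<k}"
    then have "J p (g j) h = integral {0..\<xi> h} (\<lambda>x. g j x * kernel p h x)"
      by (intro J_truncated[OF p g y]) (use h in auto)
    then show "integral {0..\<xi> h} (\<lambda>x. \<alpha> j * (g j x * kernel p h x)) = \<alpha> j * J p (g j) h"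
      by simp
  qed
  finally show ?thesis .
qed

text \<open>
  Since \<open>A\<close> is increasing, \<open>A x - A s\<close> is a positive multiple of \<open>x - s\<close>.
\<close>

lemma sign_changes_in_energy:
  assumes S: "finite S" "S \<subseteq> X" and x: "x \<in> X" and nonneg: "0 \<le> v * (\<Prod>s\<in>S. x - s)"
  shows "0 \<le> v * (\<Prod>c\<in>A ` S. A x - c)"
proof -
  define r where "r = (\<lambda>s. if x = s then 1 else (A x - A s) / (x - s))"
  have r: "0 < r s" if "s \<in> S" for s
  proof (cases x s rule: linorder_cases)
    case less
    then have "A x < A s" using A_less[of x s] x S that by auto
    with less show ?thesis by (simp add: r_def divide_neg_neg)
  next
    case greater
    then have "A s < A x" using A_less[of s x] x S that by auto
    with greater show ?thesis by (simp add: r_def)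
  qed (simp add: r_def)
  have "inj_on A S" by (rule inj_on_subset[OF inj_A]) (use S in auto)
  then have "(\<Prod>c\<in>A ` S. A x - c) = (\<Prod>s\<in>S. A x - A s)" by (simp add: prod.reindex)
  also have "\<dots> = (\<Prod>s\<in>S. (x - s) * r s)" by (rule prod.cong) (auto simp: r_def)
  also have "\<dots> = (\<Prod>s\<in>S. x - s) * prod r S" by (rule prod.distrib)
  finally have eq: "v * (\<Prod>c\<in>A ` S. A x - c) = (v * (\<Prod>s\<in>S. x - s)) * prod r S" by simp
  have "0 \<le> prod r S" by (rule prod_nonneg) (use r in \<open>auto intro: less_imp_le\<close>)
  then show ?thesis unfolding eq using nonneg by (rule mult_nonneg_nonneg[rotated])
qed

text \<open>
  The energies of the sign changes of \<open>l\<close> are fed into \<open>J_zero_count\<close>.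
\<close>

theorem J_zeros_le_density_zeros:
  assumes p: "0 < p" "real n - 1 < p"
    and l: "l real_analytic_on X" and fin: "finite {x \<in> X. l x = 0}" and card: "card {x \<in> X. l x = 0} \<le> n"
    and g: "continuous_on (insert 0 X) g" "\<And>x. x \<in> X \<Longrightarrow> g x = deriv A x * l x"
  shows "finite {z \<in> H. J p g z = 0}"
    and "(\<Sum>z | z \<in> H \<and> J p g z = 0. zero_mult (J p g) z) \<le> n"
proof -
  obtain \<epsilon> S where \<epsilon>: "\<epsilon> \<in> {1, -1 :: real}" and S: "S \<subseteq> {x \<in> X. l x = 0}"
    and sgn: "\<And>x. x \<in> X \<Longrightarrow> 0 \<le> \<epsilon> * l x * (\<Prod>s\<in>S. x - s)"
    by (rule sign_changes[OF connected_X real_analytic_on_imp_continuous_on[OF l] fin]) (rule that)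
  have finS: "finite S" "S \<subseteq> X" using S fin by (auto intro: finite_subset)
  have cardS: "card (A ` S) \<le> n"
    using card_image_le[OF finS(1), of A] card_mono[OF fin S] card by linarith
  have g_analytic: "g real_analytic_on X"
    by (rule real_analytic_on_cong[OF real_analytic_on_mult[OF real_analytic_on_deriv[OF A_analytic] l] X_open])
       (simp add: g(2))
  have zeros: "{x \<in> X. g x = 0} = {x \<in> X. l x = 0}" using A'_pos g(2) by force
  have "finite {z \<in> H. J p g z = 0} \<and> (\<Sum>z | z \<in> H \<and> J p g z = 0. zero_mult (J p g) z) \<le> card (A ` S)
    \<and> (\<forall>z\<in>H. \<exists>k. (deriv ^^ k) (J p g) z \<noteq> 0)"
  proof (rule J_zero_count[OF _ _ p(1) _ g(1) g_analytic _ \<epsilon>])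
    show "finite (A ` S)" "A ` S \<subseteq> H" using finS by (auto simp: H_def)
    show "real (card (A ` S)) - 1 < p" using cardS p(2) by linarith
    show "finite {x \<in> X. g x = 0}" unfolding zeros by (rule fin)
    fix x assume x: "x \<in> X"
    have "0 \<le> \<epsilon> * l x * (\<Prod>c\<in>A ` S. A x - c)"
      by (rule sign_changes_in_energy[OF finS x sgn[OF x]])
    then have "0 \<le> deriv A x * (\<epsilon> * l x * (\<Prod>c\<in>A ` S. A x - c))" using A'_pos[OF x] by simp
    then show "0 \<le> \<epsilon> * g x * (\<Prod>c\<in>A ` S. A x - c)" by (simp add: g(2)[OF x] mult_ac)
  qed
  then show "finite {z \<in> H. J p g z = 0}"
    "(\<Sum>z | z \<in> H \<and> J p g z = 0. zero_mult (J p g) z) \<le> n" using cardS by auto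
qed

end

theorem theorem2:
  fixes A B \<sigma> :: "real \<Rightarrow> real" and m s n :: nat
    and \<gamma> :: "real \<Rightarrow> real \<Rightarrow> complex" and xl xr h0 :: ereal
    and f :: "nat \<Rightarrow> real \<Rightarrow> real"
  assumes "period_annulus A B m \<gamma> xl xr h0"
    and "1 \<le> s"
    and "\<And>i. i < n \<Longrightarrow> f i real_analytic_on einterval xl xr"
    and "associated_involution A (einterval xl xr) \<sigma>"
    and "int s > int m * (int n - 2)"
    and "CT_system n
      (\<lambda>i. balance \<sigma> (\<lambda>x. f i x / (deriv A x * B x powr ((2 * real s - 1) / (2 * real m)))))
      (einterval 0 xr)"
  shows "ECT_system n (\<lambda>i. abelian_integral (f i) s \<gamma>) (einterval 0 h0)"
proof -
  interpret period_annulus A B m \<gamma> xl xr h0 by fact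
  interpret energy_branch "einterval 0 xr" A by (rule energy_branch_right)
  define p where "p = (2 * real s - 1) / (2 * real m)"
  let ?X = "einterval 0 xr" and ?I = "\<lambda>i. abelian_integral (f i) s \<gamma>"
  have H: "H = einterval 0 h0" unfolding H_def by (rule energies)
  have p: "0 < p" using \<open>1 \<le> s\<close> m_pos by (simp add: p_def)
  have p_n: "real n - 2 < p"
  proof -
    have "int m * (int n - 2) + 1 \<le> int s" using assms(5) by simp
    then have "real_of_int (int m * (int n - 2) + 1) \<le> real_of_int (int s)" by (simp only: of_int_le_iff)
    then have "real m * (real n - 2) + 1 \<le> real s" by simp
    then have "(real n - 2) * (2 * real m) < 2 * real s - 1" by (simp add: algebra_simps)
    then show ?thesis using m_pos unfolding p_def by (simp add: pos_less_divide_eq)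
  qed
  obtain w where w: "w \<noteq> 0" "\<And>h. h \<in> einterval 0 h0 \<Longrightarrow> Re (winding_number (\<gamma> h) 0) = w"
    by (rule winding_number_constant) (rule that)
  define \<phi> where "\<phi> = (\<lambda>i x. f i x / B x powr p)"
  define g where "g = (\<lambda>i. folded \<sigma> (\<phi> i))"
  define l where "l = (\<lambda>i. balance \<sigma> (\<lambda>x. f i x / (deriv A x * B x powr p)))"
  have sub: "insert 0 ?X \<subseteq> base" using zero_in_base by (auto simp: right_half)
  have f_cont: "continuous_on base (f i)" if "i < n" for i
    by (rule real_analytic_on_imp_continuous_on[OF assms(3)[OF that]])
  have \<phi>_cont: "continuous_on base (\<phi> i)" if "i < n" for i
    unfolding \<phi>_def
    by (intro continuous_intros f_cont[OF that] real_analytic_on_imp_continuous_on[OF B_analytic])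
       (use B_pos in force)+
  have g_cont: "continuous_on (insert 0 ?X) (g i)" if "i < n" for i
    unfolding g_def by (rule continuous_on_subset[OF folded_continuous[OF assms(4) \<phi>_cont[OF that]] sub])
  have g_l: "g i x = deriv A x * l i x" if "x \<in> ?X" for i x
    using folded_eq_balance[OF assms(4) that, of "\<phi> i"]
    by (simp add: g_def l_def \<phi>_def balance_def mult.commute)
  have I_eq: "?I i h = - 2 * w * J p (g i) h" if i: "i < n" and h: "h \<in> H" for i h
  proof -
    have h': "h \<in> einterval 0 h0" using h H by simp
    obtain a b where ab: "a < 0" "0 < b" "a \<in> base" "b \<in> base" "A a = h" "A b = h"
      by (rule oval_endpoints[OF h']) (rule that)
    have A_le: "A x \<le> h" "0 < B x" if "x \<in> {a..b}" for x
    proof -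
      have "x \<in> base" using interval_einterval[OF ab(3,4)] that by blast
      then show "0 < B x" by (rule B_pos)
      show "A x \<le> h"
        using A_mono_right[of x b] A_mono_left[of a x] ab that by (cases "0 \<le> x") simp_all
    qed
    have "?I i h = - 2 * w * integral {a..b} (\<lambda>x. f i x * ((h - A x) / B x) powr p)"
      using abelian_integral_as_real_integral(1)[OF h' ab f_cont[OF i] \<open>1 \<le> s\<close>] w(2)[OF h']
      by (simp add: p_def)
    also have "integral {a..b} (\<lambda>x. f i x * ((h - A x) / B x) powr p)
        = integral {a..b} (\<lambda>x. \<phi> i x * (h - A x) powr p)"
      by (rule integral_cong) (use A_le in \<open>simp add: \<phi>_def powr_divide less_imp_le\<close>)
    also have "\<dots> = integral {0..b} (\<lambda>x. g i x * (h - A x) powr p)"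
      unfolding g_def by (rule integral_fold[OF assms(4) ab \<phi>_cont[OF i] p])
    also have "\<dots> = J p (g i) h"
    proof -
      have "b \<in> ?X" using ab by (simp add: right_half)
      then have "\<xi> h = b" using \<xi>_A[of b] ab by simp
      then show ?thesis by (simp add: J_def)
    qed
    finally show ?thesis .
  qed
  have CT: "T_system k l ?X" if "k \<in> {1..n}" for k
    using assms(6) that unfolding CT_system_def l_def p_def by blast
  have l_analytic: "l i real_analytic_on ?X" if "i < n" for i
    using CT[of n] that unfolding T_system_def by auto
  have g_analytic: "g i real_analytic_on ?X" if "i < n" for i
    by (rule real_analytic_on_cong[OF real_analytic_on_mult[OF
          real_analytic_on_deriv[OF energy_branch.A_analytic[OF energy_branch_right]] l_analytic[OF that]] X_open])
       (simp add: g_l)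
  have I_analytic: "?I i real_analytic_on einterval 0 h0" if "i < n" for i
    unfolding H[symmetric]
    by (rule real_analytic_on_cong[OF real_analytic_on_mult[OF real_analytic_on_const
          J_analytic[OF p g_cont[OF that] g_analytic[OF that]]] H_open])
       (rule I_eq[OF that, symmetric])
  have count: "(\<exists>h\<in>H. lin_comb k \<alpha> ?I h \<noteq> 0) \<and> finite (isolated_zeros (lin_comb k \<alpha> ?I) H) \<and>
      (\<Sum>h\<in>isolated_zeros (lin_comb k \<alpha> ?I) H. zero_mult (lin_comb k \<alpha> ?I) h) < k"
    if k: "k \<in> {1..n}" and \<alpha>: "\<exists>j<k. \<alpha> j \<noteq> 0" for k \<alpha>
  proof -
    \<comment> \<open>The common nonzero factor of the integrals is moved into the coefficients.\<close>
    define \<beta> where "\<beta> = (\<lambda>j. - 2 * w * \<alpha> j)"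
    have \<beta>: "\<exists>j<k. \<beta> j \<noteq> 0" using \<alpha> w(1) by (auto simp: \<beta>_def)
    define L where "L = lin_comb k \<beta> l"
    define G where "G = lin_comb k \<beta> g"
    have T: "\<exists>x\<in>?X. L x \<noteq> 0" "finite (isolated_zeros L ?X)" "card (isolated_zeros L ?X) < k"
      using CT[OF k] \<beta> unfolding T_system_def L_def by blast+
    have L_analytic: "L real_analytic_on ?X"
      unfolding L_def by (rule real_analytic_on_lin_comb) (use l_analytic k in auto)
    have iso: "isolated_zeros L ?X = {x \<in> ?X. L x = 0}"
      using T(1) real_analytic_zeros_isolated[OF L_analytic X_open connected_X] by blast
    have G_cont: "continuous_on (insert 0 ?X) G"
      unfolding G_def lin_comb_def by (intro continuous_intros g_cont) (use k in auto)
    have GL: "G x = deriv A x * L x" if "x \<in> ?X" for x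
      by (simp add: G_def L_def lin_comb_def g_l[OF that] sum_distrib_left mult_ac)
    have bounds: "finite {z \<in> H. J p G z = 0}" "(\<Sum>z | z \<in> H \<and> J p G z = 0. zero_mult (J p G) z) \<le> k - 1"
      using J_zeros_le_density_zeros[OF p, of "k - 1" L G] L_analytic G_cont GL T p_n k
      unfolding iso by auto
    have eq: "lin_comb k \<alpha> ?I h = J p G h" if "h \<in> H" for h
    proof -
      have "lin_comb k \<alpha> ?I h = (\<Sum>j<k. \<alpha> j * (- 2 * w * J p (g j) h))"
        unfolding lin_comb_def by (rule sum.cong) (use I_eq that k in auto)
      also have "\<dots> = lin_comb k \<beta> (\<lambda>j. J p (g j)) h"
        unfolding lin_comb_def \<beta>_def by (rule sum.cong) simp_all
      also have "\<dots> = J p G h"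
        unfolding G_def by (rule J_lin_comb[symmetric, OF p g_cont that]) (use k in auto)
      finally show ?thesis .
    qed
    have mult: "zero_mult (lin_comb k \<alpha> ?I) h = zero_mult (J p G) h" if "h \<in> H" for h
      unfolding zero_mult_def using higher_deriv_cong_open[OF H_open eq that] by simp
    have iso_sub: "isolated_zeros (lin_comb k \<alpha> ?I) H \<subseteq> {z \<in> H. J p G z = 0}"
      using eq by (auto simp: isolated_zeros_def isolated_in_def)
    have "infinite H"
    proof -
      have "H \<noteq> {}" using H einterval_nonempty[OF h0_pos] by auto
      with H_open show ?thesis using finite_imp_not_open by blast
    qed
    then have "\<not> H \<subseteq> {z \<in> H. J p G z = 0}" using bounds(1) finite_subset by blast
    then have "\<exists>h\<in>H. lin_comb k \<alpha> ?I h \<noteq> 0" using eq by auto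
    moreover have "finite (isolated_zeros (lin_comb k \<alpha> ?I) H)"
      by (rule finite_subset[OF iso_sub bounds(1)])
    moreover have "(\<Sum>h\<in>isolated_zeros (lin_comb k \<alpha> ?I) H. zero_mult (lin_comb k \<alpha> ?I) h) < k"
    proof -
      have "(\<Sum>h\<in>isolated_zeros (lin_comb k \<alpha> ?I) H. zero_mult (lin_comb k \<alpha> ?I) h)
          = (\<Sum>h\<in>isolated_zeros (lin_comb k \<alpha> ?I) H. zero_mult (J p G) h)"
        by (rule sum.cong) (use iso_sub mult in auto)
      also have "\<dots> \<le> (\<Sum>z | z \<in> H \<and> J p G z = 0. zero_mult (J p G) z)"
        by (rule sum_mono2[OF bounds(1) iso_sub]) simp
      also have "\<dots> \<le> k - 1" by (rule bounds(2))
      finally show ?thesis using k by auto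
    qed
    ultimately show ?thesis by blast
  qed
  show ?thesis
    unfolding ECT_system_def H[symmetric] using I_analytic count unfolding H[symmetric] by blast
qed

end
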